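(* Let $p$ be a prime and $n$ a natural number. Assume that a finite group $G$ is weakly tame at $p$ and contains an element of order $p^n$. Let $K$ be a field of characteristic $0$. If Ledet's conjecture holds for the cyclic group $C_{p^n}$ of order $p^n$, i.e. if $\operatorname{ed}_k(C_{p^n}) = n$ for every field $k$ of characteristic $p$, then $$\operatorname{ed}_K(G) \geq n .$$
   Context: A finite group $G$ is weakly tame at a prime $p$ if $G$ contains no non-trivial normal $p$-subgroup. For a field $F$ and a finite group $G$, $\operatorname{ed}_F(G)$ denotes the essential dimension of $G$ over $F$: it is the supremum, over all field extensions $M/F$ and all $G$-torsors $T \to \operatorname{Spec} M$, of the minimum of $\operatorname{trdeg}_F M_0$ over intermediate fields $F \subseteq M_0 \subseteq M$ such that $T$ is isomorphic to the pullback of a $G$-torsor over $\operatorname{Spec} M_0$. Equivalently, if $V$ is the regular representation of $G$ over $F$, then $\operatorname{ed}_F(G)$ is the minimal value of $\operatorname{trdeg}_F(L)$ as $L$ ranges over the $G$-invariant intermediate fields $F \subseteq L \subseteq F(V)$ on which $G$ acts faithfully. Ledet's conjecture asserts: if $k$ is a field of characteristic $p > 0$, $n$ is a natural number, and $C_{p^n}$ is a cyclic group of order $p^n$, then $\operatorname{ed}_k(C_{p^n}) = n$. In this statement it is used only as an explicit hypothesis. *)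

theory Defs
  imports "HOL-Algebra.Algebra" "HOL-Library.Extended_Nat"
begin

section \<open>Rational functions in several variables\<close>

text \<open>
  Following \<^theory>\<open>HOL-Algebra.Indexed_Polynomials\<close>, a polynomial in variables indexed by \<open>I\<close>
  is the function taking a monomial (a multiset of indices) to its coefficient.  The library
  provides the carrier, the constants and the addition, but not the product.
\<close>

definition mpoly_ring :: "('a, 'm) ring_scheme \<Rightarrow> 'v set \<Rightarrow> ('v multiset \<Rightarrow> 'a) ring" where
  "mpoly_ring R I =
    \<lparr> carrier = ring.indexed_pset R I (carrier R),
      monoid.mult = (\<lambda>P Q m. \<Oplus>\<^bsub>R\<^esub>a\<in>{a. a \<subseteq># m}. P a \<otimes>\<^bsub>R\<^esub> Q (m - a)),
      one = ring.indexed_const R \<one>\<^bsub>R\<^esub>,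
      ring.zero = ring.indexed_const R \<zero>\<^bsub>R\<^esub>,
      ring.add = ring.indexed_padd R \<rparr>"

text \<open>The fraction \<open>a / b\<close>, as the class of all pairs \<open>(c, d)\<close> with \<open>c / d = a / b\<close>.\<close>

definition fraction :: "('a, 'm) ring_scheme \<Rightarrow> 'a \<Rightarrow> 'a \<Rightarrow> ('a \<times> 'a) set" where
  "fraction R a b =
    {(c, d). c \<in> carrier R \<and> d \<in> carrier R - {\<zero>\<^bsub>R\<^esub>} \<and> a \<otimes>\<^bsub>R\<^esub> d = c \<otimes>\<^bsub>R\<^esub> b}"

definition frac_field :: "('a, 'm) ring_scheme \<Rightarrow> ('a \<times> 'a) set ring" where
  "frac_field R =
    \<lparr> carrier = {fraction R a b | a b. a \<in> carrier R \<and> b \<in> carrier R - {\<zero>\<^bsub>R\<^esub>}},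
      monoid.mult = (\<lambda>A B. \<Union> {fraction R (a \<otimes>\<^bsub>R\<^esub> c) (b \<otimes>\<^bsub>R\<^esub> d) | a b c d.
        (a, b) \<in> A \<and> (c, d) \<in> B}),
      one = fraction R \<one>\<^bsub>R\<^esub> \<one>\<^bsub>R\<^esub>,
      ring.zero = fraction R \<zero>\<^bsub>R\<^esub> \<one>\<^bsub>R\<^esub>,
      ring.add = (\<lambda>A B. \<Union> {fraction R (a \<otimes>\<^bsub>R\<^esub> d \<oplus>\<^bsub>R\<^esub> c \<otimes>\<^bsub>R\<^esub> b) (b \<otimes>\<^bsub>R\<^esub> d) | a b c d.
        (a, b) \<in> A \<and> (c, d) \<in> B}) \<rparr>"


section \<open>Transcendence degree\<close>

definition mpoly_eval ::
    "('a, 'm) ring_scheme \<Rightarrow> ('v \<Rightarrow> 'a) \<Rightarrow> ('v multiset \<Rightarrow> 'a) \<Rightarrow> 'a" where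
  "mpoly_eval R f P =
    (\<Oplus>\<^bsub>R\<^esub>m\<in>{m. P m \<noteq> \<zero>\<^bsub>R\<^esub>}.
       P m \<otimes>\<^bsub>R\<^esub> finprod R (\<lambda>x. f x [^]\<^bsub>R\<^esub> count m x) (set_mset m))"

text \<open>The elements of \<open>S\<close> index the variables, and each variable is evaluated at its own index.\<close>

definition alg_independent :: "('a, 'm) ring_scheme \<Rightarrow> 'a set \<Rightarrow> 'a set \<Rightarrow> bool" where
  "alg_independent E K S \<longleftrightarrow>
    S \<subseteq> carrier E \<and>
    (\<forall>P \<in> ring.indexed_pset E S K.
       mpoly_eval E (\<lambda>x. x) P = \<zero>\<^bsub>E\<^esub> \<longrightarrow> P = ring.indexed_const E \<zero>\<^bsub>E\<^esub>)"

text \<open>The transcendence degree of \<open>L\<close> over \<open>K\<close>, where \<open>K \<subseteq> L\<close> are subfields of \<open>E\<close>.\<close>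

definition trdeg :: "('a, 'm) ring_scheme \<Rightarrow> 'a set \<Rightarrow> 'a set \<Rightarrow> enat" where
  "trdeg E K L = (SUP S\<in>{S. S \<subseteq> L \<and> finite S \<and> alg_independent E K S}. enat (card S))"


section \<open>The regular representation and essential dimension\<close>

text \<open>
  For the regular representation \<open>V\<close> of \<open>G\<close> over \<open>F\<close>, the field \<open>F(V)\<close> is the field of rational
  functions in the coordinates \<open>x\<^sub>h\<close>, \<open>h \<in> G\<close>, and \<open>g \<in> G\<close> acts by \<open>x\<^sub>h \<mapsto> x\<^sub>g\<^sub>h\<close>.  Hence the coefficient of
  \<open>g P\<close> at a monomial \<open>m\<close> is that of \<open>P\<close> at \<open>g\<^sup>-\<^sup>1 m\<close>.
\<close>

definition regular_poly_act ::
    "('a, 'm) ring_scheme \<Rightarrow> ('g, 'n) monoid_scheme \<Rightarrow> 'g \<Rightarrow>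
     ('g multiset \<Rightarrow> 'a) \<Rightarrow> ('g multiset \<Rightarrow> 'a)" where
  "regular_poly_act F G g P =
    (\<lambda>m. if set_mset m \<subseteq> carrier G then P (image_mset (\<lambda>h. inv\<^bsub>G\<^esub> g \<otimes>\<^bsub>G\<^esub> h) m) else \<zero>\<^bsub>F\<^esub>)"

type_synonym ('g, 'a) ratfun = "(('g multiset \<Rightarrow> 'a) \<times> ('g multiset \<Rightarrow> 'a)) set"

definition regular_field ::
    "('a, 'm) ring_scheme \<Rightarrow> ('g, 'n) monoid_scheme \<Rightarrow> ('g, 'a) ratfun ring" where
  "regular_field F G = frac_field (mpoly_ring F (carrier G))"

definition regular_const ::
    "('a, 'm) ring_scheme \<Rightarrow> ('g, 'n) monoid_scheme \<Rightarrow> ('g, 'a) ratfun set" where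
  "regular_const F G =
    (\<lambda>c. fraction (mpoly_ring F (carrier G)) (ring.indexed_const F c) (ring.indexed_const F \<one>\<^bsub>F\<^esub>))
      ` carrier F"

definition regular_act ::
    "('a, 'm) ring_scheme \<Rightarrow> ('g, 'n) monoid_scheme \<Rightarrow> 'g \<Rightarrow> ('g, 'a) ratfun \<Rightarrow> ('g, 'a) ratfun" where
  "regular_act F G g f = map_prod (regular_poly_act F G g) (regular_poly_act F G g) ` f"

text \<open>
  The intermediate fields \<open>F \<subseteq> L \<subseteq> F(V)\<close> that are \<open>G\<close>-invariant and on which \<open>G\<close> acts faithfully;
  invariance is the requirement that every \<open>g\<close> restricts to a bijection of \<open>L\<close>, which is part of
  \<^const>\<open>group_action\<close>.
\<close>

definition faithful_intermediate_fields ::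
    "('a, 'm) ring_scheme \<Rightarrow> ('g, 'n) monoid_scheme \<Rightarrow> ('g, 'a) ratfun set set" where
  "faithful_intermediate_fields F G =
    {L. subfield L (regular_field F G) \<and> regular_const F G \<subseteq> L \<and>
        faithful_action G L (\<lambda>g. restrict (regular_act F G g) L)}"

text \<open>The infimum is a minimum, because \<^typ>\<open>enat\<close> is well-ordered and \<open>L = F(V)\<close> is admissible.\<close>

definition essential_dimension ::
    "('a, 'm) ring_scheme \<Rightarrow> ('g, 'n) monoid_scheme \<Rightarrow> enat" where
  "essential_dimension F G =
    (INF L\<in>faithful_intermediate_fields F G. trdeg (regular_field F G) (regular_const F G) L)"


section \<open>Characteristic and weak tameness\<close>

text \<open>The additive order of \<open>1\<close>; \<^const>\<open>group.ord\<close> is \<open>0\<close> for elements of infinite order.\<close>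

definition ring_char :: "('a, 'm) ring_scheme \<Rightarrow> nat" where
  "ring_char R = group.ord (add_monoid R) \<one>\<^bsub>R\<^esub>"

definition weakly_tame :: "nat \<Rightarrow> ('g, 'n) monoid_scheme \<Rightarrow> bool" where
  "weakly_tame p G \<longleftrightarrow> (\<forall>N. N \<lhd> G \<and> (\<exists>k. card N = p ^ k) \<longrightarrow> N = {\<one>\<^bsub>G\<^esub>})"

end

theory Submission
  imports Defs
begin

text \<open>
  The essential dimension is an infimum over the faithful \<open>G\<close>-invariant fields \<open>K \<subseteq> L \<subseteq> K(V)\<close>.  From each
  such \<open>L\<close> a field \<open>k\<close> of characteristic \<open>p\<close> and a faithful invariant field \<open>k \<subseteq> L' \<subseteq> k(W)\<close> are constructed,
  where \<open>W\<close> is the regular representation of the cyclic group \<open>C\<close> of order \<open>p^n\<close>, such that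
  \<open>trdeg L' \<le> trdeg L\<close>.  The hypothesis on \<open>C\<close> then gives \<open>n \<le> trdeg L'\<close>.

  For each \<open>g \<noteq> 1\<close> some element of \<open>L\<close> is moved by \<open>g\<close>.  The coefficients of these
  elements generate a countable subfield \<open>T\<close> of \<open>K\<close>.  A subring \<open>A\<close> of \<open>T\<close> that is maximal among those without
  \<open>1/p\<close> is a valuation ring, and its residue field \<open>k\<close> is countable of characteristic \<open>p\<close>, hence it
  can be realised on any infinite type.  Reducing coefficients gives the Gauss valuation: a local ring of
  fractions \<open>a/b\<close> with \<open>a, b \<in> A[V]\<close> and \<open>b\<close> not reducing to \<open>0\<close>, with a \<open>G\<close>-equivariant residue map to \<open>k(V)\<close>.

  Let \<open>I\<close> consist of the elements of \<open>G\<close> that act trivially on the residue field of \<open>L\<close>; it is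
  normal.  Every nonzero element of \<open>T(V)\<close> is a constant, fixed by \<open>G\<close>, times a unit of the Gauss
  valuation, and therefore every \<open>g \<in> I\<close> satisfies \<open>g x / x \<equiv> 1\<close> for \<open>x \<in> L \<inter> T(V)\<close>.  If a prime \<open>q \<noteq> p\<close>
  divided the order of \<open>I\<close>, then for a subgroup \<open>J \<subseteq> I\<close> of order \<open>q\<close> the sum of the conjugates \<open>h x\<close>, \<open>h \<in> J\<close>, would be
  \<open>q x\<close> up to a factor congruent to \<open>1\<close>; but for \<open>x = g f - f \<noteq> 0\<close> this sum is \<open>0\<close>
  (\<open>inertia_prime_divisor\<close>).  So \<open>I\<close> is a normal \<open>p\<close>-subgroup, which is trivial by weak tameness.

  Write the elements of \<open>G\<close> as \<open>c t\<close> with \<open>c \<in> C\<close> and \<open>t\<close> in a set of representatives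
  numbered by \<open>e t\<close>.  The substitution of the power \<open>x\<^sub>c ^ (N ^ e t)\<close> for \<open>x\<^sub>c\<^sub>t\<close> is \<open>C\<close>-equivariant from
  \<open>k[V]\<close> to \<open>k[W]\<close>, and for large \<open>N\<close> it is injective on any given finite set of monomials, because multiplicities
  become digits in base \<open>N\<close>.  It thus keeps nonzero the finitely many polynomials
  which witness that \<open>C\<close> acts faithfully on the residue field of \<open>L\<close>.  The composite of the two reductions is again
  the residue map of a local ring \<open>O\<close> in \<open>K(V)\<close>; because that ring is local, the image \<open>L'\<close> of \<open>L \<inter> O\<close> is a
  field (\<open>residue_subfield\<close>).

  Algebraically independent elements of \<open>L'\<close> lift to \<open>L\<close>, and the lifts are independent
  over \<open>K\<close> (\<open>trdeg_residue_le\<close>): a linear relation between monomials in the lifts with coefficients in \<open>K\<close> is sent by a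
  \<open>T\<close>-linear functional \<open>K \<rightarrow> T\<close> to one with coefficients in \<open>T\<close>, which after scaling has coefficients in \<open>A\<close>,
  not all reducing to \<open>0\<close> (\<open>relation_descends\<close>).
\<close>

section \<open>Families of coefficients collected along a map\<close>

lemma (in comm_monoid) finprod_group_by:
  assumes "finite W" "finite V" "w ` W \<subseteq> V" "f \<in> W \<rightarrow> carrier G"
  shows "finprod G f W = finprod G (\<lambda>v. finprod G f {i \<in> W. w i = v}) V"
proof -
  have "finprod G f (\<Union>v\<in>V. {i \<in> W. w i = v}) = finprod G (\<lambda>v. finprod G f {i \<in> W. w i = v}) V"
    using assms by (intro finprod_UN_disjoint) (auto simp: pairwise_def disjnt_def)
  moreover have "(\<Union>v\<in>V. {i \<in> W. w i = v}) = W" using assms by auto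
  ultimately show ?thesis by simp
qed

lemmas (in abelian_monoid) finsum_group_by = add.finprod_group_by
lemmas (in abelian_monoid) finsum_mono_neutral_cong_left = add.finprod_mono_neutral_cong_left

lemma (in abelian_monoid) finsum_times:
  assumes "finite A" "finite B" "\<And>i j. i \<in> A \<Longrightarrow> j \<in> B \<Longrightarrow> h i j \<in> carrier G"
  shows "(\<Oplus>i\<in>A. \<Oplus>j\<in>B. h i j) = finsum G (\<lambda>(i, j). h i j) (A \<times> B)"
proof -
  have "finsum G (\<lambda>(i, j). h i j) (A \<times> B)
      = (\<Oplus>i\<in>A. finsum G (\<lambda>(i, j). h i j) {x \<in> A \<times> B. fst x = i})"
    by (rule finsum_group_by[where w = fst]) (use assms in auto)
  also have "\<dots> = (\<Oplus>i\<in>A. \<Oplus>j\<in>B. h i j)"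
  proof (rule finsum_cong'[OF refl])
    show "(\<lambda>i. \<Oplus>j\<in>B. h i j) \<in> A \<rightarrow> carrier G" using assms by (auto intro!: finsum_closed)
    fix i assume i: "i \<in> A"
    have eq: "{x \<in> A \<times> B. fst x = i} = Pair i ` B" using i by auto
    show "finsum G (\<lambda>(i, j). h i j) {x \<in> A \<times> B. fst x = i} = (\<Oplus>j\<in>B. h i j)"
      unfolding eq using assms i by (subst finsum_reindex) (auto simp: inj_on_def)
  qed
  finally show ?thesis by simp
qed

text \<open>
  The push-forward of a family \<open>F\<close> of coefficients along \<open>w\<close>.  A polynomial is collected from its own support
  along the identity, and products, group actions and reductions of collected families are collected families again.
  Ring laws and homomorphism laws for polynomials thereby become reindexings of finite families.
\<close>

definition collect ::
    "('a, 'm) ring_scheme \<Rightarrow> 'i set \<Rightarrow> ('i \<Rightarrow> 'a) \<Rightarrow> ('i \<Rightarrow> 'v) \<Rightarrow> 'v \<Rightarrow> 'a" where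
  "collect R W F w = (\<lambda>m. \<Oplus>\<^bsub>R\<^esub>i\<in>{i\<in>W. w i = m}. F i)"

context abelian_monoid begin

lemma collect_support: "collect G W F w m \<noteq> \<zero> \<Longrightarrow> m \<in> w ` W"
proof (rule ccontr)
  assume "collect G W F w m \<noteq> \<zero>" "m \<notin> w ` W"
  then have "{i\<in>W. w i = m} = {}" by auto
  with \<open>collect G W F w m \<noteq> \<zero>\<close> show False unfolding collect_def by simp
qed

lemma collect_cong:
  "W = W' \<Longrightarrow> F' \<in> W' \<rightarrow> carrier G \<Longrightarrow> (\<And>i. i \<in> W' \<Longrightarrow> F i = F' i) \<Longrightarrow> (\<And>i. i \<in> W' \<Longrightarrow> w i = w' i)
   \<Longrightarrow> collect G W F w = collect G W' F' w'"
  unfolding collect_def by (rule ext, rule finsum_cong') auto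

lemma collect_reindex:
  assumes "inj_on h A" "F \<in> h ` A \<rightarrow> carrier G"
  shows "collect G (h ` A) F w = collect G A (\<lambda>i. F (h i)) (\<lambda>i. w (h i))"
proof
  fix m
  have eq: "{i \<in> h ` A. w i = m} = h ` {i \<in> A. w (h i) = m}" by auto
  show "collect G (h ` A) F w m = collect G A (\<lambda>i. F (h i)) (\<lambda>i. w (h i)) m"
    unfolding collect_def eq using assms
    by (subst finsum_reindex) (auto intro: inj_on_subset)
qed

lemma collect_self:
  assumes "finite W" "\<And>m. P m \<noteq> \<zero> \<Longrightarrow> m \<in> W" "\<And>m. P m \<in> carrier G"
  shows "collect G W P (\<lambda>m. m) = P"
proof
  fix m
  have "{i \<in> W. i = m} = (if m \<in> W then {m} else {})" by auto
  then show "collect G W P (\<lambda>m. m) m = P m"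
    using assms by (auto simp: collect_def finsum_insert)
qed

lemma collect_add:
  assumes "F \<in> W \<rightarrow> carrier G" "F' \<in> W \<rightarrow> carrier G"
  shows "collect G W (\<lambda>i. F i \<oplus> F' i) w m = collect G W F w m \<oplus> collect G W F' w m"
  unfolding collect_def using assms by (intro finsum_addf) auto

end

section \<open>Polynomial rings\<close>

definition supported :: "('a, 'm) ring_scheme \<Rightarrow> 'v set \<Rightarrow> 'a set \<Rightarrow> ('v multiset \<Rightarrow> 'a) \<Rightarrow> bool" where
  "supported R I A P \<longleftrightarrow> finite {m. P m \<noteq> \<zero>\<^bsub>R\<^esub>} \<and> range P \<subseteq> A \<and> (\<forall>m. P m \<noteq> \<zero>\<^bsub>R\<^esub> \<longrightarrow> set_mset m \<subseteq> I)"

text \<open>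
  The inductively generated polynomials are sums of monomials, so they are the functions of finite
  support with coefficients in \<open>A\<close> and monomials over \<open>I\<close>.
\<close>

lemma (in ring) indexed_pset_iff:
  assumes A: "subring A R"
  shows "P \<in> indexed_pset I A \<longleftrightarrow> supported R I A P"
proof
  assume "P \<in> indexed_pset I A"
  then show "supported R I A P"
  proof induction
    case (indexed_const k)
    then show ?case using subringE(2)[OF A]
      by (auto simp: supported_def indexed_const_def intro: finite_subset[of _ "{{#}}"])
  next
    case (indexed_padd P Q)
    have "finite {m. P m \<oplus> Q m \<noteq> \<zero>}"
      by (rule finite_subset[of _ "{m. P m \<noteq> \<zero>} \<union> {m. Q m \<noteq> \<zero>}"])
         (use indexed_padd.IH in \<open>auto simp: supported_def\<close>)
    then show ?case using indexed_padd.IH subringE(7)[OF A]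
      by (auto simp: supported_def indexed_padd_def image_subset_iff) (metis l_zero zero_closed subsetD)+
  next
    case (indexed_pmult P i)
    have "finite {m. indexed_pmult P i m \<noteq> \<zero>}"
      by (rule finite_subset[of _ "(\<lambda>m. m + {#i#}) ` {m. P m \<noteq> \<zero>}"])
         (use indexed_pmult.IH in \<open>auto simp: supported_def indexed_pmult_def image_iff split: if_splits
            intro!: exI[of _ "_ - {#i#}"]\<close>)
    moreover have "set_mset m \<subseteq> I" if "indexed_pmult P i m \<noteq> \<zero>" for m
    proof -
      have im: "i \<in># m" and "P (m - {#i#}) \<noteq> \<zero>"
        using that by (auto simp: indexed_pmult_def split: if_splits)
      then have "set_mset (m - {#i#}) \<subseteq> I" using indexed_pmult.IH unfolding supported_def by blast
      moreover have "m = add_mset i (m - {#i#})" using im by simp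
      then have "set_mset m = insert i (set_mset (m - {#i#}))" by (metis set_mset_add_mset_insert)
      ultimately show ?thesis using indexed_pmult.hyps by auto
    qed
    ultimately show ?case using indexed_pmult.IH subringE(2)[OF A]
      by (auto simp: supported_def indexed_pmult_def)
  qed
next
  have AR: "A \<subseteq> carrier R" using subringE(1)[OF A] .
  have zeroA: "\<zero> \<in> A" using subringE(2)[OF A] .
  have mono: "(\<lambda>m'. if m' = m then c else \<zero>) \<in> indexed_pset I A"
    if "c \<in> A" "set_mset m \<subseteq> I" for c m
    using that(2)
  proof (induction m)
    case empty
    show ?case using indexed_pset.indexed_const[OF that(1)] by (simp add: indexed_const_def)
  next
    case (add x m)
    have "indexed_pmult (\<lambda>m'. if m' = m then c else \<zero>) x \<in> indexed_pset I A"
      using add by (intro indexed_pset.indexed_pmult) auto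
    moreover have "indexed_pmult (\<lambda>m'. if m' = m then c else \<zero>) x
        = (\<lambda>m'. if m' = add_mset x m then c else \<zero>)"
      by (auto simp: indexed_pmult_def fun_eq_iff)
    ultimately show ?case by simp
  qed
  have "supported R I A P \<Longrightarrow> {m. P m \<noteq> \<zero>} \<subseteq> W \<Longrightarrow> P \<in> indexed_pset I A" if "finite W" for W P
    using that
  proof (induction W arbitrary: P)
    case empty
    then have "P = indexed_const \<zero>" by (auto simp: indexed_const_def)
    then show ?case using zeroA by (auto intro: indexed_pset.indexed_const)
  next
    case (insert m W)
    define Q where "Q = P(m := \<zero>)"
    show ?case
    proof (cases "P m = \<zero>")
      case True
      then have "{m. P m \<noteq> \<zero>} \<subseteq> W" using insert.prems by auto
      then show ?thesis using insert by auto
    next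
      case False
      have "finite {m. Q m \<noteq> \<zero>}"
        by (rule finite_subset[of _ "{m. P m \<noteq> \<zero>}"])
          (use insert.prems in \<open>auto simp: supported_def Q_def\<close>)
      then have "supported R I A Q" using insert.prems zeroA unfolding supported_def Q_def by auto
      moreover have "{m. Q m \<noteq> \<zero>} \<subseteq> W" using insert.prems by (auto simp: Q_def)
      ultimately have "Q \<in> indexed_pset I A" using insert.IH by auto
      moreover have "(\<lambda>m'. if m' = m then P m else \<zero>) \<in> indexed_pset I A"
        using False insert.prems unfolding supported_def by (intro mono) auto
      moreover have "P = indexed_padd Q (\<lambda>m'. if m' = m then P m else \<zero>)"
      proof
        fix m'
        have "P m' \<in> carrier R" for m' using insert.prems AR unfolding supported_def by blast
        then show "P m' = indexed_padd Q (\<lambda>m'. if m' = m then P m else \<zero>) m'"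
          by (simp add: Q_def indexed_padd_def)
      qed
      ultimately show ?thesis by (metis indexed_pset.indexed_padd)
    qed
  qed
  then show "supported R I A P \<Longrightarrow> P \<in> indexed_pset I A" by (auto simp: supported_def)
qed

context cring begin

lemma mpoly_carrier: "carrier (mpoly_ring R I) = {P. supported R I (carrier R) P}"
  using indexed_pset_iff[OF carrier_is_subring] by (auto simp: mpoly_ring_def)

lemma mpoly_zero [simp]: "\<zero>\<^bsub>mpoly_ring R I\<^esub> = (\<lambda>m. \<zero>)"
  by (simp add: mpoly_ring_def indexed_const_def)

lemma mpoly_one: "\<one>\<^bsub>mpoly_ring R I\<^esub> = (\<lambda>m. if m = {#} then \<one> else \<zero>)"
  by (simp add: mpoly_ring_def indexed_const_def)

lemma mpoly_add: "P \<oplus>\<^bsub>mpoly_ring R I\<^esub> Q = (\<lambda>m. P m \<oplus> Q m)"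
  by (simp add: mpoly_ring_def indexed_padd_def)

lemma mpoly_mult:
  "P \<otimes>\<^bsub>mpoly_ring R I\<^esub> Q = (\<lambda>m. \<Oplus>a\<in>{a. a \<subseteq># m}. P a \<otimes> Q (m - a))"
  by (simp add: mpoly_ring_def)

lemma finite_submultisets: "finite {a. a \<subseteq># (m :: 'v multiset)}"
proof (induction m)
  case (add x m)
  have "{a. a \<subseteq># add_mset x m} \<subseteq> {a. a \<subseteq># m} \<union> add_mset x ` {a. a \<subseteq># m}"
  proof
    fix a assume "a \<in> {a. a \<subseteq># add_mset x m}"
    then have a: "a \<subseteq># add_mset x m" by simp
    show "a \<in> {a. a \<subseteq># m} \<union> add_mset x ` {a. a \<subseteq># m}"
    proof (cases "x \<in># a")
      case True
      then obtain b where b: "a = add_mset x b" by (metis insert_DiffM)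
      then show ?thesis using a by auto
    next
      case False
      then have "a \<subseteq># m" using a
        by (metis diff_single_trivial subset_eq_diff_conv add_mset_add_single)
      then show ?thesis by auto
    qed
  qed
  then show ?case using add finite_subset by (metis finite_UnI finite_imageI)
qed simp

text \<open>
  Both sides sum \<open>F i \<otimes> F' j\<close> over the pairs with \<open>w i + w' j = m\<close>; the convolution on the left groups these
  pairs by the value \<open>a = w i\<close>.
\<close>

lemma mult_collect:
  assumes "finite W" "finite W'" "F \<in> W \<rightarrow> carrier R" "F' \<in> W' \<rightarrow> carrier R"
  shows "collect R W F w \<otimes>\<^bsub>mpoly_ring R I\<^esub> collect R W' F' w' =
    collect R (W \<times> W') (\<lambda>(i, j). F i \<otimes> F' j) (\<lambda>(i, j). w i + w' j)"
proof
  fix m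
  let ?S = "{x \<in> W \<times> W'. (case x of (i, j) \<Rightarrow> w i + w' j) = m}"
  have fib: "collect R W F w a \<otimes> collect R W' F' w' (m - a)
      = finsum R (\<lambda>(i, j). F i \<otimes> F' j) {x \<in> ?S. w (fst x) = a}" if "a \<subseteq># m" for a
  proof -
    let ?X = "{i\<in>W. w i = a}" and ?Y = "{j\<in>W'. w' j = m - a}"
    have "collect R W F w a \<otimes> collect R W' F' w' (m - a)
        = (\<Oplus>i\<in>?X. F i \<otimes> finsum R F' ?Y)"
      unfolding collect_def using assms by (intro finsum_ldistr) (auto intro!: finsum_closed)
    also have "\<dots> = (\<Oplus>i\<in>?X. \<Oplus>j\<in>?Y. F i \<otimes> F' j)"
      using assms by (intro finsum_cong'[OF refl] finsum_rdistr) (auto intro!: finsum_closed)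
    also have "\<dots> = finsum R (\<lambda>(i, j). F i \<otimes> F' j) (?X \<times> ?Y)"
      by (rule finsum_times) (use assms in \<open>auto simp: Pi_iff\<close>)
    also have "?X \<times> ?Y = {x \<in> ?S. w (fst x) = a}"
      using that by (auto simp: subset_mset.add_diff_inverse)
    finally show ?thesis .
  qed
  have "(collect R W F w \<otimes>\<^bsub>mpoly_ring R I\<^esub> collect R W' F' w') m
      = (\<Oplus>a\<in>{a. a \<subseteq># m}. finsum R (\<lambda>(i, j). F i \<otimes> F' j) {x \<in> ?S. w (fst x) = a})"
    unfolding mpoly_mult
  proof (rule finsum_cong'[OF refl])
    show "(\<lambda>a. finsum R (\<lambda>(i, j). F i \<otimes> F' j) {x \<in> ?S. w (fst x) = a}) \<in> {a. a \<subseteq># m} \<rightarrow> carrier R"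
      using assms(3,4) by (intro funcsetI finsum_closed) auto
  qed (simp add: fib)
  also have "\<dots> = finsum R (\<lambda>(i, j). F i \<otimes> F' j) ?S"
    by (rule finsum_group_by[where w = "\<lambda>x. w (fst x)", symmetric])
      (use assms finite_submultisets in auto)
  finally show "(collect R W F w \<otimes>\<^bsub>mpoly_ring R I\<^esub> collect R W' F' w') m
      = collect R (W \<times> W') (\<lambda>(i, j). F i \<otimes> F' j) (\<lambda>(i, j). w i + w' j) m"
    by (simp add: collect_def)
qed

lemma supported_collect:
  assumes "P \<in> carrier (mpoly_ring R I)"
  shows "collect R {m. P m \<noteq> \<zero>} P (\<lambda>m. m) = P" "finite {m. P m \<noteq> \<zero>}"
    "P \<in> W \<rightarrow> carrier R"
  using assms by (auto simp: mpoly_carrier supported_def intro!: collect_self)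

lemma collect_supported:
  assumes "finite W" "F \<in> W \<rightarrow> A" "subring A R" "\<And>i. i \<in> W \<Longrightarrow> set_mset (w i) \<subseteq> I"
  shows "supported R I A (collect R W F w)"
proof -
  have "finsum R F V \<in> A" if "V \<subseteq> W" for V
    using finite_subset[OF that assms(1)] that
  proof (induction V)
    case empty then show ?case using subringE(2)[OF assms(3)] by simp
  next
    case (insert i V)
    then show ?case using assms(2) subringE(1,7)[OF assms(3)] by (subst finsum_insert) auto
  qed
  moreover have "finite {m. collect R W F w m \<noteq> \<zero>}"
    by (rule finite_subset[of _ "w ` W"]) (use assms in \<open>auto dest: collect_support\<close>)
  moreover have "set_mset m \<subseteq> I" if "collect R W F w m \<noteq> \<zero>" for m
    using collect_support[OF that] assms(4) by auto
  ultimately show ?thesis by (auto simp: supported_def collect_def)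
qed

lemma mult_supported:
  assumes "supported R I A P" "supported R I A Q" "subring A R"
  shows "supported R I A (P \<otimes>\<^bsub>mpoly_ring R I\<^esub> Q)"
proof -
  have AR: "A \<subseteq> carrier R" using subringE(1)[OF assms(3)] .
  have P: "P \<in> carrier (mpoly_ring R I)" "Q \<in> carrier (mpoly_ring R I)"
    using assms AR by (auto simp: mpoly_carrier supported_def)
  have "P \<otimes>\<^bsub>mpoly_ring R I\<^esub> Q
     = collect R ({m. P m \<noteq> \<zero>} \<times> {m. Q m \<noteq> \<zero>}) (\<lambda>(i, j). P i \<otimes> Q j) (\<lambda>(i, j). i + j)"
    using mult_collect[OF supported_collect(2)[OF P(1)] supported_collect(2)[OF P(2)]
        supported_collect(3)[OF P(1)] supported_collect(3)[OF P(2)], where w = "\<lambda>m. m" and w' = "\<lambda>m. m" and I = I]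
    supported_collect(1)[OF P(1)] supported_collect(1)[OF P(2)] by simp
  moreover have "supported R I A \<dots>"
    using assms subringE(6)[OF assms(3)]
    by (intro collect_supported) (auto simp: supported_def Pi_iff image_subset_iff, blast+)
  ultimately show ?thesis by simp
qed

lemma mpoly_cring: "cring (mpoly_ring R I)"
proof -
  let ?D = "mpoly_ring R I"
  have sub: "subring (carrier R) R" by (rule carrier_is_subring)
  have c: "P m \<in> carrier R" if "P \<in> carrier ?D" for P m
    using that by (auto simp: mpoly_carrier supported_def)
  have add_closed: "P \<oplus>\<^bsub>?D\<^esub> Q \<in> carrier ?D" if "P \<in> carrier ?D" "Q \<in> carrier ?D" for P Q
    using that unfolding mpoly_ring_def by (auto intro: indexed_pset.indexed_padd)
  have abelian: "abelian_group ?D"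
  proof (rule abelian_groupI)
    fix P assume P: "P \<in> carrier ?D"
    then have "(\<lambda>m. \<ominus> P m) \<in> carrier ?D"
      by (auto simp: mpoly_carrier supported_def elim!: rev_finite_subset) (metis minus_zero subsetD)
    then show "\<exists>y\<in>carrier ?D. y \<oplus>\<^bsub>?D\<^esub> P = \<zero>\<^bsub>?D\<^esub>"
      using P by (intro bexI[of _ "\<lambda>m. \<ominus> P m"]) (auto simp: mpoly_add c l_neg)
  qed (auto simp: mpoly_add c a_ac add_closed[unfolded mpoly_add], auto simp: mpoly_carrier supported_def)
  have mult_closed: "P \<otimes>\<^bsub>?D\<^esub> Q \<in> carrier ?D" if "P \<in> carrier ?D" "Q \<in> carrier ?D" for P Q
    using that mult_supported sub by (auto simp: mpoly_carrier)
  have one_closed: "\<one>\<^bsub>?D\<^esub> \<in> carrier ?D"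
    by (auto simp: mpoly_carrier supported_def mpoly_one)
  have one_collect: "\<one>\<^bsub>?D\<^esub> = collect R {0::nat} (\<lambda>_. \<one>) (\<lambda>_. {#})"
  proof -
    have "{i \<in> {0::nat}. {#} = m} = (if m = {#} then {0::nat} else {})" for m :: "'v multiset" by auto
    then show ?thesis by (auto simp: mpoly_one collect_def fun_eq_iff finsum_insert)
  qed
  have comm: "P \<otimes>\<^bsub>?D\<^esub> Q = Q \<otimes>\<^bsub>?D\<^esub> P" if P: "P \<in> carrier ?D" "Q \<in> carrier ?D" for P Q
  proof -
    note p = supported_collect[OF P(1)] and q = supported_collect[OF P(2)]
    let ?X = "{m. P m \<noteq> \<zero>}" and ?Y = "{m. Q m \<noteq> \<zero>}"
    have "P \<otimes>\<^bsub>?D\<^esub> Q = collect R (?X \<times> ?Y) (\<lambda>(i, j). P i \<otimes> Q j) (\<lambda>(i, j). i + j)"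
      using mult_collect[OF p(2) q(2) p(3) q(3), where w = "\<lambda>m. m" and w' = "\<lambda>m. m"] p(1) q(1) by simp
    also have "?X \<times> ?Y = (\<lambda>(i, j). (j, i)) ` (?Y \<times> ?X)" by auto
    also have "collect R \<dots> (\<lambda>(i, j). P i \<otimes> Q j) (\<lambda>(i, j). i + j)
       = collect R (?Y \<times> ?X) (\<lambda>x. (\<lambda>(i, j). P i \<otimes> Q j) ((\<lambda>(i, j). (j, i)) x))
          (\<lambda>x. (\<lambda>(i, j). i + j) ((\<lambda>(i, j). (j, i)) x))"
      by (rule collect_reindex) (auto simp: inj_on_def c[OF P(1)] c[OF P(2)])
    also have "\<dots> = collect R (?Y \<times> ?X) (\<lambda>(i, j). Q i \<otimes> P j) (\<lambda>(i, j). i + j)"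
      by (rule collect_cong) (auto simp: c[OF P(1)] c[OF P(2)] m_comm)
    also have "\<dots> = Q \<otimes>\<^bsub>?D\<^esub> P"
      using mult_collect[OF q(2) p(2) q(3) p(3), where w = "\<lambda>m. m" and w' = "\<lambda>m. m"] p(1) q(1) by simp
    finally show ?thesis .
  qed
  show ?thesis
  proof (rule cringI[OF abelian])
    show "Group.comm_monoid ?D"
    proof (rule comm_monoidI)
      fix P assume P: "P \<in> carrier ?D"
      note p = supported_collect[OF P]
      let ?X = "{m. P m \<noteq> \<zero>}"
      have "\<one>\<^bsub>?D\<^esub> \<otimes>\<^bsub>?D\<^esub> P = collect R ({0::nat} \<times> ?X) (\<lambda>(i, j). \<one> \<otimes> P j) (\<lambda>(i, j). {#} + j)"
        using mult_collect[OF _ p(2) _ p(3), of "{0::nat}" "\<lambda>_. \<one>" I "\<lambda>_. {#}" "\<lambda>m. m"] p(1)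
        by (simp add: one_collect)
      also have "{0::nat} \<times> ?X = Pair 0 ` ?X" by auto
      also have "collect R \<dots> (\<lambda>(i, j). \<one> \<otimes> P j) (\<lambda>(i, j). {#} + j)
         = collect R ?X (\<lambda>x. (\<lambda>(i, j). \<one> \<otimes> P j) (0::nat, x)) (\<lambda>x. (\<lambda>(i, j). {#} + j) (0::nat, x))"
        by (rule collect_reindex) (auto simp: inj_on_def c[OF P])
      also have "\<dots> = collect R ?X P (\<lambda>m. m)" 
        by (rule collect_cong) (auto simp: c[OF P])
      finally show "\<one>\<^bsub>?D\<^esub> \<otimes>\<^bsub>?D\<^esub> P = P" using p(1) by simp
    next
      fix P Q T assume P: "P \<in> carrier ?D" and Q: "Q \<in> carrier ?D" and T: "T \<in> carrier ?D"
      let ?X = "{m. P m \<noteq> \<zero>}" and ?Y = "{m. Q m \<noteq> \<zero>}" and ?Z = "{m. T m \<noteq> \<zero>}"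
      note p = supported_collect[OF P] and q = supported_collect[OF Q] and t = supported_collect[OF T]
      note cs = c[OF P] c[OF Q] c[OF T]
      have PQ: "P \<otimes>\<^bsub>?D\<^esub> Q = collect R (?X \<times> ?Y) (\<lambda>(i, j). P i \<otimes> Q j) (\<lambda>(i, j). i + j)"
        using mult_collect[OF p(2) q(2) p(3) q(3), where w = "\<lambda>m. m" and w' = "\<lambda>m. m"] p(1) q(1) by simp
      have QT: "Q \<otimes>\<^bsub>?D\<^esub> T = collect R (?Y \<times> ?Z) (\<lambda>(i, j). Q i \<otimes> T j) (\<lambda>(i, j). i + j)"
        using mult_collect[OF q(2) t(2) q(3) t(3), where w = "\<lambda>m. m" and w' = "\<lambda>m. m"] q(1) t(1) by simp
      let ?h = "\<lambda>(i, (j, k)). ((i, j), k)"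
      have "P \<otimes>\<^bsub>?D\<^esub> Q \<otimes>\<^bsub>?D\<^esub> T = collect R ((?X \<times> ?Y) \<times> ?Z)
           (\<lambda>(x, k). (\<lambda>(i, j). P i \<otimes> Q j) x \<otimes> T k) (\<lambda>(x, k). (\<lambda>(i, j). i + j) x + k)"
        using mult_collect[of "?X \<times> ?Y" ?Z "\<lambda>(i, j). P i \<otimes> Q j" T I "\<lambda>(i, j). i + j" "\<lambda>m. m"]
          p(2) q(2) t cs PQ by (auto simp: t(1) Pi_iff)
      also have "(?X \<times> ?Y) \<times> ?Z = ?h ` (?X \<times> (?Y \<times> ?Z))" by force
      also have "collect R \<dots> (\<lambda>(x, k). (\<lambda>(i, j). P i \<otimes> Q j) x \<otimes> T k) (\<lambda>(x, k). (\<lambda>(i, j). i + j) x + k)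
         = collect R (?X \<times> (?Y \<times> ?Z)) (\<lambda>x. (\<lambda>(x, k). (\<lambda>(i, j). P i \<otimes> Q j) x \<otimes> T k) (?h x))
          (\<lambda>x. (\<lambda>(x, k). (\<lambda>(i, j). i + j) x + k) (?h x))"
        by (rule collect_reindex) (auto simp: inj_on_def cs)
      also have "\<dots> = collect R (?X \<times> (?Y \<times> ?Z))
         (\<lambda>(i, x). P i \<otimes> (\<lambda>(j, k). Q j \<otimes> T k) x) (\<lambda>(i, x). i + (\<lambda>(j, k). j + k) x)"
        by (rule collect_cong) (auto simp: cs m_assoc)
      also have "\<dots> = P \<otimes>\<^bsub>?D\<^esub> (Q \<otimes>\<^bsub>?D\<^esub> T)"
        using mult_collect[of ?X "?Y \<times> ?Z" P "\<lambda>(i, j). Q i \<otimes> T j" I "\<lambda>m. m" "\<lambda>(i, j). i + j"]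
          q(2) t(2) p cs QT by (auto simp: p(1) Pi_iff)
      finally show "P \<otimes>\<^bsub>?D\<^esub> Q \<otimes>\<^bsub>?D\<^esub> T = P \<otimes>\<^bsub>?D\<^esub> (Q \<otimes>\<^bsub>?D\<^esub> T)" .
    qed (use one_closed mult_closed comm in auto)
  next
    fix P Q T assume P: "P \<in> carrier ?D" and Q: "Q \<in> carrier ?D" and T: "T \<in> carrier ?D"
    note cs = c[OF P] c[OF Q] c[OF T]
    show "(P \<oplus>\<^bsub>?D\<^esub> Q) \<otimes>\<^bsub>?D\<^esub> T = P \<otimes>\<^bsub>?D\<^esub> T \<oplus>\<^bsub>?D\<^esub> Q \<otimes>\<^bsub>?D\<^esub> T"
      unfolding mpoly_add mpoly_mult
      by (rule ext, subst finsum_addf[symmetric]) (auto simp: cs l_distr)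
  qed
qed

end

lemma base_expansion_unique:
  fixes g g' :: "nat \<Rightarrow> nat"
  assumes "\<And>k. k < n \<Longrightarrow> g k < N" "\<And>k. k < n \<Longrightarrow> g' k < N"
    and "(\<Sum>k<n. g k * N ^ k) = (\<Sum>k<n. g' k * N ^ k)"
  shows "\<forall>k<n. g k = g' k"
  using assms
proof (induction n arbitrary: g g')
  case (Suc n)
  have shift: "(\<Sum>k<Suc n. h k * N ^ k) = h 0 + N * (\<Sum>k<n. h (Suc k) * N ^ k)" for h :: "nat \<Rightarrow> nat"
    by (subst sum.lessThan_Suc_shift) (simp add: sum_distrib_left mult.left_commute)
  have N: "0 < N" using Suc.prems(1)[of 0] by simp
  have eq: "g 0 + N * (\<Sum>k<n. g (Suc k) * N ^ k) = g' 0 + N * (\<Sum>k<n. g' (Suc k) * N ^ k)"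
    using Suc.prems(3) unfolding shift .
  have lt: "g 0 < N" "g' 0 < N" using Suc.prems(1,2) by auto
  have g0: "g 0 = g' 0"
  proof -
    have "(g 0 + N * (\<Sum>k<n. g (Suc k) * N ^ k)) mod N = g 0" using lt by simp
    moreover have "(g' 0 + N * (\<Sum>k<n. g' (Suc k) * N ^ k)) mod N = g' 0" using lt by simp
    ultimately show ?thesis using eq by simp
  qed
  with eq N have "(\<Sum>k<n. g (Suc k) * N ^ k) = (\<Sum>k<n. g' (Suc k) * N ^ k)" by simp
  then have "\<forall>k<n. g (Suc k) = g' (Suc k)"
    using Suc.prems(1,2) by (intro Suc.IH) auto
  with g0 show ?case by (auto simp: less_Suc_eq_0_disj)
qed simp

text \<open>
  The exponent of \<open>t\<close> after Kronecker's substitution of \<open>t ^ (N ^ e x)\<close> for the variable \<open>x\<close>.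
\<close>

definition weight :: "('v \<Rightarrow> nat) \<Rightarrow> nat \<Rightarrow> 'v multiset \<Rightarrow> nat" where
  "weight e N m = (\<Sum>x\<in>#m. N ^ e x)"

lemma weight_add: "weight e N (a + b) = weight e N a + weight e N b"
  by (simp add: weight_def)

text \<open>
  The multiplicities of a monomial of size below \<open>N\<close> are the digits of its weight in base \<open>N\<close>.
\<close>

lemma weight_inj:
  assumes "finite I" "inj_on e I" "set_mset a \<subseteq> I" "set_mset b \<subseteq> I" "size a < N" "size b < N"
    and "weight e N a = weight e N b"
  shows "a = b"
proof -
  obtain n where n: "e ` I \<subseteq> {..<n}"
    using assms(1) finite_nat_bounded[of "e ` I"] by auto
  define d where "d = (\<lambda>m k. if k \<in> e ` I then count m (the_inv_into I e k) else 0)"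
  have w: "weight e N m = (\<Sum>k<n. d m k * N ^ k)" if "set_mset m \<subseteq> I" for m
  proof -
    have "weight e N m = (\<Sum>x\<in>I. count m x * N ^ e x)"
      using that
    proof (induction m)
      case (add y m)
      have "(\<Sum>x\<in>I. count (add_mset y m) x * N ^ e x)
          = (\<Sum>x\<in>I. count m x * N ^ e x + (if x = y then N ^ e x else 0))"
        by (intro sum.cong) auto
      then show ?case using add assms(1) by (simp add: weight_def sum.distrib sum.delta)
    qed (simp add: weight_def)
    also have "\<dots> = (\<Sum>x\<in>I. d m (e x) * N ^ e x)"
      using assms(2) by (intro sum.cong) (auto simp: d_def the_inv_into_f_f)
    also have "\<dots> = (\<Sum>k\<in>e ` I. d m k * N ^ k)"
      using assms(2) by (simp add: sum.reindex)
    also have "\<dots> = (\<Sum>k<n. d m k * N ^ k)"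
      using n by (intro sum.mono_neutral_left) (auto simp: d_def)
    finally show ?thesis .
  qed
  have bound: "d m k < N" if "size m < N" for m k
  proof -
    have "d m k \<le> size m" unfolding d_def by (auto simp: count_le_size)
    then show ?thesis using that by simp
  qed
  have "\<forall>k<n. d a k = d b k"
    using assms w bound by (intro base_expansion_unique[where N = N]) auto
  then have "count a x = count b x" if "x \<in> I" for x
    using that n assms(2) by (force simp: d_def the_inv_into_f_f)
  moreover have "count a x = count b x" if "x \<notin> I" for x
    using that assms(3,4) by (metis count_eq_zero_iff subsetD)
  ultimately show ?thesis by (metis multiset_eqI)
qed

text \<open>
  For large \<open>N\<close> the weight is additive and injective on the supports of two nonzero polynomials.  The
  product of their monomials of largest weight therefore arises from one pair only, and its coefficient is the
  product of two nonzero elements.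
\<close>

lemma (in domain) mpoly_domain:
  assumes "finite I"
  shows "domain (mpoly_ring R I)"
proof -
  let ?D = "mpoly_ring R I"
  interpret D: cring ?D by (rule mpoly_cring)
  have nz: "P \<otimes>\<^bsub>?D\<^esub> Q \<noteq> \<zero>\<^bsub>?D\<^esub>"
    if P: "P \<in> carrier ?D" "P \<noteq> \<zero>\<^bsub>?D\<^esub>" and Q: "Q \<in> carrier ?D" "Q \<noteq> \<zero>\<^bsub>?D\<^esub>" for P Q
  proof -
    let ?S = "{m. P m \<noteq> \<zero>}" and ?T = "{m. Q m \<noteq> \<zero>}"
    note p = supported_collect[OF P(1)] and q = supported_collect[OF Q(1)]
    have ne: "?S \<noteq> {}" "?T \<noteq> {}" using P(2) Q(2) by auto
    obtain e :: "_ \<Rightarrow> nat" where e: "inj_on e I" using finite_imp_inj_to_nat_seg[OF assms] by metis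
    define N where "N = Suc (\<Sum>m\<in>?S \<union> ?T. size m)"
    let ?w = "weight e N"
    have inj: "a = b" if "a \<in> ?S \<union> ?T" "b \<in> ?S \<union> ?T" "?w a = ?w b" for a b
    proof (rule weight_inj[OF assms e _ _ _ _ that(3)])
      have "set_mset m \<subseteq> I" if "m \<in> ?S \<union> ?T" for m
        using that P(1) Q(1) by (auto simp: mpoly_carrier supported_def)
      then show "set_mset a \<subseteq> I" "set_mset b \<subseteq> I" using that by auto
      have "size m < N" if "m \<in> ?S \<union> ?T" for m
        unfolding N_def using that p(2) q(2) by (intro le_imp_less_Suc member_le_sum) auto
      then show "size a < N" "size b < N" using that by auto
    qed
    have maximal: "\<exists>a\<in>U. \<forall>b\<in>U. ?w b \<le> ?w a" if "finite U" "U \<noteq> {}" for U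
    proof -
      have "Max (?w ` U) \<in> ?w ` U" using that by (intro Max_in) auto
      then obtain a where "a \<in> U" "Max (?w ` U) = ?w a" by blast
      then show ?thesis using that by (metis Max_ge finite_imageI imageI)
    qed
    obtain a where a: "a \<in> ?S" "\<And>b. b \<in> ?S \<Longrightarrow> ?w b \<le> ?w a"
      using maximal[OF p(2) ne(1)] by blast
    obtain b where b: "b \<in> ?T" "\<And>c. c \<in> ?T \<Longrightarrow> ?w c \<le> ?w b"
      using maximal[OF q(2) ne(2)] by blast
    have "(P \<otimes>\<^bsub>?D\<^esub> Q) (a + b) = collect R (?S \<times> ?T) (\<lambda>(i, j). P i \<otimes> Q j) (\<lambda>(i, j). i + j) (a + b)"
      using mult_collect[OF p(2) q(2) p(3) q(3), where w = "\<lambda>m. m" and w' = "\<lambda>m. m"] p(1) q(1) by simp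
    also have "\<dots> = finsum R (\<lambda>(i, j). P i \<otimes> Q j) {(a, b)}"
    proof -
      have "{x \<in> ?S \<times> ?T. (case x of (i, j) \<Rightarrow> i + j) = a + b} = {(a, b)}"
      proof (intro equalityI subsetI)
        fix x assume "x \<in> {x \<in> ?S \<times> ?T. (case x of (i, j) \<Rightarrow> i + j) = a + b}"
        then obtain i j where x: "x = (i, j)" "i \<in> ?S" "j \<in> ?T" "i + j = a + b" by auto
        have "?w i + ?w j = ?w a + ?w b" using x(4) by (metis weight_add)
        then have "?w i = ?w a" "?w j = ?w b" using a(2)[OF x(2)] b(2)[OF x(3)] by auto
        then show "x \<in> {(a, b)}" using inj[of i a] inj[of j b] x a(1) b(1) by auto
      qed (use a b in auto)
      then show ?thesis by (simp add: collect_def)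
    qed
    also have "\<dots> = P a \<otimes> Q b"
      using p(3)[of UNIV] q(3)[of UNIV] by (auto simp: finsum_insert Pi_iff)
    also have "\<dots> \<noteq> \<zero>"
      using a(1) b(1) p(3)[of UNIV] q(3)[of UNIV] by (auto simp: integral_iff Pi_iff)
    finally show ?thesis by auto
  qed
  show ?thesis
  proof (rule domain.intro[OF D.is_cring], unfold_locales)
    show "\<one>\<^bsub>?D\<^esub> \<noteq> \<zero>\<^bsub>?D\<^esub>" by (auto simp: mpoly_one fun_eq_iff)
  qed (use nz in blast)
qed

section \<open>Homomorphisms between polynomial rings\<close>

definition mpoly_map ::
  "('a, 'm) ring_scheme \<Rightarrow> ('b, 'n) ring_scheme \<Rightarrow> ('a \<Rightarrow> 'b) \<Rightarrow> ('v multiset \<Rightarrow> 'w multiset) \<Rightarrow>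
   ('v multiset \<Rightarrow> 'a) \<Rightarrow> 'w multiset \<Rightarrow> 'b" where
  "mpoly_map R S \<psi> \<tau> P = collect S {m. P m \<noteq> \<zero>\<^bsub>R\<^esub>} (\<lambda>m. \<psi> (P m)) \<tau>"

text \<open>
  A homomorphism that matters only on the subring \<open>A\<close> of \<open>R\<close>.  Reduction modulo the maximal ideal of a valuation
  ring, the induced reduction of polynomials and the residue map on fractions are all of this kind, so one
  locale carries their common laws.
\<close>

locale subring_hom = R: cring R + S: cring S for R :: "('a, 'm) ring_scheme" and S :: "('b, 'n) ring_scheme" +
  fixes A \<psi>
  assumes subring_A: "subring A R"
    and hom_closed: "a \<in> A \<Longrightarrow> \<psi> a \<in> carrier S"
    and hom_add: "a \<in> A \<Longrightarrow> b \<in> A \<Longrightarrow> \<psi> (a \<oplus>\<^bsub>R\<^esub> b) = \<psi> a \<oplus>\<^bsub>S\<^esub> \<psi> b"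
    and hom_mult: "a \<in> A \<Longrightarrow> b \<in> A \<Longrightarrow> \<psi> (a \<otimes>\<^bsub>R\<^esub> b) = \<psi> a \<otimes>\<^bsub>S\<^esub> \<psi> b"
    and hom_one: "\<psi> \<one>\<^bsub>R\<^esub> = \<one>\<^bsub>S\<^esub>"
begin

lemma A_carrier: "A \<subseteq> carrier R" using subringE(1)[OF subring_A] .

lemma A_closed [simp]:
  "\<zero>\<^bsub>R\<^esub> \<in> A" "\<one>\<^bsub>R\<^esub> \<in> A" "a \<in> A \<Longrightarrow> a \<in> carrier R" "a \<in> A \<Longrightarrow> \<ominus>\<^bsub>R\<^esub> a \<in> A"
  "a \<in> A \<Longrightarrow> b \<in> A \<Longrightarrow> a \<oplus>\<^bsub>R\<^esub> b \<in> A" "a \<in> A \<Longrightarrow> b \<in> A \<Longrightarrow> a \<otimes>\<^bsub>R\<^esub> b \<in> A"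
  using subringE[OF subring_A] by auto

lemma hom_zero [simp]: "\<psi> \<zero>\<^bsub>R\<^esub> = \<zero>\<^bsub>S\<^esub>"
proof -
  have "\<psi> \<zero>\<^bsub>R\<^esub> \<oplus>\<^bsub>S\<^esub> \<psi> \<zero>\<^bsub>R\<^esub> = \<psi> \<zero>\<^bsub>R\<^esub>"
    using hom_add[of "\<zero>\<^bsub>R\<^esub>" "\<zero>\<^bsub>R\<^esub>"] by simp
  then show ?thesis using hom_closed[of "\<zero>\<^bsub>R\<^esub>"] by simp
qed

lemma hom_minus: "a \<in> A \<Longrightarrow> \<psi> (\<ominus>\<^bsub>R\<^esub> a) = \<ominus>\<^bsub>S\<^esub> \<psi> a"
  using hom_add[of "\<ominus>\<^bsub>R\<^esub> a" a] hom_closed by (intro S.minus_equality[symmetric]) (auto simp: R.l_neg)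

lemma finsum_A: "F \<in> W \<rightarrow> A \<Longrightarrow> finsum R F W \<in> A"
proof (induction W rule: infinite_finite_induct)
  case (insert i W)
  then show ?case by (subst R.finsum_insert) (auto simp: Pi_iff)
qed simp_all

lemma hom_finsum: "F \<in> W \<rightarrow> A \<Longrightarrow> \<psi> (finsum R F W) = finsum S (\<lambda>i. \<psi> (F i)) W"
proof (induction W rule: infinite_finite_induct)
  case (insert i W)
  then have "finsum R F (insert i W) = F i \<oplus>\<^bsub>R\<^esub> finsum R F W"
    by (subst R.finsum_insert) (auto simp: Pi_iff)
  moreover have "finsum R F W \<in> A" using insert.prems by (intro finsum_A) auto
  moreover have "finsum S (\<lambda>i. \<psi> (F i)) (insert i W) = \<psi> (F i) \<oplus>\<^bsub>S\<^esub> finsum S (\<lambda>i. \<psi> (F i)) W"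
    using insert hom_closed by (subst S.finsum_insert) (auto simp: Pi_iff)
  ultimately show ?case using insert by (auto simp: hom_add Pi_iff)
qed simp_all

text \<open>
  The coefficient of the image at \<open>m\<close> sums \<open>\<psi> (F i)\<close> over all \<open>i\<close> with \<open>\<tau> (w i) = m\<close>, grouped by the value \<open>w i\<close>.  Additivity,
  multiplicativity and functoriality of the map all follow from this.
\<close>

lemma map_collect:
  assumes "finite W" "F \<in> W \<rightarrow> A"
  shows "mpoly_map R S \<psi> \<tau> (collect R W F w) = collect S W (\<lambda>i. \<psi> (F i)) (\<lambda>i. \<tau> (w i))"
proof
  fix m
  let ?Q = "collect R W F w"
  have QA: "?Q a \<in> A" for a unfolding collect_def using assms(2) by (intro finsum_A) auto
  have \<psi>Q: "\<psi> (?Q a) = collect S W (\<lambda>i. \<psi> (F i)) w a" for a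
    unfolding collect_def using assms(2) by (intro hom_finsum) auto
  have cl: "(\<lambda>i. \<psi> (F i)) \<in> W \<rightarrow> carrier S" using assms(2) hom_closed by auto
  have "mpoly_map R S \<psi> \<tau> ?Q m = finsum S (\<lambda>a. \<psi> (?Q a)) {a \<in> w ` W. \<tau> a = m}"
    unfolding mpoly_map_def collect_def[of S]
  proof (rule S.finsum_mono_neutral_cong_left)
    show "{i \<in> {m. ?Q m \<noteq> \<zero>\<^bsub>R\<^esub>}. \<tau> i = m} \<subseteq> {a \<in> w ` W. \<tau> a = m}"
      using R.collect_support by fast
  qed (use assms QA hom_closed in auto)
  also have "\<dots> = finsum S (\<lambda>a. finsum S (\<lambda>i. \<psi> (F i)) {i \<in> {i \<in> W. \<tau> (w i) = m}. w i = a}) {a \<in> w ` W. \<tau> a = m}"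
  proof (rule S.finsum_cong'[OF refl])
    show "(\<lambda>a. finsum S (\<lambda>i. \<psi> (F i)) {i \<in> {i \<in> W. \<tau> (w i) = m}. w i = a}) \<in> {a \<in> w ` W. \<tau> a = m} \<rightarrow> carrier S"
      using cl by (intro funcsetI S.finsum_closed) auto
    fix a assume a: "a \<in> {a \<in> w ` W. \<tau> a = m}"
    have "{i \<in> {i \<in> W. \<tau> (w i) = m}. w i = a} = {i \<in> W. w i = a}" using a by auto
    then show "\<psi> (?Q a) = finsum S (\<lambda>i. \<psi> (F i)) {i \<in> {i \<in> W. \<tau> (w i) = m}. w i = a}"
      by (simp only: \<psi>Q) (simp only: collect_def)
  qed
  also have "\<dots> = finsum S (\<lambda>i. \<psi> (F i)) {i \<in> W. \<tau> (w i) = m}"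
    by (rule S.finsum_group_by[symmetric]) (use assms cl in auto)
  finally show "mpoly_map R S \<psi> \<tau> ?Q m = collect S W (\<lambda>i. \<psi> (F i)) (\<lambda>i. \<tau> (w i)) m"
    by (simp add: collect_def)
qed

lemma supported_carrier: "supported R I A P \<Longrightarrow> P \<in> carrier (mpoly_ring R I)"
  using A_carrier by (auto simp: R.mpoly_carrier supported_def)

lemma map_supported:
  assumes "supported R I A P" "\<And>m. set_mset m \<subseteq> I \<Longrightarrow> set_mset (\<tau> m) \<subseteq> J"
  shows "mpoly_map R S \<psi> \<tau> P \<in> carrier (mpoly_ring S J)"
  unfolding mpoly_map_def S.mpoly_carrier mem_Collect_eq
  using assms hom_closed by (intro S.collect_supported S.carrier_is_subring) (auto simp: supported_def image_subset_iff)

lemma map_alt: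
  assumes "supported R I A P" "finite W" "{m. P m \<noteq> \<zero>\<^bsub>R\<^esub>} \<subseteq> W"
  shows "mpoly_map R S \<psi> \<tau> P = collect S W (\<lambda>m. \<psi> (P m)) \<tau>"
proof -
  have PA: "\<And>m. P m \<in> A" using assms(1) by (auto simp: supported_def)
  have "P = collect R W P (\<lambda>m. m)"
    using assms PA by (intro R.collect_self[symmetric]) auto
  then show ?thesis using map_collect[OF assms(2), of P \<tau> "\<lambda>m. m"] PA by simp
qed

lemma map_add:
  assumes P: "supported R I A P" and Q: "supported R I A Q"
  shows "mpoly_map R S \<psi> \<tau> (P \<oplus>\<^bsub>mpoly_ring R I\<^esub> Q)
     = mpoly_map R S \<psi> \<tau> P \<oplus>\<^bsub>mpoly_ring S J\<^esub> mpoly_map R S \<psi> \<tau> Q"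
proof -
  let ?W = "{m. P m \<noteq> \<zero>\<^bsub>R\<^esub>} \<union> {m. Q m \<noteq> \<zero>\<^bsub>R\<^esub>}"
  have fin: "finite ?W" and c: "\<And>m. P m \<in> A" "\<And>m. Q m \<in> A" using P Q by (auto simp: supported_def)
  have "P \<oplus>\<^bsub>mpoly_ring R I\<^esub> Q = collect R ?W (\<lambda>m. P m \<oplus>\<^bsub>R\<^esub> Q m) (\<lambda>m. m)"
    unfolding R.mpoly_add using fin c by (intro R.collect_self[symmetric]) auto
  then have "mpoly_map R S \<psi> \<tau> (P \<oplus>\<^bsub>mpoly_ring R I\<^esub> Q) = collect S ?W (\<lambda>m. \<psi> (P m \<oplus>\<^bsub>R\<^esub> Q m)) \<tau>"
    using map_collect[OF fin, of "\<lambda>m. P m \<oplus>\<^bsub>R\<^esub> Q m" \<tau> "\<lambda>m. m"] c by simp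
  also have "\<dots> = collect S ?W (\<lambda>m. \<psi> (P m) \<oplus>\<^bsub>S\<^esub> \<psi> (Q m)) \<tau>"
    using c hom_closed by (intro S.collect_cong) (auto simp: hom_add)
  also have "\<dots> = mpoly_map R S \<psi> \<tau> P \<oplus>\<^bsub>mpoly_ring S J\<^esub> mpoly_map R S \<psi> \<tau> Q"
    unfolding S.mpoly_add map_alt[OF P fin, simplified] map_alt[OF Q fin, simplified]
    using c hom_closed by (intro ext S.collect_add) auto
  finally show ?thesis .
qed

lemma map_mult:
  assumes P: "supported R I A P" and Q: "supported R I A Q"
    and \<tau>: "\<And>a b. \<tau> (a + b) = \<tau> a + \<tau> b"
  shows "mpoly_map R S \<psi> \<tau> (P \<otimes>\<^bsub>mpoly_ring R I\<^esub> Q)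
     = mpoly_map R S \<psi> \<tau> P \<otimes>\<^bsub>mpoly_ring S J\<^esub> mpoly_map R S \<psi> \<tau> Q"
proof -
  let ?V = "{m. P m \<noteq> \<zero>\<^bsub>R\<^esub>}" and ?W = "{m. Q m \<noteq> \<zero>\<^bsub>R\<^esub>}"
  have fin: "finite ?V" "finite ?W" and c: "\<And>m. P m \<in> A" "\<And>m. Q m \<in> A"
    using P Q by (auto simp: supported_def)
  note p = R.supported_collect[OF supported_carrier[OF P]] and q = R.supported_collect[OF supported_carrier[OF Q]]
  have "P \<otimes>\<^bsub>mpoly_ring R I\<^esub> Q = collect R (?V \<times> ?W) (\<lambda>(i, j). P i \<otimes>\<^bsub>R\<^esub> Q j) (\<lambda>(i, j). i + j)"
    using R.mult_collect[OF p(2) q(2) p(3) q(3), where w = "\<lambda>m. m" and w' = "\<lambda>m. m"] p(1) q(1) by simp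
  then have "mpoly_map R S \<psi> \<tau> (P \<otimes>\<^bsub>mpoly_ring R I\<^esub> Q)
     = collect S (?V \<times> ?W) (\<lambda>i. \<psi> (case i of (i, j) \<Rightarrow> P i \<otimes>\<^bsub>R\<^esub> Q j)) (\<lambda>i. \<tau> (case i of (i, j) \<Rightarrow> i + j))"
    using map_collect[of "?V \<times> ?W" "\<lambda>(i, j). P i \<otimes>\<^bsub>R\<^esub> Q j" \<tau> "\<lambda>(i, j). i + j"] fin c by (auto simp: Pi_iff)
  also have "\<dots> = collect S (?V \<times> ?W) (\<lambda>(i, j). \<psi> (P i) \<otimes>\<^bsub>S\<^esub> \<psi> (Q j)) (\<lambda>(i, j). \<tau> i + \<tau> j)"
    using c hom_closed by (intro S.collect_cong) (auto simp: hom_mult \<tau>)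
  also have "\<dots> = mpoly_map R S \<psi> \<tau> P \<otimes>\<^bsub>mpoly_ring S J\<^esub> mpoly_map R S \<psi> \<tau> Q"
    unfolding mpoly_map_def using fin c hom_closed by (intro S.mult_collect[symmetric]) auto
  finally show ?thesis .
qed

lemma map_const:
  assumes "a \<in> A" "\<tau> {#} = {#}"
  shows "mpoly_map R S \<psi> \<tau> (R.indexed_const a) = S.indexed_const (\<psi> a)"
proof -
  have "supported R {} A (R.indexed_const a)"
    using assms(1) by (auto simp: supported_def R.indexed_const_def)
  then have "mpoly_map R S \<psi> \<tau> (R.indexed_const a) = collect S {{#}} (\<lambda>m. \<psi> (R.indexed_const a m)) \<tau>"
    by (rule map_alt) (auto simp: R.indexed_const_def)
  also have "\<dots> = S.indexed_const (\<psi> a)"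
  proof
    fix m
    have "{i \<in> {{#}}. \<tau> i = m} = (if m = {#} then {{#}} else {})" using assms(2) by auto
    then show "collect S {{#}} (\<lambda>m. \<psi> (R.indexed_const a m)) \<tau> m = S.indexed_const (\<psi> a) m"
      using hom_closed[OF assms(1)]
      by (auto simp: collect_def R.indexed_const_def S.indexed_const_def S.finsum_insert)
  qed
  finally show ?thesis .
qed

lemma mpoly_map_subring_hom:
  assumes "\<tau> {#} = {#}" "\<And>a b. \<tau> (a + b) = \<tau> a + \<tau> b"
    and "\<And>m. set_mset m \<subseteq> I \<Longrightarrow> set_mset (\<tau> m) \<subseteq> J"
  shows "subring_hom (mpoly_ring R I) (mpoly_ring S J) {P. supported R I A P} (mpoly_map R S \<psi> \<tau>)"
proof -
  interpret D: cring "mpoly_ring R I" by (rule R.mpoly_cring)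
  have minus: "\<ominus>\<^bsub>mpoly_ring R I\<^esub> P = (\<lambda>m. \<ominus>\<^bsub>R\<^esub> P m)" if "supported R I A P" for P
  proof (rule D.minus_equality)
    have PA: "P m \<in> A" for m using that by (auto simp: supported_def)
    show "(\<lambda>m. \<ominus>\<^bsub>R\<^esub> P m) \<oplus>\<^bsub>mpoly_ring R I\<^esub> P = \<zero>\<^bsub>mpoly_ring R I\<^esub>"
      using PA by (simp add: R.mpoly_add R.l_neg)
    show "(\<lambda>m. \<ominus>\<^bsub>R\<^esub> P m) \<in> carrier (mpoly_ring R I)"
      using supported_carrier[OF that]
      by (auto simp: R.mpoly_carrier supported_def elim!: rev_finite_subset) (metis R.minus_zero subsetD)
  qed (rule supported_carrier[OF that])
  have sub: "subring {P. supported R I A P} (mpoly_ring R I)"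
  proof (rule D.subringI)
    show "{P. supported R I A P} \<subseteq> carrier (mpoly_ring R I)" using supported_carrier by auto
    show "\<one>\<^bsub>mpoly_ring R I\<^esub> \<in> {P. supported R I A P}" by (auto simp: R.mpoly_one supported_def)
    fix P assume P: "P \<in> {P. supported R I A P}"
    then show "\<ominus>\<^bsub>mpoly_ring R I\<^esub> P \<in> {P. supported R I A P}"
      by (auto simp: minus supported_def elim!: rev_finite_subset) (metis R.minus_zero subsetD)
    fix Q assume Q: "Q \<in> {P. supported R I A P}"
    show "P \<otimes>\<^bsub>mpoly_ring R I\<^esub> Q \<in> {P. supported R I A P}"
      using P Q R.mult_supported[OF _ _ subring_A] by auto
    have "P \<in> R.indexed_pset I A" "Q \<in> R.indexed_pset I A"
      using P Q R.indexed_pset_iff[OF subring_A] by auto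
    then have "P \<oplus>\<^bsub>mpoly_ring R I\<^esub> Q \<in> R.indexed_pset I A"
      by (auto simp: mpoly_ring_def intro: R.indexed_pset.indexed_padd)
    then show "P \<oplus>\<^bsub>mpoly_ring R I\<^esub> Q \<in> {P. supported R I A P}"
      using R.indexed_pset_iff[OF subring_A] by auto
  qed
  show ?thesis
  proof (intro subring_hom.intro subring_hom_axioms.intro R.mpoly_cring S.mpoly_cring sub)
    show "mpoly_map R S \<psi> \<tau> \<one>\<^bsub>mpoly_ring R I\<^esub> = \<one>\<^bsub>mpoly_ring S J\<^esub>"
      using map_const[of "\<one>\<^bsub>R\<^esub>" \<tau>] assms(1) by (simp add: mpoly_ring_def hom_one)
  qed (simp_all add: map_add map_mult[OF _ _ assms(2)] map_supported[OF _ assms(3)])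
qed

end

lemma mpoly_map_comp:
  assumes "subring_hom R S A \<psi>" "subring_hom S T A' \<psi>'" "\<And>a. a \<in> A \<Longrightarrow> \<psi> a \<in> A'" "supported R I A P"
  shows "mpoly_map S T \<psi>' \<tau>' (mpoly_map R S \<psi> \<tau> P) = mpoly_map R T (\<lambda>a. \<psi>' (\<psi> a)) (\<lambda>m. \<tau>' (\<tau> m)) P"
proof -
  interpret r: subring_hom R S A \<psi> by fact
  interpret s: subring_hom S T A' \<psi>' by fact
  have "finite {m. P m \<noteq> \<zero>\<^bsub>R\<^esub>}" "\<And>m. P m \<in> A" using assms(4) by (auto simp: supported_def)
  then show ?thesis unfolding mpoly_map_def[of R]
    using assms(3) by (intro s.map_collect) auto
qed

lemma mpoly_map_id:
  assumes "cring R" "P \<in> carrier (mpoly_ring R I)" "\<And>m. set_mset m \<subseteq> I \<Longrightarrow> \<tau> m = m"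
  shows "mpoly_map R R (\<lambda>a. a) \<tau> P = P"
proof -
  interpret R: cring R by fact
  have "mpoly_map R R (\<lambda>a. a) \<tau> P = collect R {m. P m \<noteq> \<zero>\<^bsub>R\<^esub>} P (\<lambda>m. m)"
    unfolding mpoly_map_def using assms(2,3)
    by (intro R.collect_cong) (auto simp: R.mpoly_carrier supported_def)
  then show ?thesis using R.supported_collect(1)[OF assms(2)] by simp
qed

lemma mpoly_map_cong:
  assumes "cring S" "supported R I A P" "\<And>a. a \<in> A \<Longrightarrow> \<psi> a = \<psi>' a" "\<And>a. a \<in> A \<Longrightarrow> \<psi> a \<in> carrier S"
    "\<And>m. set_mset m \<subseteq> I \<Longrightarrow> \<tau> m = \<tau>' m"
  shows "mpoly_map R S \<psi> \<tau> P = mpoly_map R S \<psi>' \<tau>' P"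
proof -
  interpret S: cring S by fact
  have "P m \<in> A" for m using assms(2) by (auto simp: supported_def)
  then show ?thesis unfolding mpoly_map_def
    using assms(2-5) by (intro S.collect_cong) (auto simp: supported_def)
qed

section \<open>Fraction fields\<close>

context "domain" begin

abbreviation nonzero where "nonzero \<equiv> carrier R - {\<zero>}"

lemma fraction_eq_iff:
  assumes "a \<in> carrier R" "b \<in> nonzero" "c \<in> carrier R" "d \<in> nonzero"
  shows "fraction R a b = fraction R c d \<longleftrightarrow> a \<otimes> d = c \<otimes> b"
proof
  assume "fraction R a b = fraction R c d"
  moreover have "(a, b) \<in> fraction R a b" using assms by (auto simp: fraction_def)
  ultimately have "(a, b) \<in> fraction R c d" by simp
  then show "a \<otimes> d = c \<otimes> b" by (auto simp: fraction_def)
next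
  have sub: "fraction R a b \<subseteq> fraction R c d" if eq: "a \<otimes> d = c \<otimes> b"
    and c: "a \<in> carrier R" "b \<in> nonzero" "c \<in> carrier R" "d \<in> nonzero" for a b c d
  proof
    fix x assume "x \<in> fraction R a b"
    then obtain u v where x: "x = (u, v)" and uv: "u \<in> carrier R" "v \<in> nonzero" "a \<otimes> v = u \<otimes> b"
      by (auto simp: fraction_def)
    have "b \<otimes> (c \<otimes> v) = (a \<otimes> d) \<otimes> v" using eq c uv by (simp add: m_ac)
    also have "\<dots> = d \<otimes> (a \<otimes> v)" using c uv(1,2) by (simp add: m_ac)
    also have "\<dots> = d \<otimes> (u \<otimes> b)" by (simp only: uv(3))
    also have "\<dots> = b \<otimes> (u \<otimes> d)" using c uv(1,2) by (simp add: m_ac)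
    finally have "c \<otimes> v = u \<otimes> d" using c uv by (simp add: m_lcancel)
    then show "x \<in> fraction R c d" using x uv by (simp add: fraction_def)
  qed
  assume "a \<otimes> d = c \<otimes> b"
  then show "fraction R a b = fraction R c d" using sub[of a d c b, OF _ assms] sub[of c b a d, OF _ assms(3,4,1,2)] by (metis subset_antisym)
qed

lemma fraction_memD:
  assumes "(c, d) \<in> fraction R a b" "a \<in> carrier R" "b \<in> nonzero"
  shows "c \<in> carrier R" "d \<in> nonzero" "a \<otimes> d = c \<otimes> b"
  using assms by (auto simp: fraction_def)

lemma frac_mult:
  assumes "a \<in> carrier R" "b \<in> nonzero" "c \<in> carrier R" "d \<in> nonzero"
  shows "fraction R a b \<otimes>\<^bsub>frac_field R\<^esub> fraction R c d = fraction R (a \<otimes> c) (b \<otimes> d)"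
proof -
  have eq: "fraction R (a' \<otimes> c') (b' \<otimes> d') = fraction R (a \<otimes> c) (b \<otimes> d)"
    if "(a', b') \<in> fraction R a b" "(c', d') \<in> fraction R c d" for a' b' c' d'
  proof -
    note x = fraction_memD[OF that(1) assms(1,2)] and y = fraction_memD[OF that(2) assms(3,4)]
    have "a' \<otimes> c' \<otimes> (b \<otimes> d) = (a' \<otimes> b) \<otimes> (c' \<otimes> d)" using x(1,2) y(1,2) assms by (simp add: m_ac)
    also have "\<dots> = a \<otimes> c \<otimes> (b' \<otimes> d')" unfolding x(3)[symmetric] y(3)[symmetric]
      using x(1,2) y(1,2) assms by (simp add: m_ac)
    finally show ?thesis using x(1,2) y(1,2) assms by (subst fraction_eq_iff) (auto simp: integral_iff)
  qed
  have self: "(a, b) \<in> fraction R a b" "(c, d) \<in> fraction R c d"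
    using assms by (auto simp: fraction_def)
  let ?S = "{fraction R (a' \<otimes> c') (b' \<otimes> d') | a' b' c' d'. (a', b') \<in> fraction R a b \<and> (c', d') \<in> fraction R c d}"
  have "?S = {fraction R (a \<otimes> c) (b \<otimes> d)}"
  proof (rule equalityI)
    show "?S \<subseteq> {fraction R (a \<otimes> c) (b \<otimes> d)}" 
    proof
      fix z assume "z \<in> ?S"
      then show "z \<in> {fraction R (a \<otimes> c) (b \<otimes> d)}"
        by (elim CollectE exE conjE) (simp only: eq singleton_iff)
    qed
    show "{fraction R (a \<otimes> c) (b \<otimes> d)} \<subseteq> ?S" using self
      by (simp only: insert_subset empty_subsetI simp_thms) (intro CollectI exI[of _ a] exI[of _ b] exI[of _ c] exI[of _ d], simp)
  qed
  then show ?thesis by (simp add: frac_field_def)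
qed

lemma frac_add:
  assumes "a \<in> carrier R" "b \<in> nonzero" "c \<in> carrier R" "d \<in> nonzero"
  shows "fraction R a b \<oplus>\<^bsub>frac_field R\<^esub> fraction R c d = fraction R (a \<otimes> d \<oplus> c \<otimes> b) (b \<otimes> d)"
proof -
  have eq: "fraction R (a' \<otimes> d' \<oplus> c' \<otimes> b') (b' \<otimes> d') = fraction R (a \<otimes> d \<oplus> c \<otimes> b) (b \<otimes> d)"
    if "(a', b') \<in> fraction R a b" "(c', d') \<in> fraction R c d" for a' b' c' d'
  proof -
    note x = fraction_memD[OF that(1) assms(1,2)] and y = fraction_memD[OF that(2) assms(3,4)]
    have "(a' \<otimes> d' \<oplus> c' \<otimes> b') \<otimes> (b \<otimes> d) = (a' \<otimes> b) \<otimes> (d \<otimes> d') \<oplus> (c' \<otimes> d) \<otimes> (b \<otimes> b')"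
      using x(1,2) y(1,2) assms by (simp add: l_distr r_distr m_ac)
    also have "\<dots> = (a \<otimes> d \<oplus> c \<otimes> b) \<otimes> (b' \<otimes> d')" unfolding x(3)[symmetric] y(3)[symmetric]
      using x(1,2) y(1,2) assms by (simp add: l_distr r_distr m_ac)
    finally show ?thesis using x(1,2) y(1,2) assms by (subst fraction_eq_iff) (auto simp: integral_iff)
  qed
  have self: "(a, b) \<in> fraction R a b" "(c, d) \<in> fraction R c d"
    using assms by (auto simp: fraction_def)
  let ?S = "{fraction R (a' \<otimes> d' \<oplus> c' \<otimes> b') (b' \<otimes> d') | a' b' c' d'. (a', b') \<in> fraction R a b \<and> (c', d') \<in> fraction R c d}"
  have "?S = {fraction R (a \<otimes> d \<oplus> c \<otimes> b) (b \<otimes> d)}"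
  proof (rule equalityI)
    show "?S \<subseteq> {fraction R (a \<otimes> d \<oplus> c \<otimes> b) (b \<otimes> d)}" 
    proof
      fix z assume "z \<in> ?S"
      then show "z \<in> {fraction R (a \<otimes> d \<oplus> c \<otimes> b) (b \<otimes> d)}"
        by (elim CollectE exE conjE) (simp only: eq singleton_iff)
    qed
    show "{fraction R (a \<otimes> d \<oplus> c \<otimes> b) (b \<otimes> d)} \<subseteq> ?S" using self
      by (simp only: insert_subset empty_subsetI simp_thms) (intro CollectI exI[of _ a] exI[of _ b] exI[of _ c] exI[of _ d], simp)
  qed
  then show ?thesis by (simp add: frac_field_def)
qed

lemma frac_carrierE:
  assumes "x \<in> carrier (frac_field R)"
  obtains a b where "a \<in> carrier R" "b \<in> nonzero" "x = fraction R a b"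
  using assms by (auto simp: frac_field_def)

lemma frac_carrierI: "a \<in> carrier R \<Longrightarrow> b \<in> nonzero \<Longrightarrow> fraction R a b \<in> carrier (frac_field R)"
  by (auto simp: frac_field_def)

lemma frac_one: "\<one>\<^bsub>frac_field R\<^esub> = fraction R \<one> \<one>"
  and frac_zero: "\<zero>\<^bsub>frac_field R\<^esub> = fraction R \<zero> \<one>"
  by (simp_all add: frac_field_def)

lemma frac_eq_zero_iff: "a \<in> carrier R \<Longrightarrow> b \<in> nonzero \<Longrightarrow> fraction R a b = \<zero>\<^bsub>frac_field R\<^esub> \<longleftrightarrow> a = \<zero>"
  by (simp add: frac_zero fraction_eq_iff)

lemma nonzero_mult: "b \<in> nonzero \<Longrightarrow> d \<in> nonzero \<Longrightarrow> b \<otimes> d \<in> nonzero"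
  by (auto simp: integral_iff)

lemma frac_cring: "cring (frac_field R)"
proof -
  let ?E = "frac_field R"
  have one: "\<one> \<in> nonzero" by simp
  have abelian: "abelian_group ?E"
  proof (rule abelian_groupI)
    fix x y assume "x \<in> carrier ?E" "y \<in> carrier ?E"
    then obtain a b c d where abcd: "a \<in> carrier R" "b \<in> nonzero" "x = fraction R a b"
      "c \<in> carrier R" "d \<in> nonzero" "y = fraction R c d" by (elim frac_carrierE)
    show "x \<oplus>\<^bsub>?E\<^esub> y \<in> carrier ?E"
      using abcd nonzero_mult[of b d] by (simp add: frac_add frac_carrierI)
    show "x \<oplus>\<^bsub>?E\<^esub> y = y \<oplus>\<^bsub>?E\<^esub> x" using abcd by (simp add: frac_add m_comm a_comm)
    fix z assume "z \<in> carrier ?E"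
    then obtain e f where ef: "e \<in> carrier R" "f \<in> nonzero" "z = fraction R e f" by (elim frac_carrierE)
    have cs: "a \<in> carrier R" "b \<in> carrier R" "c \<in> carrier R" "d \<in> carrier R" "e \<in> carrier R" "f \<in> carrier R"
      using abcd ef by auto
    note n = nonzero_mult[OF abcd(2,5)] nonzero_mult[OF abcd(5) ef(2)]
    have "x \<oplus>\<^bsub>?E\<^esub> y \<oplus>\<^bsub>?E\<^esub> z = fraction R ((a \<otimes> d \<oplus> c \<otimes> b) \<otimes> f \<oplus> e \<otimes> (b \<otimes> d)) (b \<otimes> d \<otimes> f)"
      unfolding abcd(3,6) ef(3) using abcd(2,5) ef(2) n cs by (simp only: frac_add a_closed m_closed)
    also have "\<dots> = fraction R (a \<otimes> (d \<otimes> f) \<oplus> (c \<otimes> f \<oplus> e \<otimes> d) \<otimes> b) (b \<otimes> (d \<otimes> f))"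
      using cs by (simp add: l_distr r_distr m_ac a_ac)
    also have "\<dots> = x \<oplus>\<^bsub>?E\<^esub> (y \<oplus>\<^bsub>?E\<^esub> z)"
      unfolding abcd(3,6) ef(3) using abcd(2,5) ef(2) n cs by (simp only: frac_add a_closed m_closed)
    finally show "x \<oplus>\<^bsub>?E\<^esub> y \<oplus>\<^bsub>?E\<^esub> z = x \<oplus>\<^bsub>?E\<^esub> (y \<oplus>\<^bsub>?E\<^esub> z)" .
  next
    fix x assume "x \<in> carrier ?E"
    then obtain a b where ab: "a \<in> carrier R" "b \<in> nonzero" "x = fraction R a b" by (elim frac_carrierE)
    show "\<zero>\<^bsub>?E\<^esub> \<oplus>\<^bsub>?E\<^esub> x = x" using ab by (simp add: frac_zero frac_add)
    have "fraction R (\<ominus> a) b \<oplus>\<^bsub>?E\<^esub> x = \<zero>\<^bsub>?E\<^esub>"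
      using ab nonzero_mult[of b b] by (simp add: frac_add frac_eq_zero_iff l_minus l_neg)
    then show "\<exists>y\<in>carrier ?E. y \<oplus>\<^bsub>?E\<^esub> x = \<zero>\<^bsub>?E\<^esub>"
      using ab by (intro bexI[of _ "fraction R (\<ominus> a) b"]) (auto intro: frac_carrierI)
  qed (simp add: frac_zero frac_carrierI one)
  show ?thesis
  proof (rule cringI[OF abelian])
    show "Group.comm_monoid ?E"
    proof (rule comm_monoidI)
      fix x y assume "x \<in> carrier ?E" "y \<in> carrier ?E"
      then obtain a b c d where abcd: "a \<in> carrier R" "b \<in> nonzero" "x = fraction R a b"
        "c \<in> carrier R" "d \<in> nonzero" "y = fraction R c d" by (elim frac_carrierE)
      show "x \<otimes>\<^bsub>?E\<^esub> y \<in> carrier ?E"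
        using abcd nonzero_mult[of b d] by (simp add: frac_mult frac_carrierI)
      show "x \<otimes>\<^bsub>?E\<^esub> y = y \<otimes>\<^bsub>?E\<^esub> x" using abcd by (simp add: frac_mult m_comm)
      fix z assume "z \<in> carrier ?E"
      then obtain e f where ef: "e \<in> carrier R" "f \<in> nonzero" "z = fraction R e f" by (elim frac_carrierE)
      have cs: "a \<in> carrier R" "b \<in> carrier R" "c \<in> carrier R" "d \<in> carrier R" "e \<in> carrier R" "f \<in> carrier R"
        using abcd ef by auto
      note n = nonzero_mult[OF abcd(2,5)] nonzero_mult[OF abcd(5) ef(2)]
      show "x \<otimes>\<^bsub>?E\<^esub> y \<otimes>\<^bsub>?E\<^esub> z = x \<otimes>\<^bsub>?E\<^esub> (y \<otimes>\<^bsub>?E\<^esub> z)"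
        unfolding abcd(3,6) ef(3) using abcd(2,5) ef(2) n cs by (simp only: frac_mult m_closed m_assoc)
    next
      fix x assume "x \<in> carrier ?E"
      then obtain a b where ab: "a \<in> carrier R" "b \<in> nonzero" "x = fraction R a b" by (elim frac_carrierE)
      show "\<one>\<^bsub>?E\<^esub> \<otimes>\<^bsub>?E\<^esub> x = x" using ab by (simp add: frac_one frac_mult)
    qed (simp add: frac_one frac_carrierI)
  next
    fix x y z assume "x \<in> carrier ?E" "y \<in> carrier ?E" "z \<in> carrier ?E"
    then obtain a b c d e f where r: "a \<in> carrier R" "b \<in> nonzero" "x = fraction R a b"
      "c \<in> carrier R" "d \<in> nonzero" "y = fraction R c d"
      "e \<in> carrier R" "f \<in> nonzero" "z = fraction R e f" by (elim frac_carrierE)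
    show "(x \<oplus>\<^bsub>?E\<^esub> y) \<otimes>\<^bsub>?E\<^esub> z = x \<otimes>\<^bsub>?E\<^esub> z \<oplus>\<^bsub>?E\<^esub> y \<otimes>\<^bsub>?E\<^esub> z"
    proof -
      note bd = nonzero_mult[OF r(2,5)] and bf = nonzero_mult[OF r(2,8)] and df = nonzero_mult[OF r(5,8)]
      note n = bd bf df nonzero_mult[OF bd r(8)] nonzero_mult[OF bf df]
      have c: "a \<in> carrier R" "b \<in> carrier R" "c \<in> carrier R" "d \<in> carrier R" "e \<in> carrier R" "f \<in> carrier R"
        using r by auto
      have "(x \<oplus>\<^bsub>?E\<^esub> y) \<otimes>\<^bsub>?E\<^esub> z = fraction R ((a \<otimes> d \<oplus> c \<otimes> b) \<otimes> e) ((b \<otimes> d) \<otimes> f)"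
        unfolding r(3,6,9) using r(2,5,8) n c by (simp only: frac_add frac_mult a_closed m_closed)
      also have "\<dots> = fraction R ((a \<otimes> e) \<otimes> (d \<otimes> f) \<oplus> (c \<otimes> e) \<otimes> (b \<otimes> f)) ((b \<otimes> f) \<otimes> (d \<otimes> f))"
      proof (subst fraction_eq_iff)
        show "(a \<otimes> d \<oplus> c \<otimes> b) \<otimes> e \<otimes> ((b \<otimes> f) \<otimes> (d \<otimes> f))
           = ((a \<otimes> e) \<otimes> (d \<otimes> f) \<oplus> (c \<otimes> e) \<otimes> (b \<otimes> f)) \<otimes> ((b \<otimes> d) \<otimes> f)"
          using c by (simp add: l_distr r_distr m_ac)
      qed (use n c in auto)
      also have "\<dots> = x \<otimes>\<^bsub>?E\<^esub> z \<oplus>\<^bsub>?E\<^esub> y \<otimes>\<^bsub>?E\<^esub> z"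
        unfolding r(3,6,9) using r(2,5,8) n c by (simp only: frac_add frac_mult a_closed m_closed)
      finally show ?thesis .
    qed
  qed
qed

lemma frac_inverse:
  assumes "a \<in> nonzero" "b \<in> nonzero"
  shows "fraction R a b \<otimes>\<^bsub>frac_field R\<^esub> fraction R b a = \<one>\<^bsub>frac_field R\<^esub>"
  using assms nonzero_mult[of b a] by (simp add: frac_mult frac_one fraction_eq_iff m_comm)

lemma frac_field_field: "field (frac_field R)"
proof -
  interpret E: cring "frac_field R" by (rule frac_cring)
  show ?thesis
  proof (rule E.cring_fieldI2)
    show "\<zero>\<^bsub>frac_field R\<^esub> \<noteq> \<one>\<^bsub>frac_field R\<^esub>"
      by (metis frac_eq_zero_iff frac_one one_closed one_not_zero DiffI singletonD)
    fix x assume x: "x \<in> carrier (frac_field R)" "x \<noteq> \<zero>\<^bsub>frac_field R\<^esub>"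
    then obtain a b where ab: "a \<in> carrier R" "b \<in> nonzero" "x = fraction R a b" by (elim frac_carrierE)
    then have "a \<in> nonzero" using x(2) frac_eq_zero_iff by auto
    then show "\<exists>y\<in>carrier (frac_field R). x \<otimes>\<^bsub>frac_field R\<^esub> y = \<one>\<^bsub>frac_field R\<^esub>"
      using ab frac_inverse frac_carrierI by blast
  qed
qed

lemma frac_inv:
  assumes "a \<in> nonzero" "b \<in> nonzero"
  shows "inv\<^bsub>frac_field R\<^esub> (fraction R a b) = fraction R b a"
proof -
  interpret E: field "frac_field R" by (rule frac_field_field)
  show ?thesis using assms frac_inverse[OF assms] frac_carrierI
    by (intro E.comm_inv_char) auto
qed

lemma frac_minus:
  assumes "a \<in> carrier R" "b \<in> nonzero"
  shows "\<ominus>\<^bsub>frac_field R\<^esub> (fraction R a b) = fraction R (\<ominus> a) b"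
proof -
  interpret E: field "frac_field R" by (rule frac_field_field)
  show ?thesis using assms nonzero_mult[of b b] frac_carrierI
    by (intro E.minus_equality) (auto simp: frac_add frac_eq_zero_iff l_minus l_neg)
qed

text \<open>
  An automorphism of \<open>R\<close> permutes the representatives of a fraction; its inverse shows that the image is the
  whole class.
\<close>

lemma map_prod_fraction:
  assumes \<alpha>: "\<alpha> \<in> ring_hom R R" and \<beta>: "\<beta> \<in> ring_hom R R"
    and inv: "\<And>x. x \<in> carrier R \<Longrightarrow> \<alpha> (\<beta> x) = x" "\<And>x. x \<in> carrier R \<Longrightarrow> \<beta> (\<alpha> x) = x"
    and ab: "a \<in> carrier R" "b \<in> nonzero"
  shows "map_prod \<alpha> \<alpha> ` fraction R a b = fraction R (\<alpha> a) (\<alpha> b)"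
proof -
  have hom: "map_prod \<gamma> \<gamma> ` fraction R a b \<subseteq> fraction R (\<gamma> a) (\<gamma> b)"
    if \<gamma>: "\<gamma> \<in> ring_hom R R" and ker: "\<And>x. x \<in> carrier R \<Longrightarrow> \<gamma> x = \<zero> \<Longrightarrow> x = \<zero>"
      and ab: "a \<in> carrier R" "b \<in> nonzero" for \<gamma> a b
  proof
    fix x assume "x \<in> map_prod \<gamma> \<gamma> ` fraction R a b"
    then obtain c d where cd: "(c, d) \<in> fraction R a b" "x = (\<gamma> c, \<gamma> d)" by auto
    note m = fraction_memD[OF cd(1) ab]
    have "\<gamma> d \<noteq> \<zero>" using ker m(2) by blast
    moreover have "\<gamma> a \<otimes> \<gamma> d = \<gamma> c \<otimes> \<gamma> b"
      using m ab ring_hom_mult[OF \<gamma>] by (metis DiffD1)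
    ultimately show "x \<in> fraction R (\<gamma> a) (\<gamma> b)"
      using cd(2) m ring_hom_closed[OF \<gamma>] by (auto simp: fraction_def)
  qed
  have zero: "\<alpha> \<zero> = \<zero>" "\<beta> \<zero> = \<zero>"
    using ring_hom_zero[OF \<alpha>] ring_hom_zero[OF \<beta>] ring_axioms by auto
  have ker: "x = \<zero>" if "x \<in> carrier R" "\<alpha> x = \<zero>" for x
    using inv(2)[OF that(1)] that(2) zero by simp
  have ker': "x = \<zero>" if "x \<in> carrier R" "\<beta> x = \<zero>" for x
    using inv(1)[OF that(1)] that(2) zero by simp
  have \<alpha>ab: "\<alpha> a \<in> carrier R" "\<alpha> b \<in> nonzero"
    using ab ker ring_hom_closed[OF \<alpha>] by auto
  show ?thesis
  proof (rule equalityI)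
    show "map_prod \<alpha> \<alpha> ` fraction R a b \<subseteq> fraction R (\<alpha> a) (\<alpha> b)"
      by (rule hom[OF \<alpha> ker ab])
    show "fraction R (\<alpha> a) (\<alpha> b) \<subseteq> map_prod \<alpha> \<alpha> ` fraction R a b"
    proof
      fix x assume x: "x \<in> fraction R (\<alpha> a) (\<alpha> b)"
      obtain c d where cd: "x = (c, d)" by (cases x)
      have "map_prod \<beta> \<beta> x \<in> fraction R (\<beta> (\<alpha> a)) (\<beta> (\<alpha> b))"
        using hom[OF \<beta> ker' \<alpha>ab] x by auto
      then have "map_prod \<beta> \<beta> x \<in> fraction R a b" using inv(2) ab by auto
      moreover have "x = map_prod \<alpha> \<alpha> (map_prod \<beta> \<beta> x)"
        using x cd inv(1) by (auto simp: fraction_def)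
      ultimately show "x \<in> map_prod \<alpha> \<alpha> ` fraction R a b" by (metis imageI)
    qed
  qed
qed

end

section \<open>Residue maps on fraction fields\<close>

text \<open>
  The condition \<open>local\<close> says that \<open>V\<close> is a local ring whose maximal ideal is the kernel of \<open>\<rho>\<close>.
\<close>

locale place = E: field E + E': field E' + subring_hom E E' V \<rho>
  for E :: "('a, 'm) ring_scheme" and E' :: "('b, 'n) ring_scheme" and V and \<rho> +
  assumes local: "x \<in> V \<Longrightarrow> \<rho> x \<noteq> \<zero>\<^bsub>E'\<^esub> \<Longrightarrow> inv\<^bsub>E\<^esub> x \<in> V"

text \<open>
  A homomorphism from a subring \<open>B\<close> of one domain to another extends to the fractions whose denominator it does not
  kill, that is, to the localisation of \<open>B\<close> at the kernel.
\<close>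

locale fraction_place = D: "domain" D + D': "domain" D' + subring_hom D D' B \<theta>
  for D :: "('a, 'm) ring_scheme" and D' :: "('b, 'n) ring_scheme" and B and \<theta>
begin

definition localization where
  "localization = {fraction D a b | a b. a \<in> B \<and> b \<in> B \<and> \<theta> b \<noteq> \<zero>\<^bsub>D'\<^esub>}"

text \<open>
  The choice does not matter: equal fractions have equal images, see \<open>residue_fraction\<close>.
\<close>

definition residue where
  "residue f = (SOME y. \<exists>a b. a \<in> B \<and> b \<in> B \<and> \<theta> b \<noteq> \<zero>\<^bsub>D'\<^esub> \<and> f = fraction D a b \<and> y = fraction D' (\<theta> a) (\<theta> b))"

lemma denominator: "b \<in> B \<Longrightarrow> \<theta> b \<noteq> \<zero>\<^bsub>D'\<^esub> \<Longrightarrow> b \<in> D.nonzero \<and> \<theta> b \<in> D'.nonzero"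
  using hom_closed by auto

lemma residue_fraction:
  assumes "a \<in> B" "b \<in> B" "\<theta> b \<noteq> \<zero>\<^bsub>D'\<^esub>"
  shows "residue (fraction D a b) = fraction D' (\<theta> a) (\<theta> b)"
  unfolding residue_def
proof (rule some_equality)
  fix y assume "\<exists>c d. c \<in> B \<and> d \<in> B \<and> \<theta> d \<noteq> \<zero>\<^bsub>D'\<^esub> \<and> fraction D a b = fraction D c d \<and> y = fraction D' (\<theta> c) (\<theta> d)"
  then obtain c d where cd: "c \<in> B" "d \<in> B" "\<theta> d \<noteq> \<zero>\<^bsub>D'\<^esub>" "fraction D a b = fraction D c d"
    "y = fraction D' (\<theta> c) (\<theta> d)" by blast
  have "a \<otimes>\<^bsub>D\<^esub> d = c \<otimes>\<^bsub>D\<^esub> b"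
    using cd(4) D.fraction_eq_iff denominator cd assms by auto
  then have "\<theta> a \<otimes>\<^bsub>D'\<^esub> \<theta> d = \<theta> c \<otimes>\<^bsub>D'\<^esub> \<theta> b" using hom_mult assms cd by metis
  then show "y = fraction D' (\<theta> a) (\<theta> b)"
    using cd assms denominator hom_closed by (subst cd(5), subst D'.fraction_eq_iff) auto
qed (use assms in blast)

lemma localizationE:
  assumes "x \<in> localization"
  obtains a b where "a \<in> B" "b \<in> B" "\<theta> b \<noteq> \<zero>\<^bsub>D'\<^esub>" "x = fraction D a b"
  using assms by (auto simp: localization_def)

lemma localizationI: "a \<in> B \<Longrightarrow> b \<in> B \<Longrightarrow> \<theta> b \<noteq> \<zero>\<^bsub>D'\<^esub> \<Longrightarrow> fraction D a b \<in> localization"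
  by (auto simp: localization_def)

lemma denominator_mult:
  assumes "b \<in> B" "\<theta> b \<noteq> \<zero>\<^bsub>D'\<^esub>" "d \<in> B" "\<theta> d \<noteq> \<zero>\<^bsub>D'\<^esub>"
  shows "b \<otimes>\<^bsub>D\<^esub> d \<in> B" "\<theta> (b \<otimes>\<^bsub>D\<^esub> d) \<noteq> \<zero>\<^bsub>D'\<^esub>"
  using assms hom_closed by (auto simp: hom_mult D'.integral_iff)

lemma place: "place (frac_field D) (frac_field D') localization residue"
proof -
  interpret E: field "frac_field D" by (rule D.frac_field_field)
  interpret E': field "frac_field D'" by (rule D'.frac_field_field)
  have one: "\<one>\<^bsub>D\<^esub> \<in> B" "\<theta> \<one>\<^bsub>D\<^esub> \<noteq> \<zero>\<^bsub>D'\<^esub>" using hom_one by auto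
  have add: "x \<oplus>\<^bsub>frac_field D\<^esub> y \<in> localization
      \<and> residue (x \<oplus>\<^bsub>frac_field D\<^esub> y) = residue x \<oplus>\<^bsub>frac_field D'\<^esub> residue y"
    and mult: "x \<otimes>\<^bsub>frac_field D\<^esub> y \<in> localization
      \<and> residue (x \<otimes>\<^bsub>frac_field D\<^esub> y) = residue x \<otimes>\<^bsub>frac_field D'\<^esub> residue y"
    if xy: "x \<in> localization" "y \<in> localization" for x y
  proof -
    obtain a b c d where r: "a \<in> B" "b \<in> B" "\<theta> b \<noteq> \<zero>\<^bsub>D'\<^esub>" "x = fraction D a b"
      "c \<in> B" "d \<in> B" "\<theta> d \<noteq> \<zero>\<^bsub>D'\<^esub>" "y = fraction D c d" using xy by (elim localizationE)
    note bd = denominator_mult[OF r(2,3,6,7)]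
    note n = denominator[OF r(2,3)] denominator[OF r(6,7)]
    show "x \<oplus>\<^bsub>frac_field D\<^esub> y \<in> localization
      \<and> residue (x \<oplus>\<^bsub>frac_field D\<^esub> y) = residue x \<oplus>\<^bsub>frac_field D'\<^esub> residue y"
      using r bd n hom_closed
      by (auto simp: D.frac_add D'.frac_add residue_fraction hom_add hom_mult intro!: localizationI)
    show "x \<otimes>\<^bsub>frac_field D\<^esub> y \<in> localization
      \<and> residue (x \<otimes>\<^bsub>frac_field D\<^esub> y) = residue x \<otimes>\<^bsub>frac_field D'\<^esub> residue y"
      using r bd n hom_closed
      by (auto simp: D.frac_mult D'.frac_mult residue_fraction hom_mult intro!: localizationI)
  qed
  have sub: "subring localization (frac_field D)"
  proof (rule E.subringI)
    show "localization \<subseteq> carrier (frac_field D)"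
      using D.frac_carrierI denominator by (auto simp: localization_def)
    show "\<one>\<^bsub>frac_field D\<^esub> \<in> localization" using one by (auto simp: D.frac_one intro!: localizationI)
    fix x assume "x \<in> localization"
    then show "\<ominus>\<^bsub>frac_field D\<^esub> x \<in> localization"
      using denominator by (elim localizationE) (auto simp: D.frac_minus intro!: localizationI)
  qed (use add mult in auto)
  show ?thesis
  proof (intro place.intro subring_hom.intro subring_hom_axioms.intro place_axioms.intro
      E.is_cring E'.is_cring sub E.field_axioms E'.field_axioms)
    fix x assume "x \<in> localization"
    then obtain a b where ab: "a \<in> B" "b \<in> B" "\<theta> b \<noteq> \<zero>\<^bsub>D'\<^esub>" "x = fraction D a b" by (elim localizationE)
    show "residue x \<in> carrier (frac_field D')"
      using ab denominator hom_closed by (auto simp: residue_fraction intro!: D'.frac_carrierI)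
    assume "residue x \<noteq> \<zero>\<^bsub>frac_field D'\<^esub>"
    then have "\<theta> a \<noteq> \<zero>\<^bsub>D'\<^esub>"
      using ab denominator hom_closed by (auto simp: residue_fraction D'.frac_eq_zero_iff)
    then show "inv\<^bsub>frac_field D\<^esub> x \<in> localization"
      using ab denominator[of a] denominator[of b] by (auto simp: D.frac_inv intro!: localizationI)
  qed (use add mult one in \<open>auto simp: D.frac_one D'.frac_one residue_fraction hom_one\<close>)
qed

end

section \<open>Transcendence degree of residue fields\<close>

context subring_hom begin

lemma A_pow: "a \<in> A \<Longrightarrow> a [^]\<^bsub>R\<^esub> (n::nat) \<in> A"
  by (induction n) auto

lemma hom_pow: "a \<in> A \<Longrightarrow> \<psi> (a [^]\<^bsub>R\<^esub> (n::nat)) = \<psi> a [^]\<^bsub>S\<^esub> n"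
  by (induction n) (auto simp: hom_one hom_mult A_pow)

lemma finprod_A: "F \<in> W \<rightarrow> A \<Longrightarrow> finprod R F W \<in> A"
proof (induction W rule: infinite_finite_induct)
  case (insert i W)
  then show ?case by (subst R.finprod_insert) (auto simp: Pi_iff)
qed simp_all

lemma hom_finprod: "F \<in> W \<rightarrow> A \<Longrightarrow> \<psi> (finprod R F W) = finprod S (\<lambda>i. \<psi> (F i)) W"
proof (induction W rule: infinite_finite_induct)
  case (insert i W)
  then have "finprod R F (insert i W) = F i \<otimes>\<^bsub>R\<^esub> finprod R F W"
    by (subst R.finprod_insert) (auto simp: Pi_iff)
  moreover have "finprod R F W \<in> A" using insert.prems by (intro finprod_A) auto
  moreover have "finprod S (\<lambda>i. \<psi> (F i)) (insert i W) = \<psi> (F i) \<otimes>\<^bsub>S\<^esub> finprod S (\<lambda>i. \<psi> (F i)) W"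
    using insert hom_closed by (subst S.finprod_insert) (auto simp: Pi_iff)
  ultimately show ?case using insert by (auto simp: hom_mult Pi_iff)
qed (simp_all add: hom_one)

lemma subring_hom_subset:
  assumes "subring B R" "B \<subseteq> A"
  shows "subring_hom R S B \<psi>"
  using assms(2)
  by (intro subring_hom.intro subring_hom_axioms.intro R.is_cring S.is_cring assms(1))
    (auto simp: hom_closed hom_one subsetD intro!: hom_add hom_mult)

end

context place begin

text \<open>
  If \<open>\<rho> a \<noteq> 0\<close>, then \<open>a\<close> is invertible in \<open>V\<close> as well as in \<open>L\<close>, and \<open>\<rho>\<close> maps its inverse to that of \<open>\<rho> a\<close>.
\<close>

lemma residue_subfield:
  assumes L: "subfield L E"
  shows "subfield (\<rho> ` (L \<inter> V)) E'"
proof (rule E'.subfieldI')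
  have sub: "subring (L \<inter> V) E" using E.subring_inter[OF subfieldE(1)[OF L] subring_A] by simp
  note s = subringE[OF sub]
  show "subring (\<rho> ` (L \<inter> V)) E'"
  proof (rule E'.subringI)
    show "\<rho> ` (L \<inter> V) \<subseteq> carrier E'" using hom_closed by auto
    show "\<one>\<^bsub>E'\<^esub> \<in> \<rho> ` (L \<inter> V)" using s(3) hom_one by (metis imageI)
    fix x assume "x \<in> \<rho> ` (L \<inter> V)"
    then obtain a where a: "a \<in> L \<inter> V" "x = \<rho> a" by auto
    then show "\<ominus>\<^bsub>E'\<^esub> x \<in> \<rho> ` (L \<inter> V)" using s(5) hom_minus by (metis IntD2 imageI)
    fix y assume "y \<in> \<rho> ` (L \<inter> V)"
    then obtain b where b: "b \<in> L \<inter> V" "y = \<rho> b" by auto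
    show "x \<otimes>\<^bsub>E'\<^esub> y \<in> \<rho> ` (L \<inter> V)" using a b s(6) hom_mult by (metis IntD2 imageI)
    show "x \<oplus>\<^bsub>E'\<^esub> y \<in> \<rho> ` (L \<inter> V)" using a b s(7) hom_add by (metis IntD2 imageI)
  qed
  fix x assume "x \<in> \<rho> ` (L \<inter> V) - {\<zero>\<^bsub>E'\<^esub>}"
  then obtain a where a: "a \<in> L" "a \<in> V" "x = \<rho> a" "\<rho> a \<noteq> \<zero>\<^bsub>E'\<^esub>" by auto
  then have a0: "a \<noteq> \<zero>\<^bsub>E\<^esub>" by auto
  have inv: "inv\<^bsub>E\<^esub> a \<in> L \<inter> V" using a a0 local E.subfield_m_inv(1)[OF L, of a] by auto
  have "inv\<^bsub>E\<^esub> a \<otimes>\<^bsub>E\<^esub> a = \<one>\<^bsub>E\<^esub>" using a a0 E.field_Units by auto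
  then have "\<rho> (inv\<^bsub>E\<^esub> a) \<otimes>\<^bsub>E'\<^esub> \<rho> a = \<one>\<^bsub>E'\<^esub>" using inv a hom_mult hom_one by (metis IntD2)
  then have "inv\<^bsub>E'\<^esub> x = \<rho> (inv\<^bsub>E\<^esub> a)"
    using a inv hom_closed E'.m_comm by (intro E'.comm_inv_char) auto
  then show "inv\<^bsub>E'\<^esub> x \<in> \<rho> ` (L \<inter> V)" using inv by auto
qed

text \<open>
  Preimages of algebraically independent elements are algebraically independent: a polynomial relation between
  them is a linear relation between finitely many monomials, and by \<open>descent\<close> it would yield one between the
  images of these monomials.
\<close>

lemma trdeg_residue_le:
  assumes L: "subfield L E" and K: "subring K E" "K \<subseteq> L" and K': "subring K' E'"
    and descent: "\<And>(W :: 'a multiset set) z c i. finite W \<Longrightarrow> z \<in> W \<rightarrow> L \<inter> V \<Longrightarrow> c \<in> W \<rightarrow> K \<Longrightarrow>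
      (\<Oplus>\<^bsub>E\<^esub>i\<in>W. c i \<otimes>\<^bsub>E\<^esub> z i) = \<zero>\<^bsub>E\<^esub> \<Longrightarrow> i \<in> W \<Longrightarrow> c i \<noteq> \<zero>\<^bsub>E\<^esub> \<Longrightarrow>
      \<exists>c'. c' \<in> W \<rightarrow> K' \<and> (\<exists>i\<in>W. c' i \<noteq> \<zero>\<^bsub>E'\<^esub>) \<and> (\<Oplus>\<^bsub>E'\<^esub>i\<in>W. c' i \<otimes>\<^bsub>E'\<^esub> \<rho> (z i)) = \<zero>\<^bsub>E'\<^esub>"
  shows "trdeg E' K' (\<rho> ` (L \<inter> V)) \<le> trdeg E K L"
  unfolding trdeg_def
proof (rule SUP_least)
  fix S' assume "S' \<in> {S. S \<subseteq> \<rho> ` (L \<inter> V) \<and> finite S \<and> alg_independent E' K' S}"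
  then have S': "S' \<subseteq> \<rho> ` (L \<inter> V)" "finite S'" "alg_independent E' K' S'" by auto
  have "\<forall>y\<in>S'. \<exists>x. x \<in> L \<inter> V \<and> \<rho> x = y" using S'(1) by auto
  then obtain r where r: "\<And>y. y \<in> S' \<Longrightarrow> r y \<in> L \<inter> V" "\<And>y. y \<in> S' \<Longrightarrow> \<rho> (r y) = y" by metis
  define S where "S = r ` S'"
  have sub: "subring (L \<inter> V) E" using E.subring_inter[OF subfieldE(1)[OF L] subring_A] by simp
  interpret LV: subring_hom E E' "L \<inter> V" \<rho> by (rule subring_hom_subset[OF sub]) auto
  have SV: "S \<subseteq> L \<inter> V" using r(1) by (auto simp: S_def)
  have fin: "finite S" using S'(2) by (simp add: S_def)
  have \<rho>S: "\<rho> x \<in> S'" "r (\<rho> x) = x" if "x \<in> S" for x using that r(2) by (auto simp: S_def)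
  have inj: "inj_on \<rho> S" by (metis \<rho>S(2) inj_onI)
  have card: "card S = card S'"
    unfolding S_def using r(2) by (intro card_image) (metis inj_onI)
  have "alg_independent E K S"
    unfolding alg_independent_def
  proof (intro conjI ballI impI)
    show "S \<subseteq> carrier E" using SV by auto
    fix P assume P: "P \<in> E.indexed_pset S K" and ev: "mpoly_eval E (\<lambda>x. x) P = \<zero>\<^bsub>E\<^esub>"
    have sup: "supported E S K P" using P E.indexed_pset_iff[OF K(1)] by auto
    show "P = E.indexed_const \<zero>\<^bsub>E\<^esub>"
    proof (rule ccontr)
      assume "P \<noteq> E.indexed_const \<zero>\<^bsub>E\<^esub>"
      then obtain m0 where m0: "P m0 \<noteq> \<zero>\<^bsub>E\<^esub>" by (auto simp: E.indexed_const_def fun_eq_iff)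
      define W where "W = {m. P m \<noteq> \<zero>\<^bsub>E\<^esub>}"
      define z where "z = (\<lambda>m. finprod E (\<lambda>x. x [^]\<^bsub>E\<^esub> count m x) (set_mset m))"
      have W: "finite W" "\<And>m. m \<in> W \<Longrightarrow> set_mset m \<subseteq> S" "P \<in> W \<rightarrow> K"
        using sup by (auto simp: W_def supported_def)
      have pw: "(\<lambda>x. x [^]\<^bsub>E\<^esub> count m x) \<in> set_mset m \<rightarrow> L \<inter> V" if "m \<in> W" for m
        using LV.A_pow W(2)[OF that] SV by blast
      have zLV: "z \<in> W \<rightarrow> L \<inter> V"
        unfolding z_def using LV.finprod_A[OF pw] by auto
      have "(\<Oplus>\<^bsub>E\<^esub>m\<in>W. P m \<otimes>\<^bsub>E\<^esub> z m) = \<zero>\<^bsub>E\<^esub>"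
        using ev by (simp add: mpoly_eval_def W_def z_def)
      then obtain c' i where c': "c' \<in> W \<rightarrow> K'" "i \<in> W" "c' i \<noteq> \<zero>\<^bsub>E'\<^esub>"
        "(\<Oplus>\<^bsub>E'\<^esub>i\<in>W. c' i \<otimes>\<^bsub>E'\<^esub> \<rho> (z i)) = \<zero>\<^bsub>E'\<^esub>"
        using descent[OF W(1) zLV W(3), of m0] m0 by (auto simp: W_def)
      define f where "f = image_mset \<rho>"
      define h where "h = image_mset r"
      have hf: "h (f m) = m" if "m \<in> W" for m
      proof -
        have "image_mset (\<lambda>x. r (\<rho> x)) m = image_mset (\<lambda>x. x) m"
          using W(2)[OF that] \<rho>S(2) by (intro image_mset_cong) auto
        then show ?thesis by (simp add: f_def h_def multiset.map_comp comp_def)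
      qed
      have injf: "inj_on f W" by (metis hf inj_onI)
      \<comment> \<open>The descended relation, read as a polynomial in the elements of \<open>S'\<close>.\<close>
      define P' where "P' = (\<lambda>m'. if m' \<in> f ` W then c' (h m') else \<zero>\<^bsub>E'\<^esub>)"
      have P'f: "P' (f m) = c' m" if "m \<in> W" for m using that hf by (auto simp: P'_def)
      have sup': "supported E' S' K' P'"
        unfolding supported_def
      proof (intro conjI allI impI)
        have "{m. P' m \<noteq> \<zero>\<^bsub>E'\<^esub>} \<subseteq> f ` W" by (auto simp: P'_def)
        then show "finite {m. P' m \<noteq> \<zero>\<^bsub>E'\<^esub>}" using W(1) finite_subset by blast
        show "range P' \<subseteq> K'" using c'(1) hf subringE(2)[OF K'] by (auto simp: P'_def)
        fix m' assume "P' m' \<noteq> \<zero>\<^bsub>E'\<^esub>"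
        then obtain m where "m \<in> W" "m' = f m" by (auto simp: P'_def split: if_splits)
        then show "set_mset m' \<subseteq> S'" using W(2) \<rho>S(1) by (auto simp: f_def)
      qed
      define z' where "z' = (\<lambda>m'. finprod E' (\<lambda>x. x [^]\<^bsub>E'\<^esub> count m' x) (set_mset m'))"
      have z'f: "z' (f m) = \<rho> (z m)" if m: "m \<in> W" for m
      proof -
        have injm: "inj_on \<rho> (set_mset m)" using inj W(2)[OF m] by (rule inj_on_subset)
        have mV: "set_mset m \<subseteq> V" using W(2)[OF m] SV by auto
        have cnt: "count (f m) (\<rho> x) = count m x" if "x \<in># m" for x
        proof -
          have "\<rho> -` {\<rho> x} \<inter> set_mset m = {x}" using that injm by (auto simp: inj_on_def)
          then show ?thesis by (simp add: f_def count_image_mset)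
        qed
        have "z' (f m) = finprod E' (\<lambda>y. y [^]\<^bsub>E'\<^esub> count (f m) y) (\<rho> ` set_mset m)"
          by (simp add: z'_def f_def)
        also have "\<dots> = finprod E' (\<lambda>x. \<rho> x [^]\<^bsub>E'\<^esub> count (f m) (\<rho> x)) (set_mset m)"
          using mV hom_closed by (intro E'.finprod_reindex injm) auto
        also have "\<dots> = finprod E' (\<lambda>x. \<rho> (x [^]\<^bsub>E\<^esub> count m x)) (set_mset m)"
          using mV hom_closed A_pow by (intro E'.finprod_cong') (auto simp: cnt hom_pow subset_iff)
        also have "\<dots> = \<rho> (z m)"
          unfolding z_def using pw[OF m] by (intro hom_finprod[symmetric]) auto
        finally show ?thesis .
      qed
      have zc: "\<rho> (z m) \<in> carrier E'" if "m \<in> W" for m using zLV hom_closed that by auto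
      have K'c: "K' \<subseteq> carrier E'" using subringE(1)[OF K'] .
      have c'c: "c' m \<in> carrier E'" if "m \<in> W" for m using c'(1) that K'c by auto
      have "mpoly_eval E' (\<lambda>x. x) P' = (\<Oplus>\<^bsub>E'\<^esub>m\<in>{m. P' m \<noteq> \<zero>\<^bsub>E'\<^esub>}. P' m \<otimes>\<^bsub>E'\<^esub> z' m)"
        by (simp add: mpoly_eval_def z'_def)
      also have "\<dots> = (\<Oplus>\<^bsub>E'\<^esub>m\<in>f ` W. P' m \<otimes>\<^bsub>E'\<^esub> z' m)"
      proof (rule E'.finsum_mono_neutral_cong_left)
        show "{m. P' m \<noteq> \<zero>\<^bsub>E'\<^esub>} \<subseteq> f ` W" by (auto simp: P'_def)
      qed (use W(1) c'c zc in \<open>auto simp: z'f P'f\<close>)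
      also have "\<dots> = (\<Oplus>\<^bsub>E'\<^esub>m\<in>W. P' (f m) \<otimes>\<^bsub>E'\<^esub> z' (f m))"
        using injf c'c zc by (intro E'.finsum_reindex) (auto simp: z'f P'f)
      also have "\<dots> = (\<Oplus>\<^bsub>E'\<^esub>m\<in>W. c' m \<otimes>\<^bsub>E'\<^esub> \<rho> (z m))"
        using c'c zc by (intro E'.finsum_cong') (auto simp: z'f P'f)
      finally have "mpoly_eval E' (\<lambda>x. x) P' = \<zero>\<^bsub>E'\<^esub>" using c'(4) by simp
      then have "P' = E'.indexed_const \<zero>\<^bsub>E'\<^esub>"
        using S'(3) sup' E'.indexed_pset_iff[OF K'] unfolding alg_independent_def by blast
      then have "P' (f i) = \<zero>\<^bsub>E'\<^esub>" by (simp add: E'.indexed_const_def)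
      then show False using P'f c'(2,3) by auto
    qed
  qed
  then have "S \<in> {S. S \<subseteq> L \<and> finite S \<and> alg_independent E K S}" using SV fin by auto
  then show "enat (card S') \<le> (SUP S\<in>{S. S \<subseteq> L \<and> finite S \<and> alg_independent E K S}. enat (card S))"
    unfolding card[symmetric] by (intro SUP_upper)
qed

end

section \<open>Countably generated subfields and linear functionals\<close>

lemma (in field) countable_generate_field:
  assumes "countable C"
  shows "countable (generate_field R C)"
proof -
  define f where "f = (\<lambda>T. T \<union> a_inv R ` T \<union> m_inv R ` T \<union> (\<lambda>(x, y). x \<oplus> y) ` (T \<times> T) \<union> (\<lambda>(x, y). x \<otimes> y) ` (T \<times> T))"
  define S where "S = (\<lambda>n. (f ^^ n) (insert \<one> C))"
  have "countable (S n)" for n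
    by (induction n) (auto simp: S_def f_def assms intro!: countable_image)
  then have cnt: "countable (\<Union>n. S n)" by auto
  have S_Suc: "S (Suc n) = f (S n)" for n by (simp add: S_def)
  have inc: "S n \<subseteq> S (n + k)" for n k
    by (induction k) (auto simp: S_Suc f_def)
  have "generate_field R C \<subseteq> (\<Union>n. S n)"
  proof
    fix x assume "x \<in> generate_field R C"
    then show "x \<in> (\<Union>n. S n)"
    proof induction
      case one
      have "\<one> \<in> S 0" by (simp add: S_def)
      then show ?case by blast
    next
      case (incl h)
      then have "h \<in> S 0" by (simp add: S_def)
      then show ?case by blast
    next
      case (a_inv h)
      then obtain n where "h \<in> S n" by blast
      then have "\<ominus> h \<in> S (Suc n)" by (auto simp: S_Suc f_def)
      then show ?case by blast
    next
      case (m_inv h)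
      then obtain n where "h \<in> S n" by blast
      then have "inv h \<in> S (Suc n)" by (auto simp: S_Suc f_def)
      then show ?case by blast
    next
      case (eng_add h1 h2)
      then obtain n m where "h1 \<in> S n" "h2 \<in> S m" by blast
      then have "h1 \<in> S (n + m)" "h2 \<in> S (n + m)" using inc[of n m] inc[of m n] by (auto simp: add.commute)
      then have "h1 \<oplus> h2 \<in> S (Suc (n + m))" by (force simp: S_Suc f_def)
      then show ?case by blast
    next
      case (eng_mult h1 h2)
      then obtain n m where "h1 \<in> S n" "h2 \<in> S m" by blast
      then have "h1 \<in> S (n + m)" "h2 \<in> S (n + m)" using inc[of n m] inc[of m n] by (auto simp: add.commute)
      then have "h1 \<otimes> h2 \<in> S (Suc (n + m))" by (force simp: S_Suc f_def)
      then show ?case by blast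
    qed
  qed
  then show ?thesis using cnt countable_subset by blast
qed

text \<open>
  By Zorn's lemma there is an \<open>F\<close>-subspace \<open>U\<close> maximal among those that avoid \<open>c\<close>.  Adjoining any \<open>x \<notin> U\<close> brings in
  \<open>c\<close>, so \<open>x \<in> U + F c\<close>: the space is the direct sum of \<open>U\<close> and \<open>F c\<close>, and the functional reads off the
  coefficient of \<open>c\<close>.
\<close>

lemma (in field) linear_functional_exists:
  assumes F: "subfield F R" and c: "c \<in> carrier R" "c \<noteq> \<zero>"
  obtains \<pi> where "\<pi> \<in> carrier R \<rightarrow> F" "\<pi> c = \<one>"
    "\<And>x y. x \<in> carrier R \<Longrightarrow> y \<in> carrier R \<Longrightarrow> \<pi> (x \<oplus> y) = \<pi> x \<oplus> \<pi> y"
    "\<And>a x. a \<in> F \<Longrightarrow> x \<in> carrier R \<Longrightarrow> \<pi> (a \<otimes> x) = a \<otimes> \<pi> x"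
proof -
  note Fs = subringE[OF subfieldE(1)[OF F]]
  have Fc: "a \<in> F \<Longrightarrow> a \<in> carrier R" for a using Fs(1) by auto
  have Finv: "inv a \<in> F" if "a \<in> F" "a \<noteq> \<zero>" for a using subfield_m_inv(1)[OF F, of a] that by auto
  define \<U> where "\<U> = {U. U \<subseteq> carrier R \<and> \<zero> \<in> U \<and> (\<forall>x\<in>U. \<forall>y\<in>U. x \<oplus> y \<in> U) \<and> (\<forall>a\<in>F. \<forall>x\<in>U. a \<otimes> x \<in> U) \<and> c \<notin> U}"
  have "\<exists>M\<in>\<U>. \<forall>U\<in>\<U>. M \<subseteq> U \<longrightarrow> U = M"
  proof (rule subset_Zorn_nonempty)
    have "{\<zero>} \<in> \<U>" using c Fc by (auto simp: \<U>_def)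
    then show "\<U> \<noteq> {}" by blast
    fix \<C> assume ne: "\<C> \<noteq> {}" and ch: "subset.chain \<U> \<C>"
    have sub: "U \<in> \<U>" if "U \<in> \<C>" for U using ch that by (auto simp: subset.chain_def)
    have add: "x \<oplus> y \<in> \<Union>\<C>" if xy: "x \<in> \<Union>\<C>" "y \<in> \<Union>\<C>" for x y
    proof -
      obtain U U' where U: "U \<in> \<C>" "x \<in> U" "U' \<in> \<C>" "y \<in> U'" using xy by auto
      then have "U \<subseteq> U' \<or> U' \<subseteq> U" using ch by (auto simp: subset.chain_def)
      then obtain T where "T \<in> \<C>" "x \<in> T" "y \<in> T" using U by blast
      then show ?thesis using sub[of T] by (auto simp: \<U>_def)
    qed
    have sc: "a \<otimes> x \<in> \<Union>\<C>" if "a \<in> F" "x \<in> \<Union>\<C>" for a x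
      using that sub by (auto simp: \<U>_def)
    have "\<forall>U\<in>\<C>. U \<subseteq> carrier R \<and> \<zero> \<in> U \<and> c \<notin> U" using sub by (auto simp: \<U>_def)
    then have "\<Union>\<C> \<subseteq> carrier R" "\<zero> \<in> \<Union>\<C>" "c \<notin> \<Union>\<C>" using ne by blast+
    then show "\<Union>\<C> \<in> \<U>" using add sc by (simp add: \<U>_def)
  qed
  then obtain U where U: "U \<in> \<U>" and max: "\<And>U'. U' \<in> \<U> \<Longrightarrow> U \<subseteq> U' \<Longrightarrow> U' = U" by blast
  have Uc: "x \<in> U \<Longrightarrow> x \<in> carrier R" and Uz: "\<zero> \<in> U" and Ua: "x \<in> U \<Longrightarrow> y \<in> U \<Longrightarrow> x \<oplus> y \<in> U"
    and Us: "a \<in> F \<Longrightarrow> x \<in> U \<Longrightarrow> a \<otimes> x \<in> U" and cU: "c \<notin> U" for x y a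
    using U by (auto simp: \<U>_def)
  have ex: "\<exists>e u. e \<in> F \<and> u \<in> U \<and> x = u \<oplus> e \<otimes> c" if x: "x \<in> carrier R" for x
  proof (cases "x \<in> U")
    case True
    then have "x = x \<oplus> \<zero> \<otimes> c" using x c by simp
    then show ?thesis using Fs(2) True by blast
  next
    case False
    define U' where "U' = {u \<oplus> k \<otimes> x | u k. u \<in> U \<and> k \<in> F}"
    have "U \<subseteq> U'"
    proof
      fix u assume u: "u \<in> U"
      have "u = u \<oplus> \<zero> \<otimes> x" using x Uc[OF u] by simp
      then show "u \<in> U'" unfolding U'_def using u Fs(2) by blast
    qed
    moreover have "x \<in> U'"
    proof -
      have "x = \<zero> \<oplus> \<one> \<otimes> x" using x by simp
      then show ?thesis unfolding U'_def using Uz Fs(3) by blast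
    qed
    ultimately have "U' \<notin> \<U>" using max False by blast
    moreover have "U' \<subseteq> carrier R" using x Uc Fc by (auto simp: U'_def)
    moreover have "\<zero> \<in> U'" using \<open>U \<subseteq> U'\<close> Uz by auto
    moreover have "y \<oplus> z \<in> U'" if yz: "y \<in> U'" "z \<in> U'" for y z
    proof -
      obtain u k u' k' where "u \<in> U" "k \<in> F" "y = u \<oplus> k \<otimes> x" "u' \<in> U" "k' \<in> F" "z = u' \<oplus> k' \<otimes> x"
        using yz by (auto simp: U'_def)
      moreover from this have "y \<oplus> z = (u \<oplus> u') \<oplus> (k \<oplus> k') \<otimes> x"
        using x Uc Fc by (simp add: l_distr a_ac)
      ultimately show ?thesis unfolding U'_def using Ua Fs(7) by blast
    qed
    moreover have "a \<otimes> y \<in> U'" if yz: "a \<in> F" "y \<in> U'" for a y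
    proof -
      obtain u k where "u \<in> U" "k \<in> F" "y = u \<oplus> k \<otimes> x" using yz by (auto simp: U'_def)
      moreover from this have "a \<otimes> y = a \<otimes> u \<oplus> (a \<otimes> k) \<otimes> x"
        using x Uc Fc yz(1) by (simp add: r_distr m_assoc)
      ultimately show ?thesis unfolding U'_def using Us Fs(6) yz(1) by blast
    qed
    ultimately have "c \<in> U'" by (auto simp: \<U>_def)
    then obtain u k where uk: "u \<in> U" "k \<in> F" "c = u \<oplus> k \<otimes> x" by (auto simp: U'_def)
    have k0: "k \<noteq> \<zero>" using uk cU x Uc[OF uk(1)] by auto
    have cs: "u \<in> carrier R" "k \<in> carrier R" "inv k \<in> carrier R" using uk Uc Fc Finv k0 by auto
    have kk: "inv k \<otimes> k = \<one>" using k0 cs field_Units by auto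
    have "\<ominus> (inv k) \<otimes> u \<oplus> inv k \<otimes> c = \<ominus> (inv k \<otimes> u) \<oplus> (inv k \<otimes> u \<oplus> (inv k \<otimes> k) \<otimes> x)"
      using cs x unfolding uk(3) by (simp add: r_distr l_minus m_assoc)
    also have "\<dots> = x" using cs x kk by (simp add: r_neg1)
    finally have "x = \<ominus> (inv k) \<otimes> u \<oplus> inv k \<otimes> c" by simp
    moreover have "\<ominus> (inv k) \<otimes> u \<in> U" using Us uk Finv k0 Fs(5) by blast
    ultimately show ?thesis using Finv[OF uk(2) k0] by blast
  qed
  have uniq: "e = e'" if "e \<in> F" "e' \<in> F" "u \<in> U" "u' \<in> U" "u \<oplus> e \<otimes> c = u' \<oplus> e' \<otimes> c" for e e' u u'
  proof (rule ccontr)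
    assume ne: "e \<noteq> e'"
    have cs: "e \<in> carrier R" "e' \<in> carrier R" "u \<in> carrier R" "u' \<in> carrier R" using that Uc Fc by auto
    define d where "d = e \<ominus> e'"
    have d: "d \<in> F" "d \<noteq> \<zero>" "d \<in> carrier R"
    proof -
      show "d \<in> F" using that(1,2) Fs(5,7) by (simp add: d_def minus_eq)
      show "d \<in> carrier R" using cs by (simp add: d_def)
      show "d \<noteq> \<zero>" using cs ne by (simp add: d_def r_right_minus_eq)
    qed
    have "d \<otimes> c = u' \<oplus> \<ominus> u"
    proof -
      have "d \<otimes> c = (u \<oplus> e \<otimes> c) \<oplus> \<ominus> u \<oplus> \<ominus> (e' \<otimes> c)"
        using cs c by (simp add: d_def minus_eq l_distr l_minus a_ac r_neg r_neg1 r_neg2)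
      also have "\<dots> = (u' \<oplus> e' \<otimes> c) \<oplus> \<ominus> u \<oplus> \<ominus> (e' \<otimes> c)" by (simp only: that(5))
      also have "\<dots> = u' \<oplus> \<ominus> u"
        using cs c by (simp add: a_ac r_neg r_neg1 r_neg2)
      finally show ?thesis .
    qed
    moreover have "\<ominus> u \<in> U"
    proof -
      have "\<ominus> \<one> \<otimes> u \<in> U" using Us Fs(3,5) that(3) by blast
      then show ?thesis using cs by (simp add: l_minus)
    qed
    ultimately have "d \<otimes> c \<in> U" using Ua that(4) by auto
    then have "inv d \<otimes> (d \<otimes> c) \<in> U" using Us Finv d by auto
    moreover have "inv d \<otimes> (d \<otimes> c) = c"
      using d c field_Units by (simp add: m_assoc[symmetric])
    ultimately show False using cU by simp
  qed
  define \<pi> where "\<pi> = (\<lambda>x. THE e. e \<in> F \<and> (\<exists>u\<in>U. x = u \<oplus> e \<otimes> c))"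
  have lam: "\<pi> x = e" if "e \<in> F" "u \<in> U" "x = u \<oplus> e \<otimes> c" for x e u
    unfolding \<pi>_def by (rule the_equality) (use that uniq in blast)+
  show thesis
  proof
    show "\<pi> \<in> carrier R \<rightarrow> F" using ex lam by fastforce
    show "\<pi> c = \<one>" using c Uz Fs(3) by (intro lam[of \<one> \<zero>]) auto
    show "\<pi> (x \<oplus> y) = \<pi> x \<oplus> \<pi> y" if xy: "x \<in> carrier R" "y \<in> carrier R" for x y
    proof -
      obtain e u where x: "e \<in> F" "u \<in> U" "x = u \<oplus> e \<otimes> c" using ex[OF xy(1)] by auto
      obtain e' u' where y: "e' \<in> F" "u' \<in> U" "y = u' \<oplus> e' \<otimes> c" using ex[OF xy(2)] by auto
      have "x \<oplus> y = (u \<oplus> u') \<oplus> (e \<oplus> e') \<otimes> c"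
        using x y c Uc Fc by (simp add: l_distr a_ac)
      then show ?thesis using lam[OF x] lam[OF y] lam[of "e \<oplus> e'" "u \<oplus> u'"] x y Ua Fs(7) by auto
    qed
    show "\<pi> (a \<otimes> x) = a \<otimes> \<pi> x" if ax: "a \<in> F" "x \<in> carrier R" for a x
    proof -
      obtain e u where x: "e \<in> F" "u \<in> U" "x = u \<oplus> e \<otimes> c" using ex[OF ax(2)] by auto
      have "a \<otimes> x = a \<otimes> u \<oplus> (a \<otimes> e) \<otimes> c"
        using x c Uc Fc ax by (simp add: r_distr m_assoc)
      then show ?thesis using lam[OF x] lam[of "a \<otimes> e" "a \<otimes> u"] x Us Fs(6) ax by auto
    qed
  qed
qed

section \<open>Valuation rings as maximal subrings\<close>

text \<open>
  The values at \<open>x\<close> of the polynomials of degree at most \<open>n\<close> over \<open>A\<close>.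
\<close>

primrec bounded_span :: "('a, 'm) ring_scheme \<Rightarrow> 'a set \<Rightarrow> 'a \<Rightarrow> nat \<Rightarrow> 'a set" where
  "bounded_span R A x 0 = A"
| "bounded_span R A x (Suc n) = {u \<oplus>\<^bsub>R\<^esub> a \<otimes>\<^bsub>R\<^esub> x [^]\<^bsub>R\<^esub> Suc n | u a. u \<in> bounded_span R A x n \<and> a \<in> A}"

context cring begin

context
  fixes A x assumes A: "subring A R" and x: "x \<in> carrier R"
begin

lemma span_carrier: "u \<in> bounded_span R A x n \<Longrightarrow> u \<in> carrier R"
  using subringE(1)[OF A] x by (induction n arbitrary: u) auto

lemma span_add: "u \<in> bounded_span R A x n \<Longrightarrow> v \<in> bounded_span R A x n \<Longrightarrow> u \<oplus> v \<in> bounded_span R A x n"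
proof (induction n arbitrary: u v)
  case 0 then show ?case using subringE(7)[OF A] by simp
next
  case (Suc n)
  obtain u' a v' b where r: "u' \<in> bounded_span R A x n" "a \<in> A" "u = u' \<oplus> a \<otimes> x [^] Suc n"
    "v' \<in> bounded_span R A x n" "b \<in> A" "v = v' \<oplus> b \<otimes> x [^] Suc n" using Suc.prems by auto
  have "u \<oplus> v = (u' \<oplus> v') \<oplus> (a \<oplus> b) \<otimes> x [^] Suc n"
    using r span_carrier[of u' n] span_carrier[of v' n] subringE(1)[OF A] x
    by (simp add: subset_iff l_distr a_ac del: nat_pow_Suc)
  then show ?case using Suc.IH[OF r(1,4)] subringE(7)[OF A r(2,5)] unfolding bounded_span.simps by blast
qed

lemma span_scale: "b \<in> A \<Longrightarrow> u \<in> bounded_span R A x n \<Longrightarrow> b \<otimes> u \<in> bounded_span R A x n"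
proof (induction n arbitrary: u)
  case 0 then show ?case using subringE(6)[OF A] by simp
next
  case (Suc n)
  obtain u' a where r: "u' \<in> bounded_span R A x n" "a \<in> A" "u = u' \<oplus> a \<otimes> x [^] Suc n" using Suc.prems by auto
  have "b \<otimes> u = b \<otimes> u' \<oplus> (b \<otimes> a) \<otimes> x [^] Suc n"
    using r span_carrier[of u' n] subringE(1)[OF A] x Suc.prems(1)
    by (simp add: subset_iff r_distr m_assoc del: nat_pow_Suc)
  then show ?case using Suc.IH[OF Suc.prems(1) r(1)] subringE(6)[OF A Suc.prems(1) r(2)]
    unfolding bounded_span.simps by blast
qed

lemma span_Suc: "u \<in> bounded_span R A x n \<Longrightarrow> u \<in> bounded_span R A x (Suc n)"
proof -
  assume u: "u \<in> bounded_span R A x n"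
  have "u = u \<oplus> \<zero> \<otimes> x [^] Suc n" using span_carrier[OF u] x by (simp del: nat_pow_Suc)
  then show ?thesis using u subringE(2)[OF A] unfolding bounded_span.simps by blast
qed

lemma span_mono: "u \<in> bounded_span R A x n \<Longrightarrow> n \<le> m \<Longrightarrow> u \<in> bounded_span R A x m"
  by (induction m rule: nat_induct) (auto simp: le_Suc_eq span_Suc simp del: bounded_span.simps(2))

lemma span_monomial: "a \<in> A \<Longrightarrow> a \<otimes> x [^] n \<in> bounded_span R A x n"
proof (cases n)
  case 0 then show "a \<in> A \<Longrightarrow> ?thesis" using subringE(1)[OF A] by auto
next
  case (Suc k)
  assume a: "a \<in> A"
  have "\<zero> \<in> bounded_span R A x k" using span_mono[of \<zero> 0 k] subringE(2)[OF A] by simp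
  moreover have "a \<otimes> x [^] n = \<zero> \<oplus> a \<otimes> x [^] Suc k"
    using Suc a x subringE(1)[OF A] by (auto simp del: nat_pow_Suc)
  ultimately show ?thesis using a unfolding Suc bounded_span.simps by blast
qed

lemma span_times: "u \<in> bounded_span R A x n \<Longrightarrow> u \<otimes> x \<in> bounded_span R A x (Suc n)"
proof (induction n arbitrary: u)
  case 0
  then have "u \<otimes> x [^] (1::nat) \<in> bounded_span R A x 1" by (intro span_monomial) simp
  then show ?case using x by simp
next
  case (Suc n)
  obtain u' a where r: "u' \<in> bounded_span R A x n" "a \<in> A" "u = u' \<oplus> a \<otimes> x [^] Suc n" using Suc.prems by auto
  have "u \<otimes> x = u' \<otimes> x \<oplus> a \<otimes> x [^] Suc (Suc n)"
    using r span_carrier[of u' n] subringE(1)[OF A] x by (auto simp: l_distr m_assoc)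
  then show ?case using Suc.IH[OF r(1)] r(2) unfolding bounded_span.simps(2)[of R A x "Suc n"] by blast
qed

lemma simple_extension_span: "y \<in> simple_extension A x \<Longrightarrow> \<exists>n. y \<in> bounded_span R A x n"
proof (induction rule: simple_extension.induct)
  case zero
  show ?case using subringE(2)[OF A] by (intro exI[of _ 0]) simp
next
  case (lin k1 k2)
  then obtain n where "k1 \<in> bounded_span R A x n" by auto
  then have "k1 \<otimes> x \<oplus> k2 \<in> bounded_span R A x (Suc n)"
    using span_times span_mono[of k2 0 "Suc n"] lin by (intro span_add) (auto simp del: bounded_span.simps(2))
  then show ?case by blast
qed

end

end

context field begin

text \<open>
  Multiplying a polynomial of degree at most \<open>n + 1\<close> in \<open>1/x\<close> by \<open>x ^ (n + 1)\<close> leaves a polynomial in \<open>x\<close> whose leading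
  coefficient is the former constant term \<open>b\<close>.
\<close>

lemma span_clear_denominators:
  assumes A: "subring A R" and x: "x \<in> carrier R" "x \<noteq> \<zero>"
  shows "y \<in> bounded_span R A (inv x) m \<Longrightarrow> m \<le> Suc n \<Longrightarrow>
    \<exists>b\<in>A. \<exists>v\<in>bounded_span R A x n. x [^] Suc n \<otimes> y = b \<otimes> x [^] Suc n \<oplus> v"
proof (induction m arbitrary: y)
  case 0
  have "x [^] Suc n \<otimes> y = y \<otimes> x [^] Suc n \<oplus> \<zero>"
    using 0 x subringE(1)[OF A] by (auto simp: m_comm simp del: nat_pow_Suc)
  moreover have "\<zero> \<in> bounded_span R A x n"
    using span_mono[OF A x(1), of \<zero> 0 n] subringE(2)[OF A] by simp
  ultimately show ?case using 0 by auto
next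
  case (Suc m)
  obtain u a where r: "u \<in> bounded_span R A (inv x) m" "a \<in> A" "y = u \<oplus> a \<otimes> (inv x) [^] Suc m"
    using Suc.prems by auto
  obtain b v where bv: "b \<in> A" "v \<in> bounded_span R A x n" "x [^] Suc n \<otimes> u = b \<otimes> x [^] Suc n \<oplus> v"
    using Suc.IH[OF r(1)] Suc.prems(2) by auto
  have ix: "inv x \<in> carrier R" "x \<otimes> inv x = \<one>" using x field_Units by auto
  have "x [^] Suc n = x [^] (n - m) \<otimes> x [^] Suc m"
    using Suc.prems(2) nat_pow_mult[OF x(1), of "n - m" "Suc m"] by (simp del: nat_pow_Suc)
  then have "x [^] Suc n \<otimes> (inv x) [^] Suc m = x [^] (n - m) \<otimes> (x \<otimes> inv x) [^] Suc m"
    using x ix(1) by (simp only: nat_pow_distrib m_assoc nat_pow_closed)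
  also have "\<dots> = x [^] (n - m)" using ix x by (simp del: nat_pow_Suc)
  finally have pw: "x [^] Suc n \<otimes> (inv x) [^] Suc m = x [^] (n - m)" .
  have cs: "u \<in> carrier R" "a \<in> carrier R" "b \<in> carrier R" "v \<in> carrier R"
    using span_carrier[OF A ix(1) r(1)] span_carrier[OF A x(1) bv(2)] r(2) bv(1) subringE(1)[OF A] by auto
  have "x [^] Suc n \<otimes> y = x [^] Suc n \<otimes> u \<oplus> a \<otimes> (x [^] Suc n \<otimes> (inv x) [^] Suc m)"
    unfolding r(3) using cs x(1) ix(1) by (simp add: r_distr m_lcomm del: nat_pow_Suc)
  also have "\<dots> = b \<otimes> x [^] Suc n \<oplus> (v \<oplus> a \<otimes> x [^] (n - m))"
    unfolding pw bv(3) using cs x(1) by (simp add: a_assoc del: nat_pow_Suc)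
  finally have "x [^] Suc n \<otimes> y = b \<otimes> x [^] Suc n \<oplus> (v \<oplus> a \<otimes> x [^] (n - m))" .
  moreover have "v \<oplus> a \<otimes> x [^] (n - m) \<in> bounded_span R A x n"
    using bv(2) span_mono[OF A x(1) span_monomial[OF A x(1) r(2)], of "n - m" n] by (intro span_add[OF A x(1)]) auto
  ultimately show ?case using bv(1) by blast
qed

lemma span_of_inverse:
  assumes A: "subring A R" and t: "t \<in> A" "t \<noteq> \<zero>"
  shows "y \<in> bounded_span R A (inv t) k \<Longrightarrow> t [^] k \<otimes> y \<in> A"
proof (induction k arbitrary: y)
  case 0 then show ?case using subringE(1)[OF A] by auto
next
  case (Suc k)
  have tc: "t \<in> carrier R" "inv t \<in> carrier R" "t \<otimes> inv t = \<one>" using t subringE(1)[OF A] field_Units by auto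
  obtain u a where r: "u \<in> bounded_span R A (inv t) k" "a \<in> A" "y = u \<oplus> a \<otimes> (inv t) [^] Suc k"
    using Suc.prems by auto
  have cs: "u \<in> carrier R" "a \<in> carrier R" using span_carrier[OF A tc(2) r(1)] r(2) subringE(1)[OF A] by auto
  have pw: "t [^] Suc k \<otimes> (inv t) [^] Suc k = \<one>"
    using tc by (metis nat_pow_distrib nat_pow_one)
  have "t [^] Suc k \<otimes> y = t [^] Suc k \<otimes> u \<oplus> a \<otimes> (t [^] Suc k \<otimes> (inv t) [^] Suc k)"
    unfolding r(3) using cs tc by (simp add: r_distr m_lcomm del: nat_pow_Suc)
  also have "\<dots> = t \<otimes> (t [^] k \<otimes> u) \<oplus> a" unfolding pw using cs tc by (simp add: m_ac)
  finally show ?case using Suc.IH[OF r(1)] r(2) t(1) subringE(6,7)[OF A] by auto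
qed

text \<open>
  Suppose that neither \<open>x\<close> nor \<open>1/x\<close> lies in \<open>A\<close>.  By maximality \<open>w\<close> is a polynomial in \<open>x\<close>, of least degree \<open>n\<close>, and a
  polynomial in \<open>1/x\<close>, of least degree \<open>m\<close>; say \<open>m \<le> n\<close>.  Clearing denominators in the second one gives
  \<open>x ^ n w = b x ^ n + v\<close> with \<open>v\<close> of degree less than \<open>n\<close>, so that \<open>(1 - p b) x ^ n = p v\<close> for \<open>p = 1/w\<close>.  Since
  \<open>1 - p b\<close> is a unit of \<open>A\<close>, the power \<open>x ^ n\<close> can be eliminated from the first polynomial, against the choice of \<open>n\<close>.
\<close>

lemma maximal_subring_is_valuation_ring:
  assumes F: "subfield F R" and A: "subring A R" "A \<subseteq> F" and w: "w \<in> F" "w \<noteq> \<zero>" "w \<notin> A" "inv w \<in> A"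
    and max: "\<And>B. subring B R \<Longrightarrow> A \<subseteq> B \<Longrightarrow> B \<subseteq> F \<Longrightarrow> w \<notin> B \<Longrightarrow> B = A"
    and x: "x \<in> F" "x \<noteq> \<zero>"
  shows "x \<in> A \<or> inv x \<in> A"
proof (rule ccontr)
  note Fs = subringE[OF subfieldE(1)[OF F]] and As = subringE[OF A(1)]
  define p where "p = inv w"
  have wc: "w \<in> carrier R" "p \<in> carrier R" "p \<in> A" "p \<otimes> w = \<one>"
    using w Fs(1) As(1) field_Units by (auto simp: p_def)
  have adj: "\<exists>n. w \<in> bounded_span R A y n" if y: "y \<in> F" "y \<notin> A" for y
  proof -
    have yc: "y \<in> carrier R" using y Fs(1) by auto
    let ?B = "simple_extension A y"
    have "subring ?B R" using simple_extension_is_subring[OF A(1) yc] .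
    moreover have "A \<subseteq> ?B" using simple_extension_incl[OF As(1) yc] .
    moreover have "?B \<subseteq> F" using simple_extension_subring_incl[OF subfieldE(1)[OF F] A(2) y(1)] .
    moreover have "y \<in> ?B" using simple_extension_mem[OF A(1) yc] .
    ultimately have "w \<in> ?B" using max[of ?B] y(2) by auto
    then show ?thesis using simple_extension_span[OF A(1) yc] by blast
  qed
  \<comment> \<open>Otherwise maximality makes \<open>w\<close> a polynomial in \<open>1/t\<close>, so \<open>t ^ k w \<in> A\<close> for some \<open>k\<close>; but
    \<open>t ^ k\<close> has the form \<open>1 - p c\<close>, hence \<open>t ^ k w = w - c\<close> and \<open>w \<in> A\<close>.\<close>
  have unit: "inv t \<in> A \<and> t \<noteq> \<zero>" if t: "b \<in> A" "t = \<one> \<ominus> p \<otimes> b" for t b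
  proof -
    have bc: "b \<in> carrier R" using t As(1) by auto
    have tA: "t \<in> A" using t wc As(3,5,6,7) by (auto simp: minus_eq)
    have tc: "t \<in> carrier R" using tA As(1) by auto
    have t0: "t \<noteq> \<zero>"
    proof
      assume "t = \<zero>"
      then have "p \<otimes> b = \<one>" using t wc bc by (metis m_closed one_closed r_right_minus_eq)
      then have "w \<otimes> (p \<otimes> b) = w" using wc by simp
      then have "b = w" using wc bc by (simp add: m_assoc[symmetric] m_comm[of w p])
      then show False using t(1) w(3) by simp
    qed
    have "inv t \<in> A"
    proof (rule ccontr)
      assume "inv t \<notin> A"
      moreover have "inv t \<in> F" using subfield_m_inv(1)[OF F, of t] tA A(2) t0 by auto
      ultimately obtain k where k: "w \<in> bounded_span R A (inv t) k" using adj by blast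
      have "\<exists>c\<in>A. t [^] k = \<one> \<ominus> p \<otimes> c" for k :: nat
      proof (induction k)
        case 0
        then show ?case using As(2) wc by (intro bexI[of _ \<zero>]) (auto simp: minus_eq)
      next
        case (Suc k)
        then obtain c where c: "c \<in> A" "t [^] k = \<one> \<ominus> p \<otimes> c" by auto
        have cc: "c \<in> carrier R" using c As(1) by auto
        have "t [^] Suc k = (\<one> \<ominus> p \<otimes> c) \<otimes> t" by (simp add: c(2))
        also have "\<dots> = (\<one> \<ominus> p \<otimes> c) \<otimes> (\<one> \<ominus> p \<otimes> b)" by (simp only: t(2))
        also have "\<dots> = \<one> \<ominus> p \<otimes> (c \<oplus> b \<ominus> p \<otimes> c \<otimes> b)"
          using cc bc wc(1,2)
          by (simp add: minus_eq l_distr r_distr l_minus r_minus minus_add a_ac m_ac)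
        finally have "t [^] Suc k = \<one> \<ominus> p \<otimes> (c \<oplus> b \<ominus> p \<otimes> c \<otimes> b)" .
        moreover have "c \<oplus> b \<ominus> p \<otimes> c \<otimes> b \<in> A" using c t wc As(5,6,7) by (simp add: minus_eq)
        ultimately show ?case by blast
      qed
      then obtain c where c: "c \<in> A" "t [^] k = \<one> \<ominus> p \<otimes> c" by blast
      have cc: "c \<in> carrier R" using c As(1) by auto
      have "t [^] k \<otimes> w \<in> A" using span_of_inverse[OF A(1) tA t0 k] .
      moreover have "t [^] k \<otimes> w = w \<ominus> c"
      proof -
        have "t [^] k \<otimes> w = w \<ominus> (p \<otimes> w) \<otimes> c"
          unfolding c(2) using cc wc(1,2) by (simp add: minus_eq l_distr r_distr l_minus r_minus m_ac)
        then show ?thesis using wc cc by simp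
      qed
      ultimately have "(w \<ominus> c) \<oplus> c \<in> A" using c(1) As(7) by auto
      then show False using w(3) wc(1) cc by (simp add: minus_eq a_assoc l_neg)
    qed
    then show ?thesis using t0 by simp
  qed
  have descend: False if y: "y \<in> F" "y \<noteq> \<zero>" "w \<in> bounded_span R A y n" "\<And>n'. n' < n \<Longrightarrow> w \<notin> bounded_span R A y n'"
    "w \<in> bounded_span R A (inv y) m" "m \<le> n" for y n m
  proof (cases n)
    case 0
    then show ?thesis using y(3) w(3) by simp
  next
    case (Suc n')
    have yc: "y \<in> carrier R" using y Fs(1) by auto
    obtain u a where ua: "u \<in> bounded_span R A y n'" "a \<in> A" "w = u \<oplus> a \<otimes> y [^] Suc n'"
      using y(3) Suc by auto
    obtain b v where bv: "b \<in> A" "v \<in> bounded_span R A y n'" "y [^] Suc n' \<otimes> w = b \<otimes> y [^] Suc n' \<oplus> v"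
      using span_clear_denominators[OF A(1) yc y(2,5), of n'] y(6) Suc by auto
    define q where "q = y [^] Suc n'"
    define t where "t = \<one> \<ominus> p \<otimes> b"
    have cs: "b \<in> carrier R" "v \<in> carrier R" "q \<in> carrier R"
      using bv As(1) span_carrier[OF A(1) yc bv(2)] yc by (auto simp: q_def)
    have t: "inv t \<in> A" "t \<noteq> \<zero>" using unit[OF bv(1) t_def] by auto
    have tc: "t \<in> carrier R" using cs wc by (simp add: t_def)
    have "p \<otimes> (q \<otimes> w) = q \<otimes> (p \<otimes> w)" using cs wc(1,2) by (simp add: m_lcomm)
    then have "q = p \<otimes> (q \<otimes> w)" using cs wc(4) by simp
    also have "\<dots> = p \<otimes> (b \<otimes> q \<oplus> v)" using bv(3) by (simp add: q_def)
    finally have q: "q = p \<otimes> (b \<otimes> q \<oplus> v)" .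
    have "t \<otimes> q = q \<ominus> p \<otimes> (b \<otimes> q)"
      using cs wc by (simp add: t_def minus_eq l_distr l_minus m_assoc)
    also have "\<dots> = p \<otimes> (b \<otimes> q \<oplus> v) \<ominus> p \<otimes> (b \<otimes> q)" by (simp only: q[symmetric])
    also have "\<dots> = p \<otimes> v" using cs wc by (simp add: minus_eq r_distr a_ac r_neg r_neg1 r_neg2)
    finally have "inv t \<otimes> (t \<otimes> q) = inv t \<otimes> (p \<otimes> v)" by simp
    then have "q = inv t \<otimes> (p \<otimes> v)"
      using t tc cs field_Units by (simp add: m_assoc[symmetric])
    then have "q \<in> bounded_span R A y n'"
      using span_scale[OF A(1) yc] t(1) wc(3) bv(2) by auto
    then have "w \<in> bounded_span R A y n'"
      using ua span_scale[OF A(1) yc ua(2)] span_add[OF A(1) yc ua(1)] by (auto simp: q_def)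
    then show False using y(4) Suc by auto
  qed
  assume "\<not> (x \<in> A \<or> inv x \<in> A)"
  then have nx: "x \<notin> A" "inv x \<notin> A" by auto
  have xc: "x \<in> carrier R" using x Fs(1) by auto
  have ix: "inv x \<in> F" "inv x \<noteq> \<zero>" "inv (inv x) = x"
    using subfield_m_inv[OF F, of x] x xc field_Units Units_inv_inv nonzero_imp_inverse_nonzero by auto
  define n where "n = (LEAST n. w \<in> bounded_span R A x n)"
  define m where "m = (LEAST n. w \<in> bounded_span R A (inv x) n)"
  have n: "w \<in> bounded_span R A x n" "\<And>n'. n' < n \<Longrightarrow> w \<notin> bounded_span R A x n'"
    unfolding n_def using adj[OF x(1) nx(1)] by (auto intro: LeastI_ex dest: not_less_Least)
  have m: "w \<in> bounded_span R A (inv x) m" "\<And>n'. n' < m \<Longrightarrow> w \<notin> bounded_span R A (inv x) n'"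
    unfolding m_def using adj[OF ix(1) nx(2)] by (auto intro: LeastI_ex dest: not_less_Least)
  show False
  proof (cases "m \<le> n")
    case True
    then show False using descend[OF x n m(1)] by simp
  next
    case False
    then show False using descend[OF ix(1,2) m, of n] n(1) ix(3) by simp
  qed
qed

end

text \<open>
  A subring of \<open>F\<close> that is maximal among those without \<open>1/p\<close>.  Such subrings exist because the image of
  the integers is one: an integer \<open>k\<close> with \<open>p k = 1\<close> in characteristic \<open>0\<close> would make \<open>p\<close> a unit.
\<close>

lemma (in field) valuation_ring_exists:
  fixes p :: nat
  assumes char0: "ring_char R = 0" and p: "Factorial_Ring.prime p" and F: "subfield F R"
  obtains A where "subring A R" "A \<subseteq> F" "add_pow R p \<one> \<in> A" "add_pow R p \<one> \<noteq> \<zero>" "inv (add_pow R p \<one>) \<notin> A"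
    "\<And>x. x \<in> F \<Longrightarrow> x \<noteq> \<zero> \<Longrightarrow> x \<in> A \<or> inv x \<in> A"
proof -
  note Fs = subringE[OF subfieldE(1)[OF F]]
  have zero_iff: "add_pow R k \<one> = \<zero> \<longleftrightarrow> k = 0" for k :: int
    using group.int_pow_eq_id[OF a_group, of \<one> k] char0 by (simp add: ring_char_def add_pow_def)
  define u where "u = add_pow R (int p) \<one>"
  have up: "add_pow R p \<one> = u" by (simp add: u_def add_pow_int_ge)
  have u: "u \<in> carrier R" "u \<noteq> \<zero>" using zero_iff[of "int p"] p by (auto simp: u_def)
  define w where "w = inv u"
  have w: "w \<in> carrier R" "u \<otimes> w = \<one>" "w \<noteq> \<zero>" "inv w = u"
    using u field_Units Units_inv_inv nonzero_imp_inverse_nonzero by (auto simp: w_def)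
  define A0 where "A0 = range (\<lambda>k::int. add_pow R k \<one>)"
  have mult_int: "add_pow R i \<one> \<otimes> add_pow R j \<one> = add_pow R (i * j) \<one>" for i j :: int
    by (simp add: add_pow_ldistr_int add.int_pow_pow mult.commute)
  have A0: "subring A0 R"
  proof (rule subringI)
    show "A0 \<subseteq> carrier R" by (auto simp: A0_def)
    have "\<one> = add_pow R (1::int) \<one>" by simp
    then show "\<one> \<in> A0" unfolding A0_def by blast
    fix x y assume "x \<in> A0" "y \<in> A0"
    then obtain i j :: int where ij: "x = add_pow R i \<one>" "y = add_pow R j \<one>" by (auto simp: A0_def)
    show "\<ominus> x \<in> A0" using ij add.int_pow_neg[of \<one> i] by (metis A0_def one_closed rangeI)
    show "x \<oplus> y \<in> A0" using ij add.int_pow_mult[of \<one> i j] by (metis A0_def one_closed rangeI)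
    show "x \<otimes> y \<in> A0" using ij mult_int by (metis A0_def rangeI)
  qed
  have A0F: "A0 \<subseteq> F"
  proof -
    have nat: "add_pow R n \<one> \<in> F" for n :: nat
      by (induction n) (use Fs(2,3,7) in auto)
    have "add_pow R k \<one> \<in> F" for k :: int
      using nat Fs(5) by (cases "k \<ge> 0") (auto simp: add_pow_int_ge add_pow_int_lt)
    then show ?thesis by (auto simp: A0_def)
  qed
  have wA0: "w \<notin> A0"
  proof
    assume "w \<in> A0"
    then obtain k :: int where k: "w = add_pow R k \<one>" by (auto simp: A0_def)
    then have "add_pow R (int p * k) \<one> = \<one>" using w(2) mult_int by (simp add: u_def)
    moreover have "add_pow R (int p * k - 1) \<one> = add_pow R (int p * k) \<one> \<ominus> \<one>"
      using add.int_pow_mult[of \<one> "int p * k" "-1"] add.int_pow_neg[of \<one> 1] by (simp add: minus_eq)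
    ultimately have "add_pow R (int p * k - 1) \<one> = \<zero>" by (simp add: r_right_minus_eq)
    then have "int p * k = 1" using zero_iff by simp
    then have "int p dvd 1" by (metis dvd_triv_left)
    then show False using p not_prime_unit by (simp add: prime_nat_iff)
  qed
  have wF: "w \<in> F" "u \<in> A0"
    using A0F subfield_m_inv(1)[OF F, of u] u by (auto simp: A0_def u_def w_def)
  define \<U> where "\<U> = {A. subring A R \<and> A \<subseteq> F \<and> u \<in> A \<and> w \<notin> A}"
  have "\<exists>M\<in>\<U>. \<forall>U\<in>\<U>. M \<subseteq> U \<longrightarrow> U = M"
  proof (rule subset_Zorn_nonempty)
    show "\<U> \<noteq> {}" using A0 A0F wA0 wF by (auto simp: \<U>_def)
    fix \<C> assume ne: "\<C> \<noteq> {}" and ch: "subset.chain \<U> \<C>"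
    have sub: "subring U R" "U \<subseteq> F" "u \<in> U" "w \<notin> U" if "U \<in> \<C>" for U
      using ch that by (auto simp: subset.chain_def \<U>_def)
    have common: "\<exists>T\<in>\<C>. x \<in> T \<and> y \<in> T" if xy: "x \<in> \<Union>\<C>" "y \<in> \<Union>\<C>" for x y
    proof -
      obtain U U' where U: "U \<in> \<C>" "x \<in> U" "U' \<in> \<C>" "y \<in> U'" using xy by auto
      then have "U \<subseteq> U' \<or> U' \<subseteq> U" using ch by (auto simp: subset.chain_def)
      then show ?thesis using U by blast
    qed
    have "subring (\<Union>\<C>) R"
    proof (rule subringI)
      show "\<Union>\<C> \<subseteq> carrier R" using subringE(1)[OF sub(1)] by (rule Union_least)
      obtain U where "U \<in> \<C>" using ne by blast
      then show "\<one> \<in> \<Union>\<C>" using subringE(3)[OF sub(1)] by blast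
      fix x assume x: "x \<in> \<Union>\<C>"
      then obtain U where "U \<in> \<C>" "x \<in> U" by blast
      then show "\<ominus> x \<in> \<Union>\<C>" using subringE(5)[OF sub(1)] by blast
      fix y assume "y \<in> \<Union>\<C>"
      then obtain T where T: "T \<in> \<C>" "x \<in> T" "y \<in> T" using common[OF x] by blast
      show "x \<otimes> y \<in> \<Union>\<C>" "x \<oplus> y \<in> \<Union>\<C>"
        using T subringE(6,7)[OF sub(1)[OF T(1)] T(2,3)] by auto
    qed
    then show "\<Union>\<C> \<in> \<U>" using sub(2,3,4) ne by (auto simp: \<U>_def)
  qed
  then obtain A where A: "A \<in> \<U>" and max: "\<And>B. B \<in> \<U> \<Longrightarrow> A \<subseteq> B \<Longrightarrow> B = A" by blast
  then have A': "subring A R" "A \<subseteq> F" "u \<in> A" "w \<notin> A" by (auto simp: \<U>_def)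
  have "x \<in> A \<or> inv x \<in> A" if "x \<in> F" "x \<noteq> \<zero>" for x
  proof (rule maximal_subring_is_valuation_ring[OF F A'(1,2) wF(1) w(3) A'(4) _ _ that])
    show "inv w \<in> A" using w(4) A'(3) by simp
    show "B = A" if "subring B R" "A \<subseteq> B" "B \<subseteq> F" "w \<notin> B" for B
      using max[of B] that A'(3) by (auto simp: \<U>_def)
  qed
  then show thesis using that[of A] A' u up by (auto simp: w_def)
qed

text \<open>
  The residue classes of \<open>A\<close> are countable in number, hence they can be named by elements of any infinite type, and
  transporting the ring structure along the naming \<open>f\<close> realises the residue field there.
\<close>

lemma (in field) residue_field_exists:
  fixes p :: nat
  assumes char0: "ring_char R = 0" and p: "Factorial_Ring.prime p"
    and F: "subfield F R" "countable F" and inf: "infinite (UNIV :: 'k set)"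
  obtains k :: "'k ring" and A \<psi> where "field k" "ring_char k = p" "A \<subseteq> F" "subring_hom R k A \<psi>" "\<psi> ` A = carrier k"
    "\<And>x. x \<in> F \<Longrightarrow> x \<noteq> \<zero> \<Longrightarrow> x \<in> A \<or> inv x \<in> A"
proof -
  obtain A where A: "subring A R" "A \<subseteq> F" "add_pow R p \<one> \<in> A" "add_pow R p \<one> \<noteq> \<zero>" "inv (add_pow R p \<one>) \<notin> A"
    and val: "\<And>x. x \<in> F \<Longrightarrow> x \<noteq> \<zero> \<Longrightarrow> x \<in> A \<or> inv x \<in> A"
    using valuation_ring_exists[OF char0 p F(1)] by metis
  note As = subringE[OF A(1)]
  have Ac: "a \<in> A \<Longrightarrow> a \<in> carrier R" for a using As(1) by auto
  have iF: "inv a \<in> F" if "a \<in> F" "a \<noteq> \<zero>" for a using subfield_m_inv(1)[OF F(1), of a] that by auto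
  have ic: "inv a \<in> carrier R" "inv a \<otimes> a = \<one>" "a \<otimes> inv a = \<one>" if "a \<in> A" "a \<noteq> \<zero>" for a
    using that Ac field_Units by auto
  let ?A = "R\<lparr>carrier := A\<rparr>"
  have Adom: "domain ?A" using subring_is_domain[OF A(1)] .
  interpret A: "domain" ?A by (rule Adom)
  have Ainv: "\<ominus>\<^bsub>?A\<^esub> a = \<ominus> a" if "a \<in> A" for a
    using that As(5) Ac by (intro A.minus_equality) (auto simp: l_neg)
  have Aminus: "a \<ominus>\<^bsub>?A\<^esub> b = a \<ominus> b" if "a \<in> A" "b \<in> A" for a b
    using Ainv[OF that(2)] by (simp add: a_minus_def)
  define M where "M = {a \<in> A. a = \<zero> \<or> inv a \<notin> A}"
  have MA: "M \<subseteq> A" by (auto simp: M_def)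
  have M_mult: "x \<otimes> a \<in> M" if "a \<in> M" "x \<in> A" for a x
  proof (cases "x \<otimes> a = \<zero>")
    case True then show ?thesis using As(2) by (simp add: M_def)
  next
    case False
    have a: "a \<in> A" "a \<in> carrier R" "x \<in> carrier R" using that MA Ac by auto
    then have nz: "a \<noteq> \<zero>" "x \<noteq> \<zero>" using False by auto
    have "inv (x \<otimes> a) \<notin> A"
    proof
      assume "inv (x \<otimes> a) \<in> A"
      then have "x \<otimes> inv (x \<otimes> a) \<in> A" using As(6) that(2) by auto
      moreover have "inv a = x \<otimes> inv (x \<otimes> a)"
      proof (rule comm_inv_char)
        have "(x \<otimes> a) \<otimes> inv (x \<otimes> a) = \<one>" using ic[of "x \<otimes> a"] False As(6) a that(2) by auto
        then show "a \<otimes> (x \<otimes> inv (x \<otimes> a)) = \<one>"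
          using a \<open>inv (x \<otimes> a) \<in> A\<close> Ac by (simp add: m_ac)
        show "x \<otimes> inv (x \<otimes> a) \<in> carrier R" using a Ac \<open>inv (x \<otimes> a) \<in> A\<close> by auto
      qed (use a in auto)
      ultimately show False using that(1) nz by (auto simp: M_def)
    qed
    then show ?thesis using a that(2) As(6) by (auto simp: M_def)
  qed
  have M_add: "a \<oplus> b \<in> M" if ab: "a \<in> M" "b \<in> M" for a b
  proof -
    have aux: "a \<oplus> b \<in> M" if ab: "a \<in> M" "b \<in> M" and "b \<noteq> \<zero>" "a \<otimes> inv b \<in> A" for a b
    proof -
      have c: "a \<in> carrier R" "b \<in> carrier R" "b \<in> A" using ab MA Ac by auto
      have "(a \<otimes> inv b \<oplus> \<one>) \<otimes> b = a \<oplus> b"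
        using c ic[OF c(3) that(3)] by (simp add: l_distr m_assoc)
      moreover have "(a \<otimes> inv b \<oplus> \<one>) \<otimes> b \<in> M"
        using M_mult[OF ab(2)] As(3,7) that(4) by auto
      ultimately show ?thesis by simp
    qed
    have c: "a \<in> carrier R" "b \<in> carrier R" "b \<in> A" "a \<in> A" using ab MA Ac by auto
    show ?thesis
    proof (cases "a = \<zero> \<or> b = \<zero>")
      case True then show ?thesis using ab c by auto
    next
      case False
      then have nz: "a \<otimes> inv b \<noteq> \<zero>" "a \<otimes> inv b \<in> F"
        using c ic[of b] Ac iF[of b] A(2) subringE(6)[OF subfieldE(1)[OF F(1)]]
        by (auto simp: integral_iff)
      have "inv (a \<otimes> inv b) = b \<otimes> inv a"
      proof (rule comm_inv_char)
        have "a \<otimes> inv b \<otimes> (b \<otimes> inv a) = (a \<otimes> inv a) \<otimes> (inv b \<otimes> b)"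
          using c(1,2) ic(1)[of a] ic(1)[of b] False c(3,4) by (simp add: m_ac del: r_one l_one)
        then show "a \<otimes> inv b \<otimes> (b \<otimes> inv a) = \<one>" using False c ic[of a] ic[of b] by simp
      qed (use False c ic[of a] ic[of b] in auto)
      then have "a \<otimes> inv b \<in> A \<or> b \<otimes> inv a \<in> A" using val[OF nz(2,1)] by simp
      then show ?thesis using aux[of a b] aux[of b a] False ab c by (auto simp: a_comm)
    qed
  qed
  have M_minus: "\<ominus> a \<in> M" if "a \<in> M" for a
    using M_mult[OF that, of "\<ominus> \<one>"] As(3,5) that MA Ac by (auto simp: l_minus)
  have one: "\<one> \<notin> M" using As(3) by (auto simp: M_def)
  have unit: "inv a \<in> A" "a \<noteq> \<zero>" if "a \<in> A" "a \<notin> M" for a using that by (auto simp: M_def)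
  have ideal: "ideal M ?A"
  proof (rule idealI)
    show "ring ?A" by (rule A.ring_axioms)
    show "subgroup M (add_monoid ?A)"
    proof (rule subgroup.intro)
      fix x y assume "x \<in> M" "y \<in> M"
      then show "x \<otimes>\<^bsub>add_monoid ?A\<^esub> y \<in> M" using M_add by simp
    next
      fix x assume "x \<in> M"
      then show "inv\<^bsub>add_monoid ?A\<^esub> x \<in> M" using M_minus Ainv[of x] MA by (auto simp: a_inv_def)
    qed (use MA As(2) in \<open>auto simp: M_def\<close>)
    fix a x assume "a \<in> M" "x \<in> carrier ?A"
    then show "x \<otimes>\<^bsub>?A\<^esub> a \<in> M" "a \<otimes>\<^bsub>?A\<^esub> x \<in> M"
      using M_mult[of a x] m_comm[of a x] MA Ac by auto
  qed
  have "maximalideal M ?A"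
  proof (rule maximalidealI[OF ideal])
    show "carrier ?A \<noteq> M" using one As(3) by auto
    fix J assume J: "ideal J ?A" "M \<subseteq> J" "J \<subseteq> carrier ?A"
    interpret J: ideal J ?A by (rule J)
    show "J = M \<or> J = carrier ?A"
    proof (cases "J = M")
      case False
      then obtain a where a: "a \<in> J" "a \<notin> M" "a \<in> A" using J by auto
      then have "inv a \<otimes> a \<in> J" using J.I_l_closed[of a "inv a"] unit by auto
      then have "\<one> \<in> J" using ic[of a] unit a by auto
      then have "x \<in> J" if "x \<in> A" for x using J.I_l_closed[of \<one> x] that Ac by auto
      then show ?thesis using J(3) by auto
    qed simp
  qed
  then have quot: "field (?A Quot M)" using maximalideal.quotient_is_field A.is_cring by blast
  \<comment> \<open>The residue class of \<open>a\<close>.\<close>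
  define C where "C = (\<lambda>a. {b \<in> A. b \<ominus> a \<in> M})"
  have C_iff: "C a = C b \<longleftrightarrow> a \<ominus> b \<in> M" if "a \<in> A" "b \<in> A" for a b
  proof
    have c: "a \<in> carrier R" "b \<in> carrier R" using that Ac by auto
    have "a \<in> C a" using that c As(2) by (auto simp: C_def M_def minus_eq r_neg)
    moreover assume "C a = C b"
    ultimately have "a \<in> C b" by simp
    then show "a \<ominus> b \<in> M" by (simp add: C_def)
  next
    have step: "C a \<subseteq> C b" if ab: "a \<in> A" "b \<in> A" "a \<ominus> b \<in> M" for a b
    proof
      fix x assume "x \<in> C a"
      then have x: "x \<in> A" "x \<ominus> a \<in> M" by (auto simp: C_def)
      have "(x \<ominus> a) \<oplus> (a \<ominus> b) = x \<ominus> b"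
        using x ab Ac by (simp add: minus_eq a_assoc r_neg1 r_neg2)
      then show "x \<in> C b" using M_add[OF x(2) ab(3)] x(1) by (simp add: C_def)
    qed
    assume ab: "a \<ominus> b \<in> M"
    have "\<ominus> (a \<ominus> b) = b \<ominus> a" using that Ac by (simp add: minus_eq minus_add a_comm)
    then have "b \<ominus> a \<in> M" using M_minus[OF ab] by simp
    then show "C a = C b" using step that ab by blast
  qed
  obtain e :: "nat \<Rightarrow> 'k" where e: "inj e" using inf infinite_countable_subset by blast
  define f where "f = (\<lambda>a. e (to_nat_on (C ` A) (C a)))"
  have cnt: "countable (C ` A)" using F(2) A(2) countable_subset by blast
  have "f a = f b \<longleftrightarrow> a \<ominus>\<^bsub>?A\<^esub> b \<in> M" if "a \<in> A" "b \<in> A" for a b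
    unfolding f_def inj_eq[OF e] Aminus[OF that] C_iff[OF that, symmetric]
    using that by (intro to_nat_on_inj[OF cnt]) auto
  then have weak: "weak_ring_morphism f M ?A"
    by (intro weak_ring_morphismI[OF ideal]) auto
  define k where "k = image_ring f ?A"
  have fk: "field k" unfolding k_def by (rule A.image_ring_is_field[OF weak quot])
  interpret k: field k by (rule fk)
  have hom: "f \<in> ring_hom ?A k" unfolding k_def by (rule A.weak_ring_morphism_is_hom[OF weak])
  have sh: "subring_hom R k A f"
    using ring_hom_memE[OF hom] A(1) by (intro subring_hom.intro subring_hom_axioms.intro is_cring k.is_cring) auto
  interpret sh: subring_hom R k A f by (rule sh)
  have f0: "f a = \<zero>\<^bsub>k\<^esub> \<longleftrightarrow> a \<in> M" if "a \<in> A" for a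
  proof -
    have "f a = f \<zero> \<longleftrightarrow> a \<ominus> \<zero> \<in> M"
      using weak_ring_morphism.inj_mod_ideal[OF weak, of a \<zero>] that As(2) Aminus[OF that As(2)] by simp
    then show ?thesis using Ac[OF that] by (simp add: minus_eq)
  qed
  have fn: "f (add_pow R n \<one>) = add_pow k n \<one>\<^bsub>k\<^esub> \<and> add_pow R n \<one> \<in> A" for n :: nat
    by (induction n) (auto simp: sh.hom_add sh.hom_one)
  have "add_pow R p \<one> \<in> M" using A(3,5) by (simp add: M_def)
  then have "add_pow k p \<one>\<^bsub>k\<^esub> = \<zero>\<^bsub>k\<^esub>" using fn[of p] f0[OF A(3)] by simp
  then have "ring_char k dvd p"
    using group.pow_eq_id[OF k.a_group, of "\<one>\<^bsub>k\<^esub>" p] by (simp add: ring_char_def add_pow_def)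
  moreover have "ring_char k \<noteq> 1"
    using group.ord_eq_1[OF k.a_group, of "\<one>\<^bsub>k\<^esub>"] by (simp add: ring_char_def)
  ultimately have char: "ring_char k = p" using p by (auto simp: prime_nat_iff)
  show thesis
  proof (rule that[OF fk char A(2) sh])
    show "f ` A = carrier k" by (simp add: k_def image_ring_carrier)
  qed (rule val)
qed

section \<open>Constants\<close>

lemma (in cring) id_subring_hom: "subring_hom R R (carrier R) (\<lambda>a. a)"
  by (intro subring_hom.intro subring_hom_axioms.intro is_cring carrier_is_subring) auto

lemma (in subring_hom) image_subring:
  assumes "subring B R" "B \<subseteq> A"
  shows "subring (\<psi> ` B) S"
proof -
  interpret B: subring_hom R S B \<psi> by (rule subring_hom_subset[OF assms])
  show ?thesis
  proof (rule S.subringI)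
    show "\<psi> ` B \<subseteq> carrier S" using B.hom_closed by auto
    show "\<one>\<^bsub>S\<^esub> \<in> \<psi> ` B" using B.A_closed(2) hom_one by (metis imageI)
    fix x assume "x \<in> \<psi> ` B"
    then obtain a where a: "a \<in> B" "x = \<psi> a" by auto
    then show "\<ominus>\<^bsub>S\<^esub> x \<in> \<psi> ` B" using B.A_closed(4) B.hom_minus by (metis imageI)
    fix y assume "y \<in> \<psi> ` B"
    then obtain b where b: "b \<in> B" "y = \<psi> b" by auto
    show "x \<otimes>\<^bsub>S\<^esub> y \<in> \<psi> ` B" using a b B.A_closed(6) B.hom_mult by (metis imageI)
    show "x \<oplus>\<^bsub>S\<^esub> y \<in> \<psi> ` B" using a b B.A_closed(5) B.hom_add by (metis imageI)
  qed
qed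

lemma (in subring_hom) hom_add_pow: "a \<in> A \<Longrightarrow> add_pow R (n :: nat) a \<in> A \<and> \<psi> (add_pow R n a) = add_pow S n (\<psi> a)"
  by (induction n) (auto simp: hom_add)

context cring begin

lemma const_closed: "c \<in> carrier R \<Longrightarrow> indexed_const c \<in> carrier (mpoly_ring R I)"
  by (auto simp: mpoly_carrier supported_def indexed_const_def)

lemma const_mult:
  assumes "c \<in> carrier R" "P \<in> carrier (mpoly_ring R I)"
  shows "indexed_const c \<otimes>\<^bsub>mpoly_ring R I\<^esub> P = (\<lambda>m. c \<otimes> P m)"
proof
  fix m
  have P: "P m \<in> carrier R" for m using assms(2) by (auto simp: mpoly_carrier supported_def)
  have "(\<Oplus>a\<in>{{#}}. c \<otimes> P (m - a)) = (\<Oplus>a\<in>{a. a \<subseteq># m}. indexed_const c a \<otimes> P (m - a))"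
    using assms(1) P finite_submultisets[of m]
    by (intro finsum_mono_neutral_cong_left) (auto simp: indexed_const_def)
  moreover have "(\<Oplus>a\<in>{{#}}. c \<otimes> P (m - a)) = c \<otimes> P m" using assms(1) P by (simp add: finsum_insert)
  ultimately show "(indexed_const c \<otimes>\<^bsub>mpoly_ring R I\<^esub> P) m = c \<otimes> P m"
    by (simp add: mpoly_mult)
qed

lemma const_subring_hom: "subring_hom R (mpoly_ring R I) (carrier R) indexed_const"
proof (intro subring_hom.intro subring_hom_axioms.intro is_cring mpoly_cring carrier_is_subring)
  fix a b assume ab: "a \<in> carrier R" "b \<in> carrier R"
  show "indexed_const (a \<oplus> b) = indexed_const a \<oplus>\<^bsub>mpoly_ring R I\<^esub> indexed_const b"
    by (auto simp: mpoly_add indexed_const_def)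
  show "indexed_const (a \<otimes> b) = indexed_const a \<otimes>\<^bsub>mpoly_ring R I\<^esub> indexed_const b"
    using ab const_mult[OF ab(1) const_closed[OF ab(2)], where I = I] by (auto simp: indexed_const_def fun_eq_iff)
next
  show "indexed_const \<one> = \<one>\<^bsub>mpoly_ring R I\<^esub>" by (simp add: mpoly_ring_def)
qed (rule const_closed)

lemma mpoly_finsum:
  assumes "F \<in> W \<rightarrow> carrier (mpoly_ring R I)"
  shows "finsum (mpoly_ring R I) F W m = (\<Oplus>i\<in>W. F i m)"
proof -
  interpret D: cring "mpoly_ring R I" by (rule mpoly_cring)
  show ?thesis using assms
  proof (induction W rule: infinite_finite_induct)
    case (insert i W)
    have "F j m \<in> carrier R" if "j \<in> insert i W" for j
    proof -
      have "F j \<in> carrier (mpoly_ring R I)" using insert.prems that by auto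
      then show ?thesis by (auto simp: mpoly_carrier supported_def)
    qed
    then show ?case using insert by (subst D.finsum_insert, auto simp: finsum_insert mpoly_add Pi_iff)
  qed simp_all
qed

end

context "domain" begin

lemma frac_of_subring_hom: "subring_hom R (frac_field R) (carrier R) (\<lambda>a. fraction R a \<one>)"
proof (intro subring_hom.intro subring_hom_axioms.intro is_cring frac_cring carrier_is_subring)
qed (auto simp: frac_carrierI frac_add frac_mult frac_one)

lemma finsum_fraction:
  assumes "F \<in> W \<rightarrow> carrier R" "b \<in> nonzero"
  shows "finsum (frac_field R) (\<lambda>i. fraction R (F i) b) W = fraction R (finsum R F W) b"
proof -
  interpret E: field "frac_field R" by (rule frac_field_field)
  have z: "\<zero>\<^bsub>frac_field R\<^esub> = fraction R \<zero> b" using frac_eq_zero_iff[of \<zero> b] assms(2) by simp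
  show ?thesis using assms(1)
  proof (induction W rule: infinite_finite_induct)
    case (insert i W)
    have c: "F i \<in> carrier R" "finsum R F W \<in> carrier R" using insert.prems by (auto intro!: finsum_closed)
    have "fraction R (F i) b \<oplus>\<^bsub>frac_field R\<^esub> fraction R (finsum R F W) b = fraction R (F i \<oplus> finsum R F W) b"
      using c assms(2) nonzero_mult[OF assms(2) assms(2)]
      by (subst frac_add, simp_all, subst fraction_eq_iff, auto simp: l_distr r_distr m_ac)
    then show ?case using insert assms(2) c
      by (subst E.finsum_insert) (auto simp: finsum_insert frac_carrierI Pi_iff)
  qed (use z in simp_all)
qed

end

section \<open>The regular representation\<close>

locale regular_rep = F: field F + G: group G
  for F :: "('a, 'm) ring_scheme" and G :: "('g, 'n) monoid_scheme" +
  assumes finite_G: "finite (carrier G)"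
begin

abbreviation D where "D \<equiv> mpoly_ring F (carrier G)"
abbreviation E where "E \<equiv> regular_field F G"
abbreviation act where "act \<equiv> regular_act F G"
abbreviation shift where "shift g \<equiv> image_mset (\<lambda>h. g \<otimes>\<^bsub>G\<^esub> h)"
abbreviation const where "const c \<equiv> fraction D (F.indexed_const c) \<one>\<^bsub>D\<^esub>"

lemma D_domain: "domain D" by (rule F.mpoly_domain[OF finite_G])

sublocale D: "domain" D by (rule D_domain)

\<comment> \<open>Keeps the zero polynomial folded, so that facts about the zero of a ring apply to it.\<close>
lemmas [simp del] = F.mpoly_zero

lemma D_one: "\<one>\<^bsub>D\<^esub> \<in> D.nonzero" by simp

lemma E_field: "field E" unfolding regular_field_def by (rule D.frac_field_field)

sublocale E: field E by (rule E_field)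

lemma E_eq: "E = frac_field D" by (simp add: regular_field_def)

lemma D_carrier: "carrier D = {P. supported F (carrier G) (carrier F) P}" by (rule F.mpoly_carrier)

lemma regular_const_eq: "regular_const F G = const ` carrier F"
  by (simp add: regular_const_def mpoly_ring_def)

lemma const_hom: "subring_hom F E (carrier F) (\<lambda>c. const c)"
proof -
  interpret c: subring_hom F D "carrier F" F.indexed_const by (rule F.const_subring_hom)
  interpret f: subring_hom D E "carrier D" "\<lambda>a. fraction D a \<one>\<^bsub>D\<^esub>"
    unfolding E_eq by (rule D.frac_of_subring_hom)
  show ?thesis
    by (intro subring_hom.intro subring_hom_axioms.intro F.is_cring E.is_cring F.carrier_is_subring)
      (auto simp: c.hom_closed f.hom_closed c.hom_add f.hom_add c.hom_mult f.hom_mult c.hom_one f.hom_one)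
qed

lemma const_eq_zero_iff: "c \<in> carrier F \<Longrightarrow> const c = \<zero>\<^bsub>E\<^esub> \<longleftrightarrow> c = \<zero>\<^bsub>F\<^esub>"
  unfolding E_eq D.frac_eq_zero_iff[OF F.const_closed D_one]
  by (auto simp: F.indexed_const_def F.mpoly_zero fun_eq_iff)

lemma regular_const_subring: "subring (regular_const F G) E"
proof -
  interpret c: subring_hom F E "carrier F" "\<lambda>c. const c" by (rule const_hom)
  show ?thesis unfolding regular_const_eq by (rule c.image_subring) (auto simp: F.carrier_is_subring)
qed

lemma shift_closed: "g \<in> carrier G \<Longrightarrow> set_mset m \<subseteq> carrier G \<Longrightarrow> set_mset (shift g m) \<subseteq> carrier G"
  by auto

text \<open>
  Translating the variables is a map of monomials, so the laws of the action are instances of those of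
  \<open>mpoly_map\<close>.
\<close>

lemma poly_act_eq:
  assumes g: "g \<in> carrier G" and P: "P \<in> carrier D"
  shows "regular_poly_act F G g P = mpoly_map F F (\<lambda>a. a) (shift g) P"
proof
  fix m
  have PF: "P m \<in> carrier F" and PS: "P m \<noteq> \<zero>\<^bsub>F\<^esub> \<Longrightarrow> set_mset m \<subseteq> carrier G" for m
    using P by (auto simp: D_carrier supported_def)
  let ?S = "{a. P a \<noteq> \<zero>\<^bsub>F\<^esub> \<and> shift g a = m}"
  have R: "mpoly_map F F (\<lambda>a. a) (shift g) P m = finsum F P ?S"
    by (simp add: mpoly_map_def collect_def)
  have inv1: "shift (inv\<^bsub>G\<^esub> g) (shift g a) = a" if "set_mset a \<subseteq> carrier G" for a
  proof -
    have "image_mset (\<lambda>h. inv\<^bsub>G\<^esub> g \<otimes>\<^bsub>G\<^esub> (g \<otimes>\<^bsub>G\<^esub> h)) a = image_mset (\<lambda>h. h) a"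
      using that g by (intro image_mset_cong) (auto simp: G.m_assoc[symmetric])
    then show ?thesis by (simp add: multiset.map_comp comp_def)
  qed
  have inv2: "shift g (shift (inv\<^bsub>G\<^esub> g) a) = a" if "set_mset a \<subseteq> carrier G" for a
  proof -
    have "image_mset (\<lambda>h. g \<otimes>\<^bsub>G\<^esub> (inv\<^bsub>G\<^esub> g \<otimes>\<^bsub>G\<^esub> h)) a = image_mset (\<lambda>h. h) a"
      using that g by (intro image_mset_cong) (auto simp: G.m_assoc[symmetric])
    then show ?thesis by (simp add: multiset.map_comp comp_def)
  qed
  show "regular_poly_act F G g P m = mpoly_map F F (\<lambda>a. a) (shift g) P m"
  proof (cases "set_mset m \<subseteq> carrier G")
    case True
    let ?a = "shift (inv\<^bsub>G\<^esub> g) m"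
    have "?S = (if P ?a \<noteq> \<zero>\<^bsub>F\<^esub> then {?a} else {})"
      using inv1 inv2[OF True] PS by auto
    then have "finsum F P ?S = P ?a" using PF by (auto simp: F.finsum_insert)
    then show ?thesis using True R by (simp add: regular_poly_act_def)
  next
    case False
    then have "?S = {}" using PS shift_closed[OF g] by blast
    then show ?thesis using False R by (simp add: regular_poly_act_def del: empty_Collect_eq Collect_empty_eq)
  qed
qed

lemma shift_comp:
  assumes "g \<in> carrier G" "h \<in> carrier G" "set_mset m \<subseteq> carrier G"
  shows "shift g (shift h m) = shift (g \<otimes>\<^bsub>G\<^esub> h) m"
proof -
  have "image_mset (\<lambda>x. g \<otimes>\<^bsub>G\<^esub> (h \<otimes>\<^bsub>G\<^esub> x)) m = image_mset (\<lambda>x. g \<otimes>\<^bsub>G\<^esub> h \<otimes>\<^bsub>G\<^esub> x) m"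
    using assms by (intro image_mset_cong) (auto simp: G.m_assoc)
  then show ?thesis by (simp add: multiset.map_comp comp_def)
qed

lemma shift_one: "set_mset m \<subseteq> carrier G \<Longrightarrow> shift \<one>\<^bsub>G\<^esub> m = m"
proof -
  assume "set_mset m \<subseteq> carrier G"
  then have "shift \<one>\<^bsub>G\<^esub> m = image_mset (\<lambda>h. h) m" by (intro image_mset_cong) auto
  then show ?thesis by simp
qed

lemma poly_act_subring_hom:
  assumes "g \<in> carrier G"
  shows "subring_hom D D (carrier D) (mpoly_map F F (\<lambda>a. a) (shift g))"
proof -
  interpret i: subring_hom F F "carrier F" "\<lambda>a. a" by (rule F.id_subring_hom)
  show ?thesis unfolding D_carrier
    by (rule i.mpoly_map_subring_hom) (use assms in auto)
qed

lemma poly_act_ring_hom: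
  assumes g: "g \<in> carrier G"
  shows "regular_poly_act F G g \<in> ring_hom D D"
proof -
  interpret a: subring_hom D D "carrier D" "mpoly_map F F (\<lambda>a. a) (shift g)" by (rule poly_act_subring_hom[OF g])
  show ?thesis
    by (rule ring_hom_memI) (auto simp: poly_act_eq[OF g] a.hom_closed a.hom_add a.hom_mult a.hom_one)
qed

lemma poly_act_comp:
  assumes "g \<in> carrier G" "h \<in> carrier G" "P \<in> carrier D"
  shows "regular_poly_act F G g (regular_poly_act F G h P) = regular_poly_act F G (g \<otimes>\<^bsub>G\<^esub> h) P"
proof -
  note i = F.id_subring_hom
  have sP: "supported F (carrier G) (carrier F) P" using assms(3) by (simp add: D_carrier)
  have hP: "regular_poly_act F G h P \<in> carrier D" using ring_hom_closed[OF poly_act_ring_hom] assms by blast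
  have "regular_poly_act F G g (regular_poly_act F G h P)
      = mpoly_map F F (\<lambda>a. a) (\<lambda>m. shift g (shift h m)) P"
    unfolding poly_act_eq[OF assms(1) hP] unfolding poly_act_eq[OF assms(2,3)]
    by (rule mpoly_map_comp[OF i i _ sP])
  also have "\<dots> = mpoly_map F F (\<lambda>a. a) (shift (g \<otimes>\<^bsub>G\<^esub> h)) P"
    by (rule mpoly_map_cong[OF F.is_cring sP]) (use assms shift_comp in auto)
  finally show ?thesis using assms poly_act_eq[of "g \<otimes>\<^bsub>G\<^esub> h" P] by simp
qed

lemma poly_act_one: "P \<in> carrier D \<Longrightarrow> regular_poly_act F G \<one>\<^bsub>G\<^esub> P = P"
  using poly_act_eq[of "\<one>\<^bsub>G\<^esub>" P] mpoly_map_id[OF F.is_cring _ shift_one, of P "carrier G"] by simp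

lemma poly_act_inv:
  assumes "g \<in> carrier G" "P \<in> carrier D"
  shows "regular_poly_act F G g (regular_poly_act F G (inv\<^bsub>G\<^esub> g) P) = P"
    "regular_poly_act F G (inv\<^bsub>G\<^esub> g) (regular_poly_act F G g P) = P"
  using assms poly_act_comp poly_act_one by auto

lemma act_fraction:
  assumes "g \<in> carrier G" "a \<in> carrier D" "b \<in> D.nonzero"
  shows "act g (fraction D a b) = fraction D (regular_poly_act F G g a) (regular_poly_act F G g b)"
    "regular_poly_act F G g a \<in> carrier D" "regular_poly_act F G g b \<in> D.nonzero"
proof -
  note h = poly_act_ring_hom[OF assms(1)]
  show "act g (fraction D a b) = fraction D (regular_poly_act F G g a) (regular_poly_act F G g b)"
    unfolding regular_act_def
    by (rule D.map_prod_fraction[OF h poly_act_ring_hom[OF G.inv_closed[OF assms(1)]]])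
      (use assms poly_act_inv in auto)
  show "regular_poly_act F G g a \<in> carrier D" using ring_hom_closed[OF h] assms by auto
  have "regular_poly_act F G g b \<noteq> \<zero>\<^bsub>D\<^esub>"
  proof
    assume "regular_poly_act F G g b = \<zero>\<^bsub>D\<^esub>"
    then have "b = regular_poly_act F G (inv\<^bsub>G\<^esub> g) \<zero>\<^bsub>D\<^esub>" using poly_act_inv(2)[of g b] assms by auto
    then show False
      using ring_hom_zero[OF poly_act_ring_hom[OF G.inv_closed[OF assms(1)]] D.ring_axioms D.ring_axioms] assms(3) by simp
  qed
  then show "regular_poly_act F G g b \<in> D.nonzero" using ring_hom_closed[OF h] assms by auto
qed

lemma E_carrierE:
  assumes "x \<in> carrier E"
  obtains a b where "a \<in> carrier D" "b \<in> D.nonzero" "x = fraction D a b"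
  using assms D.frac_carrierE unfolding E_eq by blast

lemma act_subring_hom:
  assumes g: "g \<in> carrier G"
  shows "subring_hom E E (carrier E) (act g)"
proof (intro subring_hom.intro subring_hom_axioms.intro E.is_cring E.carrier_is_subring)
  note h = poly_act_ring_hom[OF g]
  fix x y assume "x \<in> carrier E" "y \<in> carrier E"
  then obtain a b c d where r: "a \<in> carrier D" "b \<in> D.nonzero" "x = fraction D a b"
    "c \<in> carrier D" "d \<in> D.nonzero" "y = fraction D c d" by (elim E_carrierE)
  note ab = act_fraction[OF g r(1,2)] and cd = act_fraction[OF g r(4,5)]
  have cl: "b \<in> carrier D" "d \<in> carrier D" using r by auto
  note bd = D.nonzero_mult[OF r(2,5)]
  show "act g x \<in> carrier E" unfolding r(3) ab(1) E_eq using ab by (intro D.frac_carrierI)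
  show "act g (x \<otimes>\<^bsub>E\<^esub> y) = act g x \<otimes>\<^bsub>E\<^esub> act g y"
    unfolding r(3,6) E_eq D.frac_mult[OF r(1,2,4,5)] ab(1) cd(1) D.frac_mult[OF ab(2,3) cd(2,3)]
    using r bd cl by (subst act_fraction(1)[OF g]) (auto simp: ring_hom_mult[OF h])
  show "act g (x \<oplus>\<^bsub>E\<^esub> y) = act g x \<oplus>\<^bsub>E\<^esub> act g y"
    unfolding r(3,6) E_eq D.frac_add[OF r(1,2,4,5)] ab(1) cd(1) D.frac_add[OF ab(2,3) cd(2,3)]
    using r bd cl by (subst act_fraction(1)[OF g]) (auto simp: ring_hom_mult[OF h] ring_hom_add[OF h])
next
  show "act g \<one>\<^bsub>E\<^esub> = \<one>\<^bsub>E\<^esub>"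
    unfolding E_eq D.frac_one using act_fraction(1)[OF g, of "\<one>\<^bsub>D\<^esub>" "\<one>\<^bsub>D\<^esub>"] ring_hom_one[OF poly_act_ring_hom[OF g]] by simp
qed

lemma act_closed: "g \<in> carrier G \<Longrightarrow> x \<in> carrier E \<Longrightarrow> act g x \<in> carrier E"
  using subring_hom.hom_closed[OF act_subring_hom] .

lemma act_comp:
  assumes "g \<in> carrier G" "h \<in> carrier G" "x \<in> carrier E"
  shows "act g (act h x) = act (g \<otimes>\<^bsub>G\<^esub> h) x"
proof -
  obtain a b where r: "a \<in> carrier D" "b \<in> D.nonzero" "x = fraction D a b" using assms(3) by (elim E_carrierE)
  note h = act_fraction[OF assms(2) r(1,2)]
  show ?thesis unfolding r(3) h(1)
    using act_fraction(1)[OF assms(1) h(2,3)] act_fraction(1)[of "g \<otimes>\<^bsub>G\<^esub> h", OF _ r(1,2)] assms r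
    by (simp add: poly_act_comp)
qed

lemma act_one:
  assumes "x \<in> carrier E"
  shows "act \<one>\<^bsub>G\<^esub> x = x"
proof -
  obtain a b where r: "a \<in> carrier D" "b \<in> D.nonzero" "x = fraction D a b" using assms by (elim E_carrierE)
  then show ?thesis using act_fraction(1)[of "\<one>\<^bsub>G\<^esub>", OF _ r(1,2)] by (simp add: poly_act_one)
qed

lemma act_inv:
  assumes "g \<in> carrier G" "x \<in> carrier E"
  shows "act g (act (inv\<^bsub>G\<^esub> g) x) = x" "act (inv\<^bsub>G\<^esub> g) (act g x) = x"
  using assms act_comp act_one by auto

lemma act_const:
  assumes g: "g \<in> carrier G" and c: "c \<in> carrier F"
  shows "act g (const c) = const c"
proof -
  interpret i: subring_hom F F "carrier F" "\<lambda>a. a" by (rule F.id_subring_hom)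
  have "regular_poly_act F G g (F.indexed_const c) = F.indexed_const c"
    using poly_act_eq[OF g F.const_closed[OF c]] i.map_const[OF c, of "shift g"] by simp
  then show ?thesis
    using act_fraction(1)[OF g F.const_closed[OF c], of "\<one>\<^bsub>D\<^esub>"] ring_hom_one[OF poly_act_ring_hom[OF g]] by simp
qed

text \<open>
  If \<open>g\<close> and \<open>h\<close> have the same restriction to \<open>L\<close>, then \<open>h\<^sup>-\<^sup>1 g\<close> fixes \<open>L\<close> pointwise.
\<close>

lemma faithful_action_iff:
  assumes L: "L \<subseteq> carrier E"
  shows "faithful_action G L (\<lambda>g. restrict (act g) L) \<longleftrightarrow>
    (\<forall>g\<in>carrier G. \<forall>x\<in>L. act g x \<in> L) \<and> (\<forall>g\<in>carrier G. g \<noteq> \<one>\<^bsub>G\<^esub> \<longrightarrow> (\<exists>x\<in>L. act g x \<noteq> x))"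
proof
  assume "faithful_action G L (\<lambda>g. restrict (act g) L)"
  then interpret a: faithful_action G L "\<lambda>g. restrict (act g) L" .
  show "(\<forall>g\<in>carrier G. \<forall>x\<in>L. act g x \<in> L) \<and> (\<forall>g\<in>carrier G. g \<noteq> \<one>\<^bsub>G\<^esub> \<longrightarrow> (\<exists>x\<in>L. act g x \<noteq> x))"
  proof (intro conjI ballI impI)
    fix g x assume "g \<in> carrier G" "x \<in> L"
    then show "act g x \<in> L" using a.element_image[of g x "act g x"] by simp
  next
    fix g assume g: "g \<in> carrier G" "g \<noteq> \<one>\<^bsub>G\<^esub>"
    show "\<exists>x\<in>L. act g x \<noteq> x"
    proof (rule ccontr)
      assume "\<not> (\<exists>x\<in>L. act g x \<noteq> x)"
      then have "restrict (act g) L = restrict (act \<one>\<^bsub>G\<^esub>) L"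
        using act_one L by (intro restrict_ext) auto
      then show False using inj_onD[OF a.faithful, of g "\<one>\<^bsub>G\<^esub>"] g by simp
    qed
  qed
next
  assume "(\<forall>g\<in>carrier G. \<forall>x\<in>L. act g x \<in> L) \<and> (\<forall>g\<in>carrier G. g \<noteq> \<one>\<^bsub>G\<^esub> \<longrightarrow> (\<exists>x\<in>L. act g x \<noteq> x))"
  then have inv: "\<And>g x. g \<in> carrier G \<Longrightarrow> x \<in> L \<Longrightarrow> act g x \<in> L"
    and mv: "\<And>g. g \<in> carrier G \<Longrightarrow> g \<noteq> \<one>\<^bsub>G\<^esub> \<Longrightarrow> \<exists>x\<in>L. act g x \<noteq> x" by auto
  have Lc: "x \<in> L \<Longrightarrow> x \<in> carrier E" for x using L by auto
  have bij: "restrict (act g) L \<in> Bij L" if g: "g \<in> carrier G" for g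
  proof -
    have "bij_betw (act g) L L"
      by (rule bij_betw_byWitness[where f' = "act (inv\<^bsub>G\<^esub> g)"]) (use g inv Lc act_inv in auto)
    then show ?thesis by (simp add: Bij_def bij_betw_restrict_eq)
  qed
  have "group_hom G (BijGroup L) (\<lambda>g. restrict (act g) L)"
  proof (intro group_hom.intro group_hom_axioms.intro G.group_axioms group_BijGroup homI)
    fix g h assume gh: "g \<in> carrier G" "h \<in> carrier G"
    show "restrict (act g) L \<in> carrier (BijGroup L)" using bij[OF gh(1)] by (simp add: BijGroup_def)
    have "restrict (act (g \<otimes>\<^bsub>G\<^esub> h)) L = compose L (restrict (act g) L) (restrict (act h) L)"
      using gh inv Lc act_comp by (auto simp: compose_def fun_eq_iff)
    then show "restrict (act (g \<otimes>\<^bsub>G\<^esub> h)) L = restrict (act g) L \<otimes>\<^bsub>BijGroup L\<^esub> restrict (act h) L"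
      using bij gh by (simp add: BijGroup_def)
  qed
  moreover have "inj_on (\<lambda>g. restrict (act g) L) (carrier G)"
  proof (rule inj_onI)
    fix g h assume gh: "g \<in> carrier G" "h \<in> carrier G" "restrict (act g) L = restrict (act h) L"
    have "act (inv\<^bsub>G\<^esub> h \<otimes>\<^bsub>G\<^esub> g) x = x" if x: "x \<in> L" for x
    proof -
      have "act g x = act h x" using gh(3) x by (metis restrict_apply')
      then show ?thesis using act_comp[of "inv\<^bsub>G\<^esub> h" g x] act_inv(2)[of h x] gh Lc[OF x] by simp
    qed
    then have "inv\<^bsub>G\<^esub> h \<otimes>\<^bsub>G\<^esub> g = \<one>\<^bsub>G\<^esub>" using mv[of "inv\<^bsub>G\<^esub> h \<otimes>\<^bsub>G\<^esub> g"] gh by auto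
    then show "g = h" using gh by (metis G.inv_closed G.inv_equality G.inv_inv)
  qed
  ultimately show "faithful_action G L (\<lambda>g. restrict (act g) L)"
    by (intro faithful_action.intro group_action.intro faithful_action_axioms.intro)
qed

end

section \<open>Reduction of rational functions\<close>

text \<open>
  Take \<open>s\<close> inverse to a coefficient of least value: all quotients by it lie in the valuation ring.
\<close>

lemma (in field) scale_into_valuation_ring:
  assumes A: "subring A R" "A \<subseteq> T" and T: "subfield T R"
    and val: "\<And>x. x \<in> T \<Longrightarrow> x \<noteq> \<zero> \<Longrightarrow> x \<in> A \<or> inv x \<in> A"
    and W: "finite W"
  shows "c \<in> W \<rightarrow> T \<Longrightarrow> j \<in> W \<Longrightarrow> c j \<noteq> \<zero> \<Longrightarrow>
    \<exists>s\<in>T. s \<noteq> \<zero> \<and> (\<forall>i\<in>W. s \<otimes> c i \<in> A) \<and> (\<exists>i\<in>W. s \<otimes> c i = \<one>)"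
  using W
proof (induction W arbitrary: j)
  case (insert l W)
  note Ts = subringE[OF subfieldE(1)[OF T]] and As = subringE[OF A(1)]
  have Tc: "x \<in> T \<Longrightarrow> x \<in> carrier R" for x using Ts(1) by auto
  have inv: "inv x \<in> T" "inv x \<otimes> x = \<one>" "inv x \<noteq> \<zero>" if "x \<in> T" "x \<noteq> \<zero>" for x
    using that subfield_m_inv(1)[OF T, of x] Tc field_Units nonzero_imp_inverse_nonzero by auto
  have c: "c l \<in> T" "\<And>i. i \<in> W \<Longrightarrow> c i \<in> T" using insert.prems(1) by auto
  show ?case
  proof (cases "\<exists>j\<in>W. c j \<noteq> \<zero>")
    case False
    then have "j = l" using insert.prems by auto
    then have l: "c l \<noteq> \<zero>" using insert.prems by simp
    have "inv (c l) \<otimes> c i \<in> A" if "i \<in> insert l W" for i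
      using that False inv[OF c(1) l] As(2,3) Tc by (auto simp: r_null)
    then show ?thesis using inv[OF c(1) l] by (intro bexI[of _ "inv (c l)"]) auto
  next
    case True
    then obtain s where s: "s \<in> T" "s \<noteq> \<zero>" "\<forall>i\<in>W. s \<otimes> c i \<in> A" "\<exists>i\<in>W. s \<otimes> c i = \<one>"
      using insert.IH insert.prems(1) by blast
    show ?thesis
    proof (cases "s \<otimes> c l \<in> A")
      case True
      then show ?thesis using s by blast
    next
      case False
      have scl: "s \<otimes> c l \<in> T" "s \<otimes> c l \<noteq> \<zero>" using s c Ts(6) False As(2) by auto
      have l: "c l \<noteq> \<zero>" using scl(2) Tc[OF s(1)] by auto
      have cs: "s \<in> carrier R" "inv s \<in> carrier R" "c l \<in> carrier R" "inv (c l) \<in> carrier R"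
        using s inv(1)[OF s(1,2)] inv(1)[OF c(1) l] c Tc by auto
      have i: "inv (s \<otimes> c l) = inv s \<otimes> inv (c l)"
      proof (rule comm_inv_char)
        have "s \<otimes> c l \<otimes> (inv s \<otimes> inv (c l)) = (inv s \<otimes> s) \<otimes> (inv (c l) \<otimes> c l)"
          using cs by (simp add: m_ac)
        then show "s \<otimes> c l \<otimes> (inv s \<otimes> inv (c l)) = \<one>"
          using inv(2)[OF s(1,2)] inv(2)[OF c(1) l] by simp
      qed (use cs in auto)
      then have iA: "inv s \<otimes> inv (c l) \<in> A" using val[OF scl] False by simp
      have "inv (c l) \<otimes> c i \<in> A" if "i \<in> insert l W" for i
      proof (cases "i = l")
        case True
        then show ?thesis using inv(2)[OF c(1) l] As(3) by simp
      next
        case False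
        then have i: "i \<in> W" using that by simp
        have ci: "c i \<in> carrier R" using c(2)[OF i] Tc by auto
        have "(inv s \<otimes> inv (c l)) \<otimes> (s \<otimes> c i) = (inv s \<otimes> s) \<otimes> (inv (c l) \<otimes> c i)"
          using cs ci by (simp add: m_ac)
        then have "inv (c l) \<otimes> c i = (inv s \<otimes> inv (c l)) \<otimes> (s \<otimes> c i)"
          using inv(2)[OF s(1,2)] cs ci by simp
        then show ?thesis using As(6)[OF iA] s(3) i by simp
      qed
      then show ?thesis using inv[OF c(1) l] by (intro bexI[of _ "inv (c l)"]) auto
    qed
  qed
qed simp

lemma (in fraction_place) common_denominator:
  assumes "finite W"
  shows "z \<in> W \<rightarrow> localization \<Longrightarrow>
    \<exists>a b. b \<in> B \<and> \<theta> b \<noteq> \<zero>\<^bsub>D'\<^esub> \<and> (\<forall>i\<in>W. a i \<in> B \<and> z i = fraction D (a i) b)"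
  using assms
proof (induction W)
  case empty
  show ?case using hom_one A_closed(2) by (intro exI[of _ undefined] exI[of _ "\<one>\<^bsub>D\<^esub>"]) auto
next
  case (insert j W)
  then have "\<exists>a b. b \<in> B \<and> \<theta> b \<noteq> \<zero>\<^bsub>D'\<^esub> \<and> (\<forall>i\<in>W. a i \<in> B \<and> z i = fraction D (a i) b)"
    by auto
  then obtain a b where ab: "b \<in> B" "\<theta> b \<noteq> \<zero>\<^bsub>D'\<^esub>" "\<And>i. i \<in> W \<Longrightarrow> a i \<in> B \<and> z i = fraction D (a i) b"
    by blast
  have "z j \<in> localization" using insert.prems by auto
  then obtain c d where cd: "c \<in> B" "d \<in> B" "\<theta> d \<noteq> \<zero>\<^bsub>D'\<^esub>" "z j = fraction D c d" by (elim localizationE)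
  note n = denominator[OF ab(1,2)] denominator[OF cd(2,3)] and bd = denominator_mult[OF ab(1,2) cd(2,3)]
  note nbd = denominator[OF bd]
  have "fraction D (a i) b = fraction D (a i \<otimes>\<^bsub>D\<^esub> d) (b \<otimes>\<^bsub>D\<^esub> d)" if "i \<in> W" for i
  proof -
    have ai: "a i \<in> carrier D" using ab(3)[OF that] by auto
    show ?thesis using n nbd ai by (subst D.fraction_eq_iff) (auto simp: D.m_ac)
  qed
  moreover have "z j = fraction D (c \<otimes>\<^bsub>D\<^esub> b) (b \<otimes>\<^bsub>D\<^esub> d)"
    unfolding cd(4) using n nbd cd(1) by (subst D.fraction_eq_iff) (auto simp: D.m_ac)
  ultimately show ?case
    using insert.hyps ab cd bd
    by (intro exI[of _ "\<lambda>i. if i = j then c \<otimes>\<^bsub>D\<^esub> b else a i \<otimes>\<^bsub>D\<^esub> d"] exI[of _ "b \<otimes>\<^bsub>D\<^esub> d"]) auto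
qed

text \<open>
  Polynomials over \<open>A\<close> in the variables of \<open>G\<close> are mapped to polynomials over \<open>k\<close> in the variables of \<open>H\<close>, by \<open>\<psi>\<close> on
  coefficients and \<open>\<tau>\<close> on monomials.  It is used with the identity for \<open>\<tau>\<close>, for the Gauss valuation, and with
  a collapse of the variables of \<open>G\<close> onto those of a subgroup.
\<close>

locale reduction = P: regular_rep F G + Q: regular_rep k H + subring_hom F k A \<psi>
  for F :: "('a, 'm) ring_scheme" and G :: "('g, 'n) monoid_scheme"
    and k :: "('b, 'p) ring_scheme" and H :: "('h, 'q) monoid_scheme" and A \<psi> +
  fixes \<tau> :: "'g multiset \<Rightarrow> 'h multiset"
  assumes \<tau>_empty: "\<tau> {#} = {#}"
    and \<tau>_add: "\<tau> (a + b) = \<tau> a + \<tau> b"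
    and \<tau>_closed: "set_mset m \<subseteq> carrier G \<Longrightarrow> set_mset (\<tau> m) \<subseteq> carrier H"
begin

abbreviation B where "B \<equiv> {P. supported F (carrier G) A P}"
abbreviation red where "red \<equiv> mpoly_map F k \<psi> \<tau>"

lemma fraction_place: "fraction_place P.D Q.D B red"
  by (intro fraction_place.intro P.D_domain Q.D_domain mpoly_map_subring_hom \<tau>_empty \<tau>_add \<tau>_closed)

sublocale fp: fraction_place P.D Q.D B red by (rule fraction_place)

abbreviation V where "V \<equiv> fp.localization"
abbreviation res where "res \<equiv> fp.residue"

sublocale pl: place P.E Q.E V res
  using fp.place unfolding P.E_eq Q.E_eq .

lemma const_B: "a \<in> A \<Longrightarrow> P.F.indexed_const a \<in> B"
  by (auto simp: supported_def P.F.indexed_const_def)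

lemma red_const: "a \<in> A \<Longrightarrow> red (P.F.indexed_const a) = Q.F.indexed_const (\<psi> a)"
  by (rule map_const[where \<tau> = \<tau>, OF _ \<tau>_empty])

lemma res_const:
  assumes "a \<in> A"
  shows "P.const a \<in> V" "res (P.const a) = Q.const (\<psi> a)"
proof -
  have one: "\<one>\<^bsub>P.D\<^esub> \<in> B" "red \<one>\<^bsub>P.D\<^esub> \<noteq> \<zero>\<^bsub>Q.D\<^esub>"
    using fp.A_closed(2) fp.hom_one by auto
  show "P.const a \<in> V" using fp.localizationI[OF const_B[OF assms] one] .
  show "res (P.const a) = Q.const (\<psi> a)"
    using fp.residue_fraction[OF const_B[OF assms] one] red_const[OF assms] fp.hom_one by simp
qed

lemma act_equivariant:
  assumes g: "g \<in> carrier G" and h: "h \<in> carrier H"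
    and eq: "\<And>m. set_mset m \<subseteq> carrier G \<Longrightarrow> \<tau> (P.shift g m) = Q.shift h (\<tau> m)"
    and b: "b \<in> B"
  shows "regular_poly_act F G g b \<in> B" "red (regular_poly_act F G g b) = regular_poly_act k H h (red b)"
proof -
  have b': "supported F (carrier G) A b" "b \<in> carrier P.D" using b supported_carrier by auto
  have PA: "b m \<in> A" "b m \<noteq> \<zero>\<^bsub>F\<^esub> \<Longrightarrow> set_mset m \<subseteq> carrier G" for m using b'(1) by (auto simp: supported_def)
  note i = P.F.id_subring_hom and j = Q.F.id_subring_hom
  have iA: "subring_hom F F A (\<lambda>a. a)"
    by (rule subring_hom.subring_hom_subset[OF i subring_A A_carrier])
  have act: "regular_poly_act F G g b = mpoly_map F F (\<lambda>a. a) (P.shift g) b" by (rule P.poly_act_eq[OF g b'(2)])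
  show "regular_poly_act F G g b \<in> B"
  proof -
    have "supported F (carrier G) A (collect F {m. b m \<noteq> \<zero>\<^bsub>F\<^esub>} b (P.shift g))"
    proof (rule P.F.collect_supported[OF _ _ subring_A])
      show "finite {m. b m \<noteq> \<zero>\<^bsub>F\<^esub>}" using b'(1) by (simp add: supported_def)
      show "set_mset (P.shift g m) \<subseteq> carrier G" if "m \<in> {m. b m \<noteq> \<zero>\<^bsub>F\<^esub>}" for m
        using PA(2)[of m] that P.shift_closed[OF g] by blast
    qed (use PA(1) in auto)
    then show ?thesis unfolding act mpoly_map_def by simp
  qed
  have redb: "red b \<in> carrier Q.D" using fp.hom_closed[OF b] .
  have "red (regular_poly_act F G g b) = mpoly_map F k \<psi> (\<lambda>m. \<tau> (P.shift g m)) b"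
    unfolding act using mpoly_map_comp[OF iA subring_hom_axioms _ b'(1)] by simp
  also have "\<dots> = mpoly_map F k \<psi> (\<lambda>m. Q.shift h (\<tau> m)) b"
    by (rule mpoly_map_cong[OF Q.F.is_cring b'(1)]) (use eq hom_closed in auto)
  also have "\<dots> = mpoly_map k k (\<lambda>a. a) (Q.shift h) (red b)"
    by (rule mpoly_map_comp[OF subring_hom_axioms j hom_closed b'(1), symmetric])
  also have "\<dots> = regular_poly_act k H h (red b)" by (rule Q.poly_act_eq[OF h redb, symmetric])
  finally show "red (regular_poly_act F G g b) = regular_poly_act k H h (red b)" .
qed

lemma residue_equivariant:
  assumes g: "g \<in> carrier G" and h: "h \<in> carrier H"
    and eq: "\<And>m. set_mset m \<subseteq> carrier G \<Longrightarrow> \<tau> (P.shift g m) = Q.shift h (\<tau> m)"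
    and x: "x \<in> V"
  shows "P.act g x \<in> V" "res (P.act g x) = Q.act h (res x)"
proof -
  obtain a b where ab: "a \<in> B" "b \<in> B" "red b \<noteq> \<zero>\<^bsub>Q.D\<^esub>" "x = fraction P.D a b" using x by (elim fp.localizationE)
  note n = fp.denominator[OF ab(2,3)]
  have aD: "a \<in> carrier P.D" "red a \<in> carrier Q.D" using fp.A_carrier fp.hom_closed ab(1) by blast+
  note ga = act_equivariant[OF g h eq ab(1)] and gb = act_equivariant[OF g h eq ab(2)]
  have gx: "P.act g x = fraction P.D (regular_poly_act F G g a) (regular_poly_act F G g b)"
    unfolding ab(4) using P.act_fraction(1)[OF g aD(1)] n by blast
  have hb: "regular_poly_act k H h (red b) \<in> Q.D.nonzero"
    using Q.act_fraction(3)[OF h aD(2)] n by blast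
  then have gb0: "red (regular_poly_act F G g b) \<noteq> \<zero>\<^bsub>Q.D\<^esub>" using gb(2) by simp
  show "P.act g x \<in> V" unfolding gx by (rule fp.localizationI[OF ga(1) gb(1) gb0])
  have "res (P.act g x) = fraction Q.D (regular_poly_act k H h (red a)) (regular_poly_act k H h (red b))"
    by (simp only: gx fp.residue_fraction[OF ga(1) gb(1) gb0] ga(2) gb(2))
  also have "\<dots> = Q.act h (res x)"
    unfolding ab(4) fp.residue_fraction[OF ab(1-3)] using Q.act_fraction(1)[OF h aD(2)] n by auto
  finally show "res (P.act g x) = Q.act h (res x)" .
qed

end

text \<open>
  The subring \<open>A\<close> is a valuation ring of \<open>T\<close>, which may be much smaller than \<open>F\<close>.
\<close>

locale valued_reduction = reduction +
  fixes T
  assumes T: "subfield T F" "A \<subseteq> T"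
    and val: "\<And>x. x \<in> T \<Longrightarrow> x \<noteq> \<zero>\<^bsub>F\<^esub> \<Longrightarrow> x \<in> A \<or> inv\<^bsub>F\<^esub> x \<in> A"
begin

text \<open>
  Over a common denominator the relation says that \<open>\<Sum> \<gamma> i * a i = 0\<close> for polynomials \<open>a i\<close> over \<open>A\<close> and constants
  \<open>\<gamma> i \<in> F\<close>.  A \<open>T\<close>-linear functional with value \<open>1\<close> at a nonzero \<open>\<gamma> j\<close> commutes with the coefficients of the
  \<open>a i\<close>, which lie in \<open>T\<close>, and turns the \<open>\<gamma> i\<close> into elements of \<open>T\<close>, not all zero.  Scaling moves these into \<open>A\<close> with
  one of them equal to \<open>1\<close>, and the reduction of the resulting relation is not trivial.
\<close>

lemma relation_descends:
  assumes W: "finite W" and z: "z \<in> W \<rightarrow> V" and c: "c \<in> W \<rightarrow> regular_const F G"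
    and rel: "(\<Oplus>\<^bsub>P.E\<^esub>i\<in>W. c i \<otimes>\<^bsub>P.E\<^esub> z i) = \<zero>\<^bsub>P.E\<^esub>" and j: "j \<in> W" "c j \<noteq> \<zero>\<^bsub>P.E\<^esub>"
  shows "\<exists>c'. c' \<in> W \<rightarrow> regular_const k H \<and> (\<exists>i\<in>W. c' i \<noteq> \<zero>\<^bsub>Q.E\<^esub>)
    \<and> (\<Oplus>\<^bsub>Q.E\<^esub>i\<in>W. c' i \<otimes>\<^bsub>Q.E\<^esub> res (z i)) = \<zero>\<^bsub>Q.E\<^esub>"
proof -
  obtain a b where ab: "b \<in> B" "red b \<noteq> \<zero>\<^bsub>Q.D\<^esub>" "\<And>i. i \<in> W \<Longrightarrow> a i \<in> B" "\<And>i. i \<in> W \<Longrightarrow> z i = fraction P.D (a i) b"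
    using fp.common_denominator[OF W z] by auto
  note n = fp.denominator[OF ab(1,2)]
  have n': "b \<in> P.D.nonzero" "red b \<in> Q.D.nonzero" using n by auto
  have aD: "a i \<in> carrier P.D" if "i \<in> W" for i using fp.A_closed(3)[OF ab(3)[OF that]] .
  have aA: "a i m \<in> A" if "i \<in> W" for i m using ab(3)[OF that] by (auto simp: supported_def)
  have "\<forall>i\<in>W. \<exists>\<gamma>. \<gamma> \<in> carrier F \<and> c i = P.const \<gamma>" using c by (auto simp: P.regular_const_eq Pi_iff)
  then obtain \<gamma> where \<gamma>: "\<And>i. i \<in> W \<Longrightarrow> \<gamma> i \<in> carrier F" "\<And>i. i \<in> W \<Longrightarrow> c i = P.const (\<gamma> i)" by metis
  have ze: "c i \<otimes>\<^bsub>P.E\<^esub> z i = fraction P.D (P.F.indexed_const (\<gamma> i) \<otimes>\<^bsub>P.D\<^esub> a i) b" if i: "i \<in> W" for i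
    unfolding \<gamma>(2)[OF i] ab(4)[OF i] P.E_eq
    using P.D.frac_mult[OF P.F.const_closed[OF \<gamma>(1)[OF i]] P.D_one aD[OF i] n'(1)] n'(1) by simp
  have cm: "P.F.indexed_const u \<otimes>\<^bsub>P.D\<^esub> a i = (\<lambda>m. u \<otimes>\<^bsub>F\<^esub> a i m)" if "i \<in> W" "u \<in> carrier F" for i u
    by (rule P.F.const_mult[OF that(2) aD[OF that(1)]])
  have summand: "P.F.indexed_const u \<otimes>\<^bsub>P.D\<^esub> a i \<in> carrier P.D" if "i \<in> W" "u \<in> carrier F" for i u
    using P.F.const_closed[OF that(2)] aD[OF that(1)] by (rule P.D.m_closed)
  have "fraction P.D (finsum P.D (\<lambda>i. P.F.indexed_const (\<gamma> i) \<otimes>\<^bsub>P.D\<^esub> a i) W) b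
      = (\<Oplus>\<^bsub>P.E\<^esub>i\<in>W. fraction P.D (P.F.indexed_const (\<gamma> i) \<otimes>\<^bsub>P.D\<^esub> a i) b)"
    unfolding P.E_eq using summand \<gamma>(1) by (intro P.D.finsum_fraction[symmetric] n'(1)) auto
  also have "\<dots> = (\<Oplus>\<^bsub>P.E\<^esub>i\<in>W. c i \<otimes>\<^bsub>P.E\<^esub> z i)"
    unfolding P.E_eq using summand \<gamma>(1) ze P.D.frac_carrierI[OF _ n'(1)]
    by (intro P.E.finsum_cong'[unfolded P.E_eq] refl) (auto simp: P.E_eq)
  finally have "fraction P.D (finsum P.D (\<lambda>i. P.F.indexed_const (\<gamma> i) \<otimes>\<^bsub>P.D\<^esub> a i) W) b = \<zero>\<^bsub>P.E\<^esub>"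
    using rel by simp
  then have sum0: "finsum P.D (\<lambda>i. P.F.indexed_const (\<gamma> i) \<otimes>\<^bsub>P.D\<^esub> a i) W = \<zero>\<^bsub>P.D\<^esub>"
    unfolding P.E_eq using summand \<gamma>(1) by (subst (asm) P.D.frac_eq_zero_iff[OF _ n'(1)]) (auto intro!: P.D.finsum_closed)
  have sumF: "(\<Oplus>\<^bsub>F\<^esub>i\<in>W. \<gamma> i \<otimes>\<^bsub>F\<^esub> a i m) = \<zero>\<^bsub>F\<^esub>" for m
  proof -
    have "(\<Oplus>\<^bsub>F\<^esub>i\<in>W. \<gamma> i \<otimes>\<^bsub>F\<^esub> a i m) = (\<Oplus>\<^bsub>F\<^esub>i\<in>W. (P.F.indexed_const (\<gamma> i) \<otimes>\<^bsub>P.D\<^esub> a i) m)"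
      using \<gamma>(1) aA by (intro P.F.finsum_cong' refl) (auto simp: cm)
    also have "\<dots> = finsum P.D (\<lambda>i. P.F.indexed_const (\<gamma> i) \<otimes>\<^bsub>P.D\<^esub> a i) W m"
      using summand \<gamma>(1) by (intro P.F.mpoly_finsum[symmetric]) auto
    finally show ?thesis using sum0 by (simp add: P.F.mpoly_zero)
  qed
  have "\<gamma> j \<noteq> \<zero>\<^bsub>F\<^esub>" using j \<gamma>(2)[OF j(1)] P.const_eq_zero_iff[OF \<gamma>(1)[OF j(1)]] by simp
  then obtain \<pi> where \<pi>: "\<pi> \<in> carrier F \<rightarrow> T" "\<pi> (\<gamma> j) = \<one>\<^bsub>F\<^esub>"
    and \<pi>_add: "\<And>x y. x \<in> carrier F \<Longrightarrow> y \<in> carrier F \<Longrightarrow> \<pi> (x \<oplus>\<^bsub>F\<^esub> y) = \<pi> x \<oplus>\<^bsub>F\<^esub> \<pi> y"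
    and \<pi>_scale: "\<And>a x. a \<in> T \<Longrightarrow> x \<in> carrier F \<Longrightarrow> \<pi> (a \<otimes>\<^bsub>F\<^esub> x) = a \<otimes>\<^bsub>F\<^esub> \<pi> x"
    using P.F.linear_functional_exists[OF T(1) \<gamma>(1)[OF j(1)]] by blast
  note Ts = subringE[OF subfieldE(1)[OF T(1)]]
  have Tc: "x \<in> T \<Longrightarrow> x \<in> carrier F" for x using Ts(1) by auto
  have \<pi>c: "\<pi> x \<in> T" "\<pi> x \<in> carrier F" if "x \<in> carrier F" for x using \<pi>(1) that Tc by auto
  have \<pi>0: "\<pi> \<zero>\<^bsub>F\<^esub> = \<zero>\<^bsub>F\<^esub>" using \<pi>_scale[of "\<zero>\<^bsub>F\<^esub>" "\<zero>\<^bsub>F\<^esub>"] Ts(2) \<pi>c by simp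
  have \<pi>sum: "\<pi> (finsum F f W) = (\<Oplus>\<^bsub>F\<^esub>i\<in>W. \<pi> (f i))" if "f \<in> W \<rightarrow> carrier F" for f
    using W that
  proof (induction W)
    case (insert i W)
    then show ?case using \<pi>c by (subst P.F.finsum_insert, simp_all add: \<pi>_add P.F.finsum_insert Pi_iff)
  qed (simp add: \<pi>0)
  have "(\<lambda>i. \<pi> (\<gamma> i)) \<in> W \<rightarrow> T" using \<pi>c \<gamma>(1) by auto
  then obtain s where s: "s \<in> T" "\<forall>i\<in>W. s \<otimes>\<^bsub>F\<^esub> \<pi> (\<gamma> i) \<in> A" "\<exists>i\<in>W. s \<otimes>\<^bsub>F\<^esub> \<pi> (\<gamma> i) = \<one>\<^bsub>F\<^esub>"
    using P.F.scale_into_valuation_ring[OF subring_A T(2,1) val W, of "\<lambda>i. \<pi> (\<gamma> i)" j] j(1) \<pi>(2) by auto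
  define e where "e = (\<lambda>i. s \<otimes>\<^bsub>F\<^esub> \<pi> (\<gamma> i))"
  have eA: "e i \<in> A" if "i \<in> W" for i using s(2) that by (simp add: e_def)
  obtain i0 where i0: "i0 \<in> W" "e i0 = \<one>\<^bsub>F\<^esub>" using s(3) by (auto simp: e_def)
  have sume: "(\<Oplus>\<^bsub>F\<^esub>i\<in>W. e i \<otimes>\<^bsub>F\<^esub> a i m) = \<zero>\<^bsub>F\<^esub>" for m
  proof -
    have "\<zero>\<^bsub>F\<^esub> = \<pi> (\<Oplus>\<^bsub>F\<^esub>i\<in>W. \<gamma> i \<otimes>\<^bsub>F\<^esub> a i m)" unfolding sumF by (simp add: \<pi>0)
    also have "\<dots> = (\<Oplus>\<^bsub>F\<^esub>i\<in>W. \<pi> (\<gamma> i \<otimes>\<^bsub>F\<^esub> a i m))" using \<gamma>(1) aA by (intro \<pi>sum) auto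
    also have "\<dots> = (\<Oplus>\<^bsub>F\<^esub>i\<in>W. \<pi> (\<gamma> i) \<otimes>\<^bsub>F\<^esub> a i m)"
    proof (rule P.F.finsum_cong'[OF refl])
      fix i assume i: "i \<in> W"
      have "\<gamma> i \<otimes>\<^bsub>F\<^esub> a i m = a i m \<otimes>\<^bsub>F\<^esub> \<gamma> i" using \<gamma>(1)[OF i] aA[OF i] by (simp add: P.F.m_comm)
      then show "\<pi> (\<gamma> i \<otimes>\<^bsub>F\<^esub> a i m) = \<pi> (\<gamma> i) \<otimes>\<^bsub>F\<^esub> a i m"
        using \<pi>_scale[of "a i m" "\<gamma> i"] aA[OF i, of m] T(2) \<gamma>(1)[OF i] \<pi>c[OF \<gamma>(1)[OF i]] by (auto simp: P.F.m_comm)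
    qed (use \<gamma>(1) \<pi>c aA in auto)
    finally have eq: "\<zero>\<^bsub>F\<^esub> = (\<Oplus>\<^bsub>F\<^esub>i\<in>W. \<pi> (\<gamma> i) \<otimes>\<^bsub>F\<^esub> a i m)" .
    have "s \<otimes>\<^bsub>F\<^esub> (\<Oplus>\<^bsub>F\<^esub>i\<in>W. \<pi> (\<gamma> i) \<otimes>\<^bsub>F\<^esub> a i m) = \<zero>\<^bsub>F\<^esub>"
      unfolding eq[symmetric] using Tc[OF s(1)] by simp
    moreover have "s \<otimes>\<^bsub>F\<^esub> (\<Oplus>\<^bsub>F\<^esub>i\<in>W. \<pi> (\<gamma> i) \<otimes>\<^bsub>F\<^esub> a i m)
        = (\<Oplus>\<^bsub>F\<^esub>i\<in>W. s \<otimes>\<^bsub>F\<^esub> (\<pi> (\<gamma> i) \<otimes>\<^bsub>F\<^esub> a i m))"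
      using Tc[OF s(1)] W \<gamma>(1) \<pi>c aA by (intro P.F.finsum_rdistr) auto
    moreover have "\<dots> = (\<Oplus>\<^bsub>F\<^esub>i\<in>W. e i \<otimes>\<^bsub>F\<^esub> a i m)"
      using Tc[OF s(1)] \<gamma>(1) \<pi>c aA by (intro P.F.finsum_cong'[OF refl]) (auto simp: e_def P.F.m_assoc)
    ultimately show ?thesis by simp
  qed
  have Bterm: "P.F.indexed_const (e i) \<otimes>\<^bsub>P.D\<^esub> a i \<in> B" if "i \<in> W" for i
    using fp.A_closed(6)[OF const_B[OF eA[OF that]] ab(3)[OF that]] .
  have "finsum P.D (\<lambda>i. P.F.indexed_const (e i) \<otimes>\<^bsub>P.D\<^esub> a i) W = \<zero>\<^bsub>P.D\<^esub>"
  proof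
    fix m
    have "finsum P.D (\<lambda>i. P.F.indexed_const (e i) \<otimes>\<^bsub>P.D\<^esub> a i) W m
        = (\<Oplus>\<^bsub>F\<^esub>i\<in>W. (P.F.indexed_const (e i) \<otimes>\<^bsub>P.D\<^esub> a i) m)"
      using summand eA A_closed(3) by (intro P.F.mpoly_finsum) auto
    also have "\<dots> = (\<Oplus>\<^bsub>F\<^esub>i\<in>W. e i \<otimes>\<^bsub>F\<^esub> a i m)"
      using eA aA by (intro P.F.finsum_cong'[OF refl]) (auto simp: cm)
    finally show "finsum P.D (\<lambda>i. P.F.indexed_const (e i) \<otimes>\<^bsub>P.D\<^esub> a i) W m = \<zero>\<^bsub>P.D\<^esub> m"
      using sume by (simp add: P.F.mpoly_zero)
  qed
  then have "red (finsum P.D (\<lambda>i. P.F.indexed_const (e i) \<otimes>\<^bsub>P.D\<^esub> a i) W) = \<zero>\<^bsub>Q.D\<^esub>"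
    using fp.hom_zero by simp
  moreover have "red (finsum P.D (\<lambda>i. P.F.indexed_const (e i) \<otimes>\<^bsub>P.D\<^esub> a i) W)
      = finsum Q.D (\<lambda>i. red (P.F.indexed_const (e i) \<otimes>\<^bsub>P.D\<^esub> a i)) W"
    using Bterm by (intro fp.hom_finsum) auto
  moreover have rc: "red (P.F.indexed_const (e i) \<otimes>\<^bsub>P.D\<^esub> a i) = Q.F.indexed_const (\<psi> (e i)) \<otimes>\<^bsub>Q.D\<^esub> red (a i)"
    if "i \<in> W" for i
    using fp.hom_mult[OF const_B[OF eA[OF that]] ab(3)[OF that]] red_const[OF eA[OF that]] by simp
  ultimately have Qsum: "finsum Q.D (\<lambda>i. Q.F.indexed_const (\<psi> (e i)) \<otimes>\<^bsub>Q.D\<^esub> red (a i)) W = \<zero>\<^bsub>Q.D\<^esub>"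
  proof -
    have "finsum Q.D (\<lambda>i. red (P.F.indexed_const (e i) \<otimes>\<^bsub>P.D\<^esub> a i)) W
        = finsum Q.D (\<lambda>i. Q.F.indexed_const (\<psi> (e i)) \<otimes>\<^bsub>Q.D\<^esub> red (a i)) W"
      using Bterm fp.hom_closed rc by (intro Q.D.finsum_cong'[OF refl]) (auto simp flip: rc)
    then show ?thesis
      using \<open>red (finsum P.D _ W) = \<zero>\<^bsub>Q.D\<^esub>\<close> \<open>red (finsum P.D _ W) = finsum Q.D _ W\<close> by simp
  qed
  define c' where "c' = (\<lambda>i. Q.const (\<psi> (e i)))"
  have ra: "red (a i) \<in> carrier Q.D" "Q.F.indexed_const (\<psi> (e i)) \<in> carrier Q.D" if "i \<in> W" for i
    using fp.hom_closed[OF ab(3)[OF that]] Q.F.const_closed[OF hom_closed[OF eA[OF that]]] by auto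
  have qe: "c' i \<otimes>\<^bsub>Q.E\<^esub> res (z i) = fraction Q.D (Q.F.indexed_const (\<psi> (e i)) \<otimes>\<^bsub>Q.D\<^esub> red (a i)) (red b)"
    if i: "i \<in> W" for i
    unfolding c'_def ab(4)[OF i] fp.residue_fraction[OF ab(3)[OF i] ab(1,2)] Q.E_eq
    using Q.D.frac_mult[OF ra(2)[OF i] Q.D_one ra(1)[OF i] n'(2)] n'(2) by simp
  have "(\<Oplus>\<^bsub>Q.E\<^esub>i\<in>W. c' i \<otimes>\<^bsub>Q.E\<^esub> res (z i))
      = (\<Oplus>\<^bsub>Q.E\<^esub>i\<in>W. fraction Q.D (Q.F.indexed_const (\<psi> (e i)) \<otimes>\<^bsub>Q.D\<^esub> red (a i)) (red b))"
    using ra qe Q.D.frac_carrierI[OF _ n'(2), folded Q.E_eq] by (intro Q.E.finsum_cong'[OF refl]) auto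
  also have "\<dots> = fraction Q.D (finsum Q.D (\<lambda>i. Q.F.indexed_const (\<psi> (e i)) \<otimes>\<^bsub>Q.D\<^esub> red (a i)) W) (red b)"
    unfolding Q.E_eq using ra by (intro Q.D.finsum_fraction n'(2)) auto
  also have "\<dots> = \<zero>\<^bsub>Q.E\<^esub>"
    unfolding Qsum Q.E_eq using Q.D.frac_eq_zero_iff[OF Q.D.zero_closed n'(2)] by simp
  finally have "(\<Oplus>\<^bsub>Q.E\<^esub>i\<in>W. c' i \<otimes>\<^bsub>Q.E\<^esub> res (z i)) = \<zero>\<^bsub>Q.E\<^esub>" .
  moreover have "c' \<in> W \<rightarrow> regular_const k H"
    unfolding Q.regular_const_eq c'_def using hom_closed eA by auto
  moreover have "c' i0 \<noteq> \<zero>\<^bsub>Q.E\<^esub>"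
    using Q.const_eq_zero_iff[of "\<psi> (e i0)"] i0 hom_one by (simp add: c'_def)
  ultimately show ?thesis using i0(1) by blast
qed

lemma trdeg_residue_field_le:
  assumes L: "subfield L P.E" "regular_const F G \<subseteq> L"
  shows "trdeg Q.E (regular_const k H) (res ` (L \<inter> V)) \<le> trdeg P.E (regular_const F G) L"
proof (rule pl.trdeg_residue_le[OF L(1) P.regular_const_subring L(2) Q.regular_const_subring])
  fix W z c i
  assume "finite W" "z \<in> W \<rightarrow> L \<inter> V" "c \<in> W \<rightarrow> regular_const F G"
    "(\<Oplus>\<^bsub>P.E\<^esub>i\<in>W. c i \<otimes>\<^bsub>P.E\<^esub> z i) = \<zero>\<^bsub>P.E\<^esub>" "i \<in> W" "c i \<noteq> \<zero>\<^bsub>P.E\<^esub>"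
  then show "\<exists>c'. c' \<in> W \<rightarrow> regular_const k H \<and> (\<exists>i\<in>W. c' i \<noteq> \<zero>\<^bsub>Q.E\<^esub>)
    \<and> (\<Oplus>\<^bsub>Q.E\<^esub>i\<in>W. c' i \<otimes>\<^bsub>Q.E\<^esub> res (z i)) = \<zero>\<^bsub>Q.E\<^esub>"
    by (intro relation_descends) auto
qed

end

section \<open>The inertia group of the Gauss valuation\<close>

lemma prime_power_if_unique_prime_divisor:
  fixes p n :: nat
  assumes n: "n > 0" and p: "Factorial_Ring.prime p" and only: "\<And>q. Factorial_Ring.prime q \<Longrightarrow> q dvd n \<Longrightarrow> q = p"
  shows "\<exists>j. n = p ^ j"
proof -
  obtain m where m: "n = p ^ multiplicity p n * m" "\<not> p dvd m"
    using multiplicity_decompose'[of n p] n p by (auto simp: prime_nat_iff)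
  have "m = 1"
  proof (rule ccontr)
    assume "m \<noteq> 1"
    then obtain q where q: "Factorial_Ring.prime q" "q dvd m" using prime_factor_nat by blast
    then have "q dvd n" using m(1) by (metis dvd_mult)
    then show False using only[OF q(1)] q(2) m(2) by simp
  qed
  then show ?thesis using m(1) by auto
qed

text \<open>
  With the identity on monomials, the fractions whose denominator does not reduce to \<open>0\<close> form on \<open>T(V)\<close> the Gauss
  extension of a valuation of \<open>T\<close>, the one given by the localisation of \<open>A\<close> at the kernel of \<open>\<psi>\<close>.
\<close>

locale gauss_valuation = valued_reduction F G k G A \<psi> "\<lambda>m. m" T
  for F :: "('a, 'm) ring_scheme" and G :: "('g, 'n) monoid_scheme"
    and k :: "('b, 'p) ring_scheme" and A \<psi> T
begin

lemma red_eq: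
  assumes "b \<in> B"
  shows "red b = (\<lambda>m. \<psi> (b m))"
proof -
  have b: "finite {m. b m \<noteq> \<zero>\<^bsub>F\<^esub>}" "\<And>m. b m \<in> A" using assms by (auto simp: supported_def)
  have "\<psi> (b m) \<noteq> \<zero>\<^bsub>k\<^esub> \<Longrightarrow> m \<in> {m. b m \<noteq> \<zero>\<^bsub>F\<^esub>}" for m using hom_zero by auto
  then show ?thesis unfolding mpoly_map_def using b hom_closed by (intro Q.F.collect_self) auto
qed

lemma scale_polynomial:
  assumes a: "supported F (carrier G) T a" "a \<noteq> \<zero>\<^bsub>P.D\<^esub>"
  obtains s where "s \<in> T" "s \<noteq> \<zero>\<^bsub>F\<^esub>" "P.F.indexed_const s \<otimes>\<^bsub>P.D\<^esub> a \<in> B"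
    "red (P.F.indexed_const s \<otimes>\<^bsub>P.D\<^esub> a) \<noteq> \<zero>\<^bsub>Q.D\<^esub>"
proof -
  have Tc: "T \<subseteq> carrier F" using subringE(1)[OF subfieldE(1)[OF T(1)]] .
  let ?W = "{m. a m \<noteq> \<zero>\<^bsub>F\<^esub>}"
  have W: "finite ?W" "a \<in> ?W \<rightarrow> T" "\<And>m. a m \<in> T" "\<And>m. m \<in> ?W \<Longrightarrow> set_mset m \<subseteq> carrier G"
    using a(1) by (auto simp: supported_def)
  obtain j where j: "a j \<noteq> \<zero>\<^bsub>F\<^esub>" using a(2) by (auto simp: P.F.mpoly_zero fun_eq_iff)
  obtain s i where s: "s \<in> T" "s \<noteq> \<zero>\<^bsub>F\<^esub>" "\<And>m. m \<in> ?W \<Longrightarrow> s \<otimes>\<^bsub>F\<^esub> a m \<in> A" "s \<otimes>\<^bsub>F\<^esub> a i = \<one>\<^bsub>F\<^esub>"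
    using P.F.scale_into_valuation_ring[OF subring_A T(2,1) val W(1,2), of j] j by auto
  have aD: "a \<in> carrier P.D" using a(1) Tc by (auto simp: P.D_carrier supported_def)
  have sc: "s \<in> carrier F" "a m \<in> carrier F" for m using s(1) W(3) Tc by auto
  have eq: "P.F.indexed_const s \<otimes>\<^bsub>P.D\<^esub> a = (\<lambda>m. s \<otimes>\<^bsub>F\<^esub> a m)" by (rule P.F.const_mult[OF sc(1) aD])
  have sA: "s \<otimes>\<^bsub>F\<^esub> a m \<in> A" for m using s(3)[of m] sc by (cases "a m = \<zero>\<^bsub>F\<^esub>") auto
  have sB: "(\<lambda>m. s \<otimes>\<^bsub>F\<^esub> a m) \<in> B"
    unfolding mem_Collect_eq supported_def
  proof (intro conjI allI impI)
    show "finite {m. s \<otimes>\<^bsub>F\<^esub> a m \<noteq> \<zero>\<^bsub>F\<^esub>}" by (rule finite_subset[OF _ W(1)]) (use sc in auto)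
    show "range (\<lambda>m. s \<otimes>\<^bsub>F\<^esub> a m) \<subseteq> A" using sA by auto
    show "set_mset m \<subseteq> carrier G" if "s \<otimes>\<^bsub>F\<^esub> a m \<noteq> \<zero>\<^bsub>F\<^esub>" for m using that W(4)[of m] sc by fastforce
  qed
  have "red (\<lambda>m. s \<otimes>\<^bsub>F\<^esub> a m) i \<noteq> \<zero>\<^bsub>k\<^esub>" unfolding red_eq[OF sB] s(4) hom_one by simp
  then show thesis using that[OF s(1,2)] sB unfolding eq by (metis Q.F.mpoly_zero)
qed

text \<open>
  Every value of the Gauss valuation is taken by a constant: scale numerator and denominator by constants until
  both have coefficients in \<open>A\<close> and neither reduces to \<open>0\<close>.
\<close>

lemma constant_times_unit:
  assumes x: "x = fraction P.D a b" "x \<noteq> \<zero>\<^bsub>P.E\<^esub>"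
    and a: "supported F (carrier G) T a" and b: "supported F (carrier G) T b" "b \<noteq> \<zero>\<^bsub>P.D\<^esub>"
  obtains c u where "c \<in> carrier F" "c \<noteq> \<zero>\<^bsub>F\<^esub>" "u \<in> V" "res u \<noteq> \<zero>\<^bsub>Q.E\<^esub>" "x = P.const c \<otimes>\<^bsub>P.E\<^esub> u"
proof -
  have Tc: "T \<subseteq> carrier F" using subringE(1)[OF subfieldE(1)[OF T(1)]] .
  have D: "a \<in> carrier P.D" "b \<in> carrier P.D" using a b(1) Tc by (auto simp: P.D_carrier supported_def)
  have a0: "a \<noteq> \<zero>\<^bsub>P.D\<^esub>" using x D b(2) P.D.frac_eq_zero_iff[of a b] by (auto simp: P.E_eq)
  obtain s where s: "s \<in> T" "s \<noteq> \<zero>\<^bsub>F\<^esub>" "P.F.indexed_const s \<otimes>\<^bsub>P.D\<^esub> a \<in> B"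
    "red (P.F.indexed_const s \<otimes>\<^bsub>P.D\<^esub> a) \<noteq> \<zero>\<^bsub>Q.D\<^esub>" using scale_polynomial[OF a a0] by metis
  obtain t where t: "t \<in> T" "t \<noteq> \<zero>\<^bsub>F\<^esub>" "P.F.indexed_const t \<otimes>\<^bsub>P.D\<^esub> b \<in> B"
    "red (P.F.indexed_const t \<otimes>\<^bsub>P.D\<^esub> b) \<noteq> \<zero>\<^bsub>Q.D\<^esub>" using scale_polynomial[OF b] by metis
  define sa where "sa = P.F.indexed_const s \<otimes>\<^bsub>P.D\<^esub> a"
  define tb where "tb = P.F.indexed_const t \<otimes>\<^bsub>P.D\<^esub> b"
  note sat = s(3,4)[folded sa_def] t(3,4)[folded tb_def]
  define u where "u = fraction P.D sa tb"
  have st: "s \<in> carrier F" "t \<in> carrier F" "inv\<^bsub>F\<^esub> s \<in> carrier F" "s \<otimes>\<^bsub>F\<^esub> inv\<^bsub>F\<^esub> s = \<one>\<^bsub>F\<^esub>"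
    using s t Tc P.F.field_Units by auto
  define c where "c = t \<otimes>\<^bsub>F\<^esub> inv\<^bsub>F\<^esub> s"
  have c: "c \<in> carrier F" "c \<otimes>\<^bsub>F\<^esub> s = t"
    using st P.F.m_comm[OF st(1,3)] by (auto simp: c_def P.F.m_assoc)
  have c0: "c \<noteq> \<zero>\<^bsub>F\<^esub>" using c(2) t(2) st(1) by auto
  have nz: "sa \<in> P.D.nonzero" "tb \<in> P.D.nonzero" "red sa \<in> Q.D.nonzero" "red tb \<in> Q.D.nonzero"
    using fp.denominator[OF sat(1,2)] fp.denominator[OF sat(3,4)] by auto
  have pc: "P.F.indexed_const y \<in> carrier P.D" if "y \<in> carrier F" for y using P.F.const_closed[OF that] .
  interpret c: subring_hom F P.D "carrier F" P.F.indexed_const by (rule P.F.const_subring_hom)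
  have csa: "P.F.indexed_const c \<otimes>\<^bsub>P.D\<^esub> sa = P.F.indexed_const t \<otimes>\<^bsub>P.D\<^esub> a"
    using c st D pc by (simp add: sa_def P.D.m_assoc[symmetric] c.hom_mult[symmetric])
  have "P.const c \<otimes>\<^bsub>P.E\<^esub> u = fraction P.D (P.F.indexed_const c \<otimes>\<^bsub>P.D\<^esub> sa) (\<one>\<^bsub>P.D\<^esub> \<otimes>\<^bsub>P.D\<^esub> tb)"
    unfolding u_def P.E_eq using pc[OF c(1)] nz by (intro P.D.frac_mult P.D_one) auto
  also have "\<dots> = fraction P.D a b"
  proof (subst P.D.fraction_eq_iff)
    show "P.F.indexed_const c \<otimes>\<^bsub>P.D\<^esub> sa \<otimes>\<^bsub>P.D\<^esub> b = a \<otimes>\<^bsub>P.D\<^esub> (\<one>\<^bsub>P.D\<^esub> \<otimes>\<^bsub>P.D\<^esub> tb)"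
      unfolding csa tb_def using D pc st by (simp add: P.D.m_ac)
  qed (use pc[OF c(1)] nz D b(2) in auto)
  finally have "x = P.const c \<otimes>\<^bsub>P.E\<^esub> u" using x(1) by simp
  moreover have "u \<in> V" unfolding u_def by (rule fp.localizationI[OF sat(1,3,4)])
  moreover have "res u \<noteq> \<zero>\<^bsub>Q.E\<^esub>"
    unfolding u_def fp.residue_fraction[OF sat(1,3,4)] Q.E_eq using nz by (subst Q.D.frac_eq_zero_iff) auto
  ultimately show thesis using that c(1) c0 by blast
qed

text \<open>
  The identity on coefficients in \<open>T\<close> reduces no nonzero polynomial to \<open>0\<close>.  The ring of its integral fractions is therefore the
  field \<open>T(V)\<close>, and the laws of reductions show that this is a subring stable under \<open>G\<close>.
\<close>

lemma reduction_over_T: "reduction F G F G T (\<lambda>a. a) (\<lambda>m. m)"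
proof -
  have "subring_hom F F T (\<lambda>a. a)"
    using subringE(1)[OF subfieldE(1)[OF T(1)]]
    by (intro subring_hom.subring_hom_subset[OF P.F.id_subring_hom] subfieldE(1)[OF T(1)])
  then show ?thesis
    by (intro reduction.intro P.regular_rep_axioms reduction_axioms.intro) auto
qed

sublocale rT: reduction F G F G T "\<lambda>a. a" "\<lambda>m. m" by (rule reduction_over_T)

lemma rT_V_iff: "x \<in> rT.V \<longleftrightarrow> (\<exists>a b. supported F (carrier G) T a \<and> supported F (carrier G) T b \<and> b \<noteq> \<zero>\<^bsub>P.D\<^esub> \<and> x = fraction P.D a b)"
proof -
  have "rT.red b = b" if "supported F (carrier G) T b" for b
    using mpoly_map_id[OF P.F.is_cring rT.supported_carrier[OF that]] by simp
  then show ?thesis unfolding rT.fp.localization_def by auto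
qed

definition inertia where
  "inertia L = {g \<in> carrier G. \<forall>x\<in>L \<inter> V. res (P.act g x) = res x}"

text \<open>
  The residue map is equivariant, so \<open>inertia L\<close> is the kernel of the action of \<open>G\<close> on the residue field of \<open>L\<close>.
\<close>

lemma inertia_normal:
  assumes L: "L \<subseteq> carrier P.E" "\<And>g x. g \<in> carrier G \<Longrightarrow> x \<in> L \<Longrightarrow> P.act g x \<in> L"
  shows "inertia L \<lhd> G"
proof -
  have LV: "P.act g x \<in> L \<inter> V" and req: "res (P.act g x) = Q.act g (res x)"
    if "g \<in> carrier G" "x \<in> L \<inter> V" for g x
    using residue_equivariant[OF that(1) that(1)] that L(2) by auto
  have Lc: "x \<in> L \<Longrightarrow> x \<in> carrier P.E" for x using L(1) by auto
  have sub: "subgroup (inertia L) G"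
  proof (rule P.G.subgroupI)
    show "inertia L \<subseteq> carrier G" by (auto simp: inertia_def)
    have "\<one>\<^bsub>G\<^esub> \<in> inertia L" using P.act_one Lc by (auto simp: inertia_def)
    then show "inertia L \<noteq> {}" by blast
    fix g assume g: "g \<in> inertia L"
    then have gc: "g \<in> carrier G" by (auto simp: inertia_def)
    show "inv\<^bsub>G\<^esub> g \<in> inertia L"
      unfolding inertia_def
    proof (intro CollectI conjI ballI)
      fix x assume x: "x \<in> L \<inter> V"
      have "res (P.act (inv\<^bsub>G\<^esub> g) x) = res (P.act g (P.act (inv\<^bsub>G\<^esub> g) x))"
        using g LV[of "inv\<^bsub>G\<^esub> g" x] gc x by (auto simp: inertia_def)
      then show "res (P.act (inv\<^bsub>G\<^esub> g) x) = res x" using P.act_inv[OF gc, of x] x Lc by auto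
    qed (use gc in auto)
    fix h assume h: "h \<in> inertia L"
    then have hc: "h \<in> carrier G" by (auto simp: inertia_def)
    show "g \<otimes>\<^bsub>G\<^esub> h \<in> inertia L"
      unfolding inertia_def
    proof (intro CollectI conjI ballI)
      fix x assume x: "x \<in> L \<inter> V"
      have "res (P.act (g \<otimes>\<^bsub>G\<^esub> h) x) = res (P.act g (P.act h x))" using P.act_comp[OF gc hc] x Lc by auto
      also have "\<dots> = res (P.act h x)" using g LV[OF hc x] by (auto simp: inertia_def)
      also have "\<dots> = res x" using h x by (auto simp: inertia_def)
      finally show "res (P.act (g \<otimes>\<^bsub>G\<^esub> h) x) = res x" .
    qed (use gc hc in auto)
  qed
  show ?thesis
    unfolding P.G.normal_inv_iff
  proof (intro conjI sub ballI)
    fix h g assume h: "h \<in> carrier G" and g: "g \<in> inertia L"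
    then have gc: "g \<in> carrier G" by (auto simp: inertia_def)
    show "h \<otimes>\<^bsub>G\<^esub> g \<otimes>\<^bsub>G\<^esub> inv\<^bsub>G\<^esub> h \<in> inertia L"
      unfolding inertia_def
    proof (intro CollectI conjI ballI)
      fix x assume x: "x \<in> L \<inter> V"
      let ?y = "P.act (inv\<^bsub>G\<^esub> h) x"
      have y: "?y \<in> L \<inter> V" using LV[of "inv\<^bsub>G\<^esub> h" x] h x by auto
      have "P.act (h \<otimes>\<^bsub>G\<^esub> g \<otimes>\<^bsub>G\<^esub> inv\<^bsub>G\<^esub> h) x = P.act h (P.act g ?y)"
        using P.act_comp[of h g ?y] P.act_comp[of "h \<otimes>\<^bsub>G\<^esub> g" "inv\<^bsub>G\<^esub> h" x] h gc x y Lc by simp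
      then have "res (P.act (h \<otimes>\<^bsub>G\<^esub> g \<otimes>\<^bsub>G\<^esub> inv\<^bsub>G\<^esub> h) x) = Q.act h (res (P.act g ?y))"
        using req[OF h LV[OF gc y]] by simp
      also have "res (P.act g ?y) = res ?y" using g y by (auto simp: inertia_def)
      also have "Q.act h (res ?y) = res (P.act h ?y)" using req[OF h y] by simp
      also have "P.act h ?y = x" using P.act_inv(1)[OF h, of x] x Lc by auto
      finally show "res (P.act (h \<otimes>\<^bsub>G\<^esub> g \<otimes>\<^bsub>G\<^esub> inv\<^bsub>G\<^esub> h) x) = res x" .
    qed (use h gc in auto)
  qed
qed

text \<open>
  Let \<open>J\<close> be a subgroup of order \<open>q\<close> of the inertia group, \<open>g \<noteq> 1\<close> in \<open>J\<close>, and \<open>x = g f - f \<noteq> 0\<close> with \<open>f \<in> L \<inter> T(V)\<close>.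
  The sum of \<open>h x\<close> over \<open>h \<in> J\<close> is \<open>0\<close>, because \<open>h \<mapsto> h g\<close> permutes \<open>J\<close>.  Write \<open>x = c u\<close> with a constant \<open>c\<close> and a unit \<open>u\<close>; as \<open>G\<close> fixes \<open>c\<close>, also the
  sum of \<open>h u\<close> vanishes.  But each \<open>h u\<close> has the residue of \<open>u\<close>, hence \<open>q\<close> times this nonzero residue is \<open>0\<close>, and
  \<open>q\<close> is the characteristic \<open>p\<close>.
\<close>

lemma inertia_prime_divisor:
  fixes p q :: nat
  assumes L: "subfield L P.E" "regular_const F G \<subseteq> L" "\<And>g x. g \<in> carrier G \<Longrightarrow> x \<in> L \<Longrightarrow> P.act g x \<in> L"
    and faithful: "\<And>g. g \<in> carrier G \<Longrightarrow> g \<noteq> \<one>\<^bsub>G\<^esub> \<Longrightarrow> \<exists>f\<in>L \<inter> rT.V. P.act g f \<noteq> f"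
    and p: "Factorial_Ring.prime p" "ring_char k = p"
    and q: "Factorial_Ring.prime q" "q dvd card (inertia L)"
  shows "q = p"
proof (rule ccontr)
  assume qp: "q \<noteq> p"
  note Ls = subringE[OF subfieldE(1)[OF L(1)]]
  have Lc: "x \<in> L \<Longrightarrow> x \<in> carrier P.E" for x using Ls(1) by auto
  let ?I = "inertia L"
  have norm: "?I \<lhd> G" by (rule inertia_normal[OF Ls(1) L(3)])
  have subI: "subgroup ?I G" using normal_imp_subgroup[OF norm] .
  let ?GI = "G\<lparr>carrier := ?I\<rparr>"
  have finI: "finite ?I" using P.finite_G by (auto simp: inertia_def)
  obtain r where r: "card ?I = q * r" using q(2) by auto
  obtain J where J: "subgroup J ?GI" "card J = q"
    using sylow_thm[of q ?GI 1 r] q(1) P.G.subgroup_imp_group[OF subI] r finI by (auto simp: order_def)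
  have JI: "J \<subseteq> ?I" using subgroup.subset[OF J(1)] by simp
  have JG: "subgroup J G" by (rule P.G.incl_subgroup[OF subI J(1)])
  have Jc: "h \<in> J \<Longrightarrow> h \<in> carrier G" for h using subgroup.subset[OF JG] by auto
  have finJ: "finite J" using JI finI finite_subset by blast
  have "\<exists>g\<in>J. g \<noteq> \<one>\<^bsub>G\<^esub>"
  proof (rule ccontr)
    assume "\<not> (\<exists>g\<in>J. g \<noteq> \<one>\<^bsub>G\<^esub>)"
    then have "J \<subseteq> {\<one>\<^bsub>G\<^esub>}" by auto
    then have "card J \<le> 1" using card_mono[of "{\<one>\<^bsub>G\<^esub>}" J] by simp
    then show False using J(2) prime_gt_1_nat[OF q(1)] by simp
  qed
  then obtain g where g: "g \<in> J" "g \<noteq> \<one>\<^bsub>G\<^esub>" by blast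
  note gc = Jc[OF g(1)]
  obtain f where f: "f \<in> L" "f \<in> rT.V" "P.act g f \<noteq> f" using faithful[OF gc g(2)] by blast
  have fc: "f \<in> carrier P.E" "P.act g f \<in> carrier P.E" using Lc[OF f(1)] P.act_closed[OF gc] by auto
  define x where "x = P.act g f \<ominus>\<^bsub>P.E\<^esub> f"
  have xL: "x \<in> L" unfolding x_def P.E.minus_eq using Ls(5,7) L(3)[OF gc f(1)] f(1) by auto
  have xc: "x \<in> carrier P.E" using Lc[OF xL] .
  have xf: "x \<oplus>\<^bsub>P.E\<^esub> f = P.act g f" using fc by (simp add: x_def P.E.minus_eq P.E.a_assoc P.E.l_neg)
  have x0: "x \<noteq> \<zero>\<^bsub>P.E\<^esub>" using f(3) fc by (simp add: x_def P.E.r_right_minus_eq)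
  have "x \<in> rT.V"
    unfolding x_def P.E.minus_eq
    using rT.pl.A_closed(4)[OF f(2)] rT.pl.A_closed(5) rT.residue_equivariant(1)[OF gc gc _ f(2)] by simp
  then obtain a b where xab: "x = fraction P.D a b" "supported F (carrier G) T a" "supported F (carrier G) T b"
    "b \<noteq> \<zero>\<^bsub>P.D\<^esub>" using rT_V_iff by blast
  obtain c u where cu: "c \<in> carrier F" "c \<noteq> \<zero>\<^bsub>F\<^esub>" "u \<in> V" "res u \<noteq> \<zero>\<^bsub>Q.E\<^esub>" "x = P.const c \<otimes>\<^bsub>P.E\<^esub> u"
    by (rule constant_times_unit[OF xab(1) x0 xab(2-4)])
  have uc: "u \<in> carrier P.E" using pl.A_closed(3)[OF cu(3)] .
  have cc: "P.const c \<in> carrier P.E" "P.const c \<noteq> \<zero>\<^bsub>P.E\<^esub>" "P.const c \<in> L"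
  proof -
    show "P.const c \<in> carrier P.E" by (rule subring_hom.hom_closed[OF P.const_hom cu(1)])
    show "P.const c \<noteq> \<zero>\<^bsub>P.E\<^esub>" using P.const_eq_zero_iff[OF cu(1)] cu(2) by blast
    have "P.const c \<in> regular_const F G" unfolding P.regular_const_eq by (rule imageI[OF cu(1)])
    then show "P.const c \<in> L" using L(2) by (rule subsetD[rotated])
  qed
  have uL: "u \<in> L"
  proof -
    have i: "inv\<^bsub>P.E\<^esub> (P.const c) \<in> L" "inv\<^bsub>P.E\<^esub> (P.const c) \<otimes>\<^bsub>P.E\<^esub> P.const c = \<one>\<^bsub>P.E\<^esub>"
      using P.E.subfield_m_inv(1)[OF L(1), of "P.const c"] cc P.E.field_Units by auto
    have "inv\<^bsub>P.E\<^esub> (P.const c) \<otimes>\<^bsub>P.E\<^esub> x = u"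
      unfolding cu(5) using i Lc[OF i(1)] cc(1) uc by (simp add: P.E.m_assoc[symmetric])
    then show ?thesis using Ls(6)[OF i(1) xL] by simp
  qed
  have sumx: "(\<Oplus>\<^bsub>P.E\<^esub>h\<in>J. P.act h x) = \<zero>\<^bsub>P.E\<^esub>"
  proof -
    have cl: "P.act h y \<in> carrier P.E" if "h \<in> J" "y \<in> carrier P.E" for h y using P.act_closed Jc that by auto
    have S: "(\<Oplus>\<^bsub>P.E\<^esub>h\<in>J. P.act h f) \<in> carrier P.E" "(\<Oplus>\<^bsub>P.E\<^esub>h\<in>J. P.act h x) \<in> carrier P.E"
      using cl fc xc by (auto intro!: P.E.finsum_closed)
    have im: "(\<lambda>h. h \<otimes>\<^bsub>G\<^esub> g) ` J = J"
    proof (rule equalityI)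
      show "(\<lambda>h. h \<otimes>\<^bsub>G\<^esub> g) ` J \<subseteq> J" using subgroup.m_closed[OF JG _ g(1)] by auto
      show "J \<subseteq> (\<lambda>h. h \<otimes>\<^bsub>G\<^esub> g) ` J"
      proof
        fix h assume h: "h \<in> J"
        have "h \<otimes>\<^bsub>G\<^esub> inv\<^bsub>G\<^esub> g \<in> J" using subgroup.m_closed[OF JG h subgroup.m_inv_closed[OF JG g(1)]] .
        moreover have "h = h \<otimes>\<^bsub>G\<^esub> inv\<^bsub>G\<^esub> g \<otimes>\<^bsub>G\<^esub> g" using Jc[OF h] gc by (simp add: P.G.m_assoc)
        ultimately show "h \<in> (\<lambda>h. h \<otimes>\<^bsub>G\<^esub> g) ` J" by blast
      qed
    qed
    have inj: "inj_on (\<lambda>h. h \<otimes>\<^bsub>G\<^esub> g) J" using Jc gc by (intro inj_onI) (metis P.G.r_cancel)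
    have "(\<Oplus>\<^bsub>P.E\<^esub>h\<in>J. P.act h f) = (\<Oplus>\<^bsub>P.E\<^esub>h\<in>(\<lambda>h. h \<otimes>\<^bsub>G\<^esub> g) ` J. P.act h f)" by (simp only: im)
    also have "\<dots> = (\<Oplus>\<^bsub>P.E\<^esub>h\<in>J. P.act (h \<otimes>\<^bsub>G\<^esub> g) f)"
      using cl fc im by (intro P.E.finsum_reindex inj) auto
    also have "\<dots> = (\<Oplus>\<^bsub>P.E\<^esub>h\<in>J. P.act h x \<oplus>\<^bsub>P.E\<^esub> P.act h f)"
    proof (rule P.E.finsum_cong'[OF refl])
      fix h assume h: "h \<in> J"
      interpret a: subring_hom P.E P.E "carrier P.E" "P.act h" by (rule P.act_subring_hom[OF Jc[OF h]])
      show "P.act (h \<otimes>\<^bsub>G\<^esub> g) f = P.act h x \<oplus>\<^bsub>P.E\<^esub> P.act h f"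
        using a.hom_add[OF xc fc(1)] xf P.act_comp[OF Jc[OF h] gc fc(1)] by simp
    qed (use cl fc xc in auto)
    also have "\<dots> = (\<Oplus>\<^bsub>P.E\<^esub>h\<in>J. P.act h x) \<oplus>\<^bsub>P.E\<^esub> (\<Oplus>\<^bsub>P.E\<^esub>h\<in>J. P.act h f)"
      using cl fc xc by (intro P.E.finsum_addf) auto
    finally show ?thesis using S P.E.add.r_cancel_one' by metis
  qed
  have uV: "P.act h u \<in> V" "P.act h u \<in> carrier P.E" if "h \<in> J" for h
    using residue_equivariant(1)[OF Jc[OF that] Jc[OF that] _ cu(3)] pl.A_closed(3) by auto
  have "(\<Oplus>\<^bsub>P.E\<^esub>h\<in>J. P.act h x) = (\<Oplus>\<^bsub>P.E\<^esub>h\<in>J. P.const c \<otimes>\<^bsub>P.E\<^esub> P.act h u)"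
  proof (rule P.E.finsum_cong'[OF refl])
    fix h assume h: "h \<in> J"
    interpret a: subring_hom P.E P.E "carrier P.E" "P.act h" by (rule P.act_subring_hom[OF Jc[OF h]])
    show "P.act h x = P.const c \<otimes>\<^bsub>P.E\<^esub> P.act h u"
      unfolding cu(5) using a.hom_mult[OF cc(1) uc] P.act_const[OF Jc[OF h] cu(1)] by simp
  qed (use cc uV in auto)
  also have "\<dots> = P.const c \<otimes>\<^bsub>P.E\<^esub> (\<Oplus>\<^bsub>P.E\<^esub>h\<in>J. P.act h u)"
    using finJ cc uV by (intro P.E.finsum_rdistr[symmetric]) auto
  finally have "P.const c \<otimes>\<^bsub>P.E\<^esub> (\<Oplus>\<^bsub>P.E\<^esub>h\<in>J. P.act h u) = \<zero>\<^bsub>P.E\<^esub>" using sumx by simp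
  moreover have "(\<Oplus>\<^bsub>P.E\<^esub>h\<in>J. P.act h u) \<in> carrier P.E" using uV by (auto intro!: P.E.finsum_closed)
  ultimately have "(\<Oplus>\<^bsub>P.E\<^esub>h\<in>J. P.act h u) = \<zero>\<^bsub>P.E\<^esub>" using cc P.E.integral_iff by blast
  then have "\<zero>\<^bsub>Q.E\<^esub> = res (\<Oplus>\<^bsub>P.E\<^esub>h\<in>J. P.act h u)" using pl.hom_zero by simp
  also have "\<dots> = (\<Oplus>\<^bsub>Q.E\<^esub>h\<in>J. res (P.act h u))" using uV by (intro pl.hom_finsum) auto
  also have "\<dots> = (\<Oplus>\<^bsub>Q.E\<^esub>h\<in>J. res u)"
    using JI uL cu(3) pl.hom_closed[OF cu(3)] by (intro Q.E.finsum_cong'[OF refl]) (auto simp: inertia_def)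
  also have "\<dots> = add_pow Q.E q (res u)" using Q.E.add.finprod_const[OF pl.hom_closed[OF cu(3)], of J] J(2) by simp
  finally have qz: "add_pow Q.E q (res u) = \<zero>\<^bsub>Q.E\<^esub>" by simp
  have ru: "res u \<in> carrier Q.E" by (rule pl.hom_closed[OF cu(3)])
  have pz: "add_pow Q.E p (res u) = \<zero>\<^bsub>Q.E\<^esub>"
  proof -
    interpret c: subring_hom k Q.E "carrier k" "\<lambda>c. Q.const c" by (rule Q.const_hom)
    have "add_pow k p \<one>\<^bsub>k\<^esub> = \<zero>\<^bsub>k\<^esub>"
      using group.pow_ord_eq_1[OF Q.F.a_group, of "\<one>\<^bsub>k\<^esub>"] p(2) by (simp add: ring_char_def add_pow_def)
    then have "add_pow Q.E p \<one>\<^bsub>Q.E\<^esub> = \<zero>\<^bsub>Q.E\<^esub>"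
      using c.hom_add_pow[of "\<one>\<^bsub>k\<^esub>" p] c.hom_one c.hom_zero by simp
    then show ?thesis using Q.E.add_pow_ldistr[of "\<one>\<^bsub>Q.E\<^esub>" "res u" p] ru by simp
  qed
  have "group.ord (add_monoid Q.E) (res u) dvd q" "group.ord (add_monoid Q.E) (res u) dvd p"
    using group.pow_eq_id[OF Q.E.a_group, of "res u"] ru qz pz by (auto simp: add_pow_def)
  then have "group.ord (add_monoid Q.E) (res u) = 1"
    using p(1) q(1) qp by (metis prime_nat_iff)
  then show False using group.ord_eq_1[OF Q.E.a_group, of "res u"] ru cu(4) by simp
qed

lemma inertia_trivial:
  fixes p :: nat
  assumes L: "subfield L P.E" "regular_const F G \<subseteq> L" "\<And>g x. g \<in> carrier G \<Longrightarrow> x \<in> L \<Longrightarrow> P.act g x \<in> L"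
    and faithful: "\<And>g. g \<in> carrier G \<Longrightarrow> g \<noteq> \<one>\<^bsub>G\<^esub> \<Longrightarrow> \<exists>f\<in>L \<inter> rT.V. P.act g f \<noteq> f"
    and p: "Factorial_Ring.prime p" "ring_char k = p" "weakly_tame p G"
  shows "inertia L = {\<one>\<^bsub>G\<^esub>}"
proof -
  have norm: "inertia L \<lhd> G"
    by (rule inertia_normal[OF subringE(1)[OF subfieldE(1)[OF L(1)]] L(3)])
  have "\<one>\<^bsub>G\<^esub> \<in> inertia L" using subgroup.one_closed[OF normal_imp_subgroup[OF norm]] .
  moreover have "finite (inertia L)" using P.finite_G by (auto simp: inertia_def)
  ultimately have "card (inertia L) > 0" by (auto simp: card_gt_0_iff)
  then have "\<exists>j. card (inertia L) = p ^ j"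
    using prime_power_if_unique_prime_divisor[OF _ p(1)] inertia_prime_divisor[OF L faithful p(1,2)] by blast
  then show ?thesis using p(3) norm by (simp add: weakly_tame_def)
qed

end

section \<open>Restriction to a subgroup\<close>

text \<open>
  Every \<open>x \<in> G\<close> is uniquely \<open>\<iota> (d x) \<otimes> t x\<close>, where \<open>t x\<close> represents the coset of \<open>x\<close>.  The collapse replaces the variable \<open>x\<close> by
  the power \<open>N ^ e (t x)\<close> of the variable \<open>d x\<close>, where \<open>e\<close> numbers \<open>G\<close>.  It is equivariant since multiplying \<open>x\<close> by \<open>\<iota> h\<close>
  changes \<open>d x\<close> to \<open>h \<otimes> d x\<close> and keeps \<open>t x\<close>.  The multiplicity of \<open>j\<close> in the collapse of \<open>m\<close> is the weight of the part
  of \<open>m\<close> where \<open>d x = j\<close>; so this part can be recovered from its digits in base \<open>N\<close>.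
\<close>

lemma equivariant_collapse_exists:
  assumes G: "group G" and H: "group H" and fin: "finite (carrier G)"
    and \<iota>: "\<iota> \<in> hom H G" "inj_on \<iota> (carrier H)"
  obtains \<sigma> :: "nat \<Rightarrow> 'g multiset \<Rightarrow> 'h multiset"
  where "\<And>N. \<sigma> N {#} = {#}" "\<And>N a b. \<sigma> N (a + b) = \<sigma> N a + \<sigma> N b"
    "\<And>N m. set_mset m \<subseteq> carrier G \<Longrightarrow> set_mset (\<sigma> N m) \<subseteq> carrier H"
    "\<And>N h m. h \<in> carrier H \<Longrightarrow> set_mset m \<subseteq> carrier G \<Longrightarrow>
      \<sigma> N (image_mset (\<lambda>x. \<iota> h \<otimes>\<^bsub>G\<^esub> x) m) = image_mset (\<lambda>x. h \<otimes>\<^bsub>H\<^esub> x) (\<sigma> N m)"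
    "\<And>N m m'. set_mset m \<subseteq> carrier G \<Longrightarrow> set_mset m' \<subseteq> carrier G \<Longrightarrow> size m < N \<Longrightarrow> size m' < N \<Longrightarrow>
      \<sigma> N m = \<sigma> N m' \<Longrightarrow> m = m'"
proof -
  interpret G: group G by fact
  interpret H: group H by fact
  have \<iota>c: "\<iota> h \<in> carrier G" if "h \<in> carrier H" for h using hom_in_carrier[OF \<iota>(1) that] .
  have \<iota>m: "\<iota> (h \<otimes>\<^bsub>H\<^esub> h') = \<iota> h \<otimes>\<^bsub>G\<^esub> \<iota> h'" if "h \<in> carrier H" "h' \<in> carrier H" for h h'
    using Group.hom_mult[OF \<iota>(1) that] .
  have \<iota>1: "\<iota> \<one>\<^bsub>H\<^esub> = \<one>\<^bsub>G\<^esub>" using Group.hom_one[OF \<iota>(1) H G] .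
  define cs where "cs = (\<lambda>x. (\<lambda>h. \<iota> h \<otimes>\<^bsub>G\<^esub> x) ` carrier H)"
  have cs_sub: "cs (\<iota> h \<otimes>\<^bsub>G\<^esub> x) \<subseteq> cs x" if "h \<in> carrier H" "x \<in> carrier G" for h x
  proof
    fix y assume "y \<in> cs (\<iota> h \<otimes>\<^bsub>G\<^esub> x)"
    then obtain h' where "h' \<in> carrier H" "y = \<iota> h' \<otimes>\<^bsub>G\<^esub> (\<iota> h \<otimes>\<^bsub>G\<^esub> x)" by (auto simp: cs_def)
    then have "y = \<iota> (h' \<otimes>\<^bsub>H\<^esub> h) \<otimes>\<^bsub>G\<^esub> x" "h' \<otimes>\<^bsub>H\<^esub> h \<in> carrier H"
      using that \<iota>c by (auto simp: \<iota>m G.m_assoc)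
    then show "y \<in> cs x" by (auto simp: cs_def)
  qed
  have cancel: "x = \<iota> (inv\<^bsub>H\<^esub> h) \<otimes>\<^bsub>G\<^esub> (\<iota> h \<otimes>\<^bsub>G\<^esub> x)" if "h \<in> carrier H" "x \<in> carrier G" for h x
    using that \<iota>c \<iota>m[of "inv\<^bsub>H\<^esub> h" h] \<iota>1 by (simp add: G.m_assoc[symmetric])
  have cs_eq: "cs (\<iota> h \<otimes>\<^bsub>G\<^esub> x) = cs x" if hx: "h \<in> carrier H" "x \<in> carrier G" for h x
    using cs_sub[OF hx] cs_sub[of "inv\<^bsub>H\<^esub> h" "\<iota> h \<otimes>\<^bsub>G\<^esub> x"] cancel[OF hx] hx \<iota>c by auto
  define t where "t = (\<lambda>x. SOME y. y \<in> cs x)"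
  have t_cs: "t x \<in> cs x" for x
  proof -
    have "\<iota> \<one>\<^bsub>H\<^esub> \<otimes>\<^bsub>G\<^esub> x \<in> cs x" unfolding cs_def by blast
    then show ?thesis unfolding t_def by (rule someI)
  qed
  have t_eq: "t (\<iota> h \<otimes>\<^bsub>G\<^esub> x) = t x" if "h \<in> carrier H" "x \<in> carrier G" for h x
    by (simp add: t_def cs_eq[OF that])
  have t_carrier: "t x \<in> carrier G" if "x \<in> carrier G" for x using t_cs[of x] \<iota>c that by (auto simp: cs_def)
  have ex: "\<exists>j. j \<in> carrier H \<and> x = \<iota> j \<otimes>\<^bsub>G\<^esub> t x" if x: "x \<in> carrier G" for x
  proof -
    obtain h where h: "h \<in> carrier H" "t x = \<iota> h \<otimes>\<^bsub>G\<^esub> x" using t_cs[of x] by (auto simp: cs_def)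
    then show ?thesis using cancel[OF h(1) x] by (intro exI[of _ "inv\<^bsub>H\<^esub> h"]) auto
  qed
  define d where "d = (\<lambda>x. SOME j. j \<in> carrier H \<and> x = \<iota> j \<otimes>\<^bsub>G\<^esub> t x)"
  have d: "d x \<in> carrier H" "x = \<iota> (d x) \<otimes>\<^bsub>G\<^esub> t x" if "x \<in> carrier G" for x
    using someI_ex[OF ex[OF that]] unfolding d_def by auto
  have d_eq: "d (\<iota> h \<otimes>\<^bsub>G\<^esub> x) = h \<otimes>\<^bsub>H\<^esub> d x" if hx: "h \<in> carrier H" "x \<in> carrier G" for h x
  proof -
    have hxc: "\<iota> h \<otimes>\<^bsub>G\<^esub> x \<in> carrier G" using hx \<iota>c by simp
    have "\<iota> (d (\<iota> h \<otimes>\<^bsub>G\<^esub> x)) \<otimes>\<^bsub>G\<^esub> t x = \<iota> h \<otimes>\<^bsub>G\<^esub> x" using d(2)[OF hxc] t_eq[OF hx] by simp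
    also have "\<dots> = \<iota> h \<otimes>\<^bsub>G\<^esub> (\<iota> (d x) \<otimes>\<^bsub>G\<^esub> t x)" using d(2)[OF hx(2)] by simp
    also have "\<dots> = \<iota> (h \<otimes>\<^bsub>H\<^esub> d x) \<otimes>\<^bsub>G\<^esub> t x"
      using hx d(1)[OF hx(2)] \<iota>c t_carrier[OF hx(2)] by (simp add: \<iota>m G.m_assoc)
    finally have "\<iota> (d (\<iota> h \<otimes>\<^bsub>G\<^esub> x)) = \<iota> (h \<otimes>\<^bsub>H\<^esub> d x)"
      using \<iota>c d(1)[OF hxc] d(1)[OF hx(2)] hx t_carrier[OF hx(2)] by (simp add: G.r_cancel)
    then show ?thesis using \<iota>(2) d(1)[OF hxc] d(1)[OF hx(2)] hx by (auto dest: inj_onD)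
  qed
  obtain e :: "'g \<Rightarrow> nat" where e: "inj_on e (carrier G)" using finite_imp_inj_to_nat_seg[OF fin] by metis
  define \<sigma> where "\<sigma> = (\<lambda>(N::nat) m. (\<Sum>x\<in>#m. replicate_mset (N ^ e (t x)) (d x)))"
  have cnt: "count (\<sigma> N m) j = weight (\<lambda>x. e (t x)) N (filter_mset (\<lambda>x. d x = j) m)" for N m j
    by (induction m) (auto simp: \<sigma>_def weight_def)
  show thesis
  proof (rule that[of \<sigma>])
    show "\<sigma> N {#} = {#}" "\<sigma> N (a + b) = \<sigma> N a + \<sigma> N b" for N a b by (simp_all add: \<sigma>_def)
    show "set_mset (\<sigma> N m) \<subseteq> carrier H" if "set_mset m \<subseteq> carrier G" for N m
      using that d(1) by (induction m) (auto simp: \<sigma>_def split: if_splits)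
    show "\<sigma> N (image_mset (\<lambda>x. \<iota> h \<otimes>\<^bsub>G\<^esub> x) m) = image_mset (\<lambda>x. h \<otimes>\<^bsub>H\<^esub> x) (\<sigma> N m)"
      if "h \<in> carrier H" "set_mset m \<subseteq> carrier G" for N h m
      using that(2) by (induction m) (auto simp: \<sigma>_def t_eq[OF that(1)] d_eq[OF that(1)])
    show "m = m'" if m: "set_mset m \<subseteq> carrier G" "set_mset m' \<subseteq> carrier G" "size m < N" "size m' < N"
      "\<sigma> N m = \<sigma> N m'" for N m m'
    proof -
      have eq: "filter_mset (\<lambda>x. d x = j) m = filter_mset (\<lambda>x. d x = j) m'" for j
      proof (rule weight_inj)
        show "finite {x \<in> carrier G. d x = j}" using fin by simp
        show "inj_on (\<lambda>x. e (t x)) {x \<in> carrier G. d x = j}"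
        proof (rule inj_onI)
          fix x y assume xy: "x \<in> {x \<in> carrier G. d x = j}" "y \<in> {x \<in> carrier G. d x = j}" "e (t x) = e (t y)"
          then have "t x = t y" using e t_carrier by (auto dest: inj_onD)
          then show "x = y" using d(2)[of x] d(2)[of y] xy by auto
        qed
        show "weight (\<lambda>x. e (t x)) N (filter_mset (\<lambda>x. d x = j) m)
          = weight (\<lambda>x. e (t x)) N (filter_mset (\<lambda>x. d x = j) m')"
          using cnt[of N m j] cnt[of N m' j] m(5) by simp
        show "size (filter_mset (\<lambda>x. d x = j) m) < N" "size (filter_mset (\<lambda>x. d x = j) m') < N"
          using m(3,4) size_filter_mset_lesseq le_less_trans by blast+
      qed (use m(1,2) in auto)
      show ?thesis
      proof (rule multiset_eqI)
        fix x
        have "count (filter_mset (\<lambda>y. d y = d x) m) x = count (filter_mset (\<lambda>y. d y = d x) m') x" by (simp only: eq)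
        then show "count m x = count m' x" by simp
      qed
    qed
  qed
qed

lemma (in cring) mpoly_map_nonzero:
  assumes P: "P \<in> carrier (mpoly_ring R I)" "P \<noteq> \<zero>\<^bsub>mpoly_ring R I\<^esub>" and inj: "inj_on \<tau> {m. P m \<noteq> \<zero>}"
  shows "mpoly_map R R (\<lambda>a. a) \<tau> P \<noteq> \<zero>\<^bsub>mpoly_ring R J\<^esub>"
proof -
  obtain m where m: "P m \<noteq> \<zero>" using P(2) by (auto simp: fun_eq_iff)
  have "{i. P i \<noteq> \<zero> \<and> \<tau> i = \<tau> m} = {m}" using m inj by (auto dest: inj_onD)
  moreover have "P m \<in> carrier R" using P(1) by (auto simp: mpoly_carrier supported_def)
  ultimately have "mpoly_map R R (\<lambda>a. a) \<tau> P (\<tau> m) = P m"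
    by (auto simp: mpoly_map_def collect_def finsum_insert)
  then show ?thesis using m by auto
qed

lemma (in group) cyclic_embedding:
  assumes g: "g \<in> carrier G" "ord g = N" and N: "N > 0"
  shows "(\<lambda>j::int. g [^] j) \<in> hom (integer_mod_group N) G" "inj_on (\<lambda>j::int. g [^] j) (carrier (integer_mod_group N))"
proof -
  show "(\<lambda>j::int. g [^] j) \<in> hom (integer_mod_group N) G"
  proof (rule homI)
    fix i j assume "i \<in> carrier (integer_mod_group N)" "j \<in> carrier (integer_mod_group N)"
    have "int N dvd (i + j) - (i + j) mod int N" by (simp add: minus_mod_eq_mult_div)
    then have "g [^] ((i + j) mod int N) = g [^] (i + j)" using int_pow_eq[OF g(1)] g(2) by simp
    then show "g [^] (i \<otimes>\<^bsub>integer_mod_group N\<^esub> j) = g [^] i \<otimes> g [^] j" using g(1) by (simp add: int_pow_mult)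
  qed (use g in auto)
  show "inj_on (\<lambda>j::int. g [^] j) (carrier (integer_mod_group N))"
  proof (rule inj_onI)
    fix i j assume ij: "i \<in> carrier (integer_mod_group N)" "j \<in> carrier (integer_mod_group N)" "g [^] i = g [^] j"
    then have "int N dvd j - i" using int_pow_eq[OF g(1)] g(2) by simp
    then have "i mod int N = j mod int N" by (metis mod_eq_dvd_iff dvd_minus_iff minus_diff_eq)
    then show "i = j" using ij(1,2) N by (simp add: carrier_integer_mod_group)
  qed
qed

text \<open>
  Because inertia is trivial, each \<open>h \<noteq> 1\<close> in \<open>H\<close> moves the residue of some fraction \<open>a h / b h\<close> in \<open>L\<close>.  This is expressed
  by finitely many nonzero polynomials over \<open>k\<close>: the reductions of \<open>b h\<close> and of its translate, and the
  difference \<open>diff h\<close> of cross products.  A collapse of variables that is injective on their monomials keeps them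
  nonzero, so composing it with the reduction gives a residue map to the rational functions on the regular representation of \<open>H\<close>
  under which the image of \<open>L\<close> is still faithful.
\<close>

lemma (in gauss_valuation) descent_to_subgroup:
  fixes \<iota> :: "'h \<Rightarrow> 'g"
  assumes L: "L \<in> faithful_intermediate_fields F G" and I: "inertia L = {\<one>\<^bsub>G\<^esub>}" and surj: "\<psi> ` A = carrier k"
    and H: "group H" and \<iota>: "\<iota> \<in> hom H G" "inj_on \<iota> (carrier H)"
  shows "essential_dimension k H \<le> trdeg P.E (regular_const F G) L"
proof -
  interpret H: group H by (rule H)
  have \<iota>c: "\<iota> h \<in> carrier G" if "h \<in> carrier H" for h using hom_in_carrier[OF \<iota>(1) that] .
  have finH: "finite (carrier H)"
    using \<iota>(2) P.finite_G \<iota>c by (auto intro: inj_on_finite[of \<iota> "carrier H" "carrier G"])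
  interpret Y: regular_rep k H by (intro regular_rep.intro regular_rep_axioms.intro Q.F.field_axioms H finH)
  have Lf: "subfield L P.E" "regular_const F G \<subseteq> L" "faithful_action G L (\<lambda>g. restrict (P.act g) L)"
    using L by (auto simp: faithful_intermediate_fields_def)
  have Lc: "L \<subseteq> carrier P.E" using subringE(1)[OF subfieldE(1)[OF Lf(1)]] .
  have inv: "P.act g x \<in> L" if "g \<in> carrier G" "x \<in> L" for g x
    using P.faithful_action_iff[OF Lc] Lf(3) that by blast
  obtain \<sigma> :: "nat \<Rightarrow> 'g multiset \<Rightarrow> 'h multiset" where \<sigma>: "\<And>N. \<sigma> N {#} = {#}" "\<And>N a b. \<sigma> N (a + b) = \<sigma> N a + \<sigma> N b"
    "\<And>N m. set_mset m \<subseteq> carrier G \<Longrightarrow> set_mset (\<sigma> N m) \<subseteq> carrier H"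
    "\<And>N h m. h \<in> carrier H \<Longrightarrow> set_mset m \<subseteq> carrier G \<Longrightarrow> \<sigma> N (P.shift (\<iota> h) m) = Y.shift h (\<sigma> N m)"
    and \<sigma>_inj: "\<And>N m m'. set_mset m \<subseteq> carrier G \<Longrightarrow> set_mset m' \<subseteq> carrier G \<Longrightarrow> size m < N \<Longrightarrow> size m' < N \<Longrightarrow>
      \<sigma> N m = \<sigma> N m' \<Longrightarrow> m = m'"
    using equivariant_collapse_exists[OF P.G.group_axioms H P.finite_G \<iota>] by blast
  let ?H' = "carrier H - {\<one>\<^bsub>H\<^esub>}"
  have "\<exists>a b. a \<in> B \<and> b \<in> B \<and> red b \<noteq> \<zero>\<^bsub>Q.D\<^esub> \<and> fraction P.D a b \<in> L \<and>
      res (P.act (\<iota> h) (fraction P.D a b)) \<noteq> res (fraction P.D a b)" if h: "h \<in> ?H'" for h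
  proof -
    have "\<iota> h \<noteq> \<one>\<^bsub>G\<^esub>"
    proof
      assume "\<iota> h = \<one>\<^bsub>G\<^esub>"
      then have "\<iota> h = \<iota> \<one>\<^bsub>H\<^esub>" using Group.hom_one[OF \<iota>(1) H P.G.group_axioms] by simp
      then show False using \<iota>(2) h by (auto dest: inj_onD)
    qed
    then have "\<iota> h \<notin> inertia L" using I by simp
    then obtain x where x: "x \<in> L" "x \<in> V" "res (P.act (\<iota> h) x) \<noteq> res x" using \<iota>c h by (auto simp: inertia_def)
    obtain a b where "a \<in> B" "b \<in> B" "red b \<noteq> \<zero>\<^bsub>Q.D\<^esub>" "x = fraction P.D a b" using x(2) by (elim fp.localizationE)
    then show ?thesis using x by blast
  qed
  then obtain a b where ab: "\<And>h. h \<in> ?H' \<Longrightarrow> a h \<in> B" "\<And>h. h \<in> ?H' \<Longrightarrow> b h \<in> B"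
    "\<And>h. h \<in> ?H' \<Longrightarrow> red (b h) \<noteq> \<zero>\<^bsub>Q.D\<^esub>" "\<And>h. h \<in> ?H' \<Longrightarrow> fraction P.D (a h) (b h) \<in> L"
    "\<And>h. h \<in> ?H' \<Longrightarrow> res (P.act (\<iota> h) (fraction P.D (a h) (b h))) \<noteq> res (fraction P.D (a h) (b h))"
    by metis
  define ga where "ga = (\<lambda>h. regular_poly_act F G (\<iota> h) (a h))"
  define gb where "gb = (\<lambda>h. regular_poly_act F G (\<iota> h) (b h))"
  define diff where "diff = (\<lambda>h. red (ga h) \<otimes>\<^bsub>Q.D\<^esub> red (b h) \<ominus>\<^bsub>Q.D\<^esub> red (a h) \<otimes>\<^bsub>Q.D\<^esub> red (gb h))"
  have g: "ga h \<in> B" "gb h \<in> B" "red (gb h) \<noteq> \<zero>\<^bsub>Q.D\<^esub>" "diff h \<noteq> \<zero>\<^bsub>Q.D\<^esub>"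
    "P.act (\<iota> h) (fraction P.D (a h) (b h)) = fraction P.D (ga h) (gb h)" if h: "h \<in> ?H'" for h
  proof -
    have \<iota>h: "\<iota> h \<in> carrier G" using \<iota>c h by auto
    note n = fp.denominator[OF ab(2,3)[OF h]]
    have aD: "a h \<in> carrier P.D" using fp.A_closed(3)[OF ab(1)[OF h]] .
    show ga: "ga h \<in> B" and gb: "gb h \<in> B"
      using act_equivariant(1)[OF \<iota>h \<iota>h _ ab(1)[OF h]] act_equivariant(1)[OF \<iota>h \<iota>h _ ab(2)[OF h]]
      by (auto simp: ga_def gb_def)
    have "red (gb h) = regular_poly_act k G (\<iota> h) (red (b h))"
      using act_equivariant(2)[OF \<iota>h \<iota>h _ ab(2)[OF h]] by (simp add: gb_def)
    then show gb0: "red (gb h) \<noteq> \<zero>\<^bsub>Q.D\<^esub>"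
      using Q.act_fraction(3)[OF \<iota>h fp.hom_closed[OF ab(1)[OF h]]] n by auto
    show eq: "P.act (\<iota> h) (fraction P.D (a h) (b h)) = fraction P.D (ga h) (gb h)"
      unfolding ga_def gb_def using P.act_fraction(1)[OF \<iota>h aD] n by blast
    note ng = fp.denominator[OF gb gb0]
    have c: "red (a h) \<in> carrier Q.D" "red (ga h) \<in> carrier Q.D" "red (b h) \<in> carrier Q.D" "red (gb h) \<in> carrier Q.D"
      using fp.hom_closed ab(1,2)[OF h] ga gb by auto
    have "fraction Q.D (red (ga h)) (red (gb h)) \<noteq> fraction Q.D (red (a h)) (red (b h))"
      using ab(5)[OF h] unfolding eq fp.residue_fraction[OF ga gb gb0] fp.residue_fraction[OF ab(1-3)[OF h]] .
    then have "red (ga h) \<otimes>\<^bsub>Q.D\<^esub> red (b h) \<noteq> red (a h) \<otimes>\<^bsub>Q.D\<^esub> red (gb h)"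
      using c n ng by (subst (asm) Q.D.fraction_eq_iff) auto
    then show "diff h \<noteq> \<zero>\<^bsub>Q.D\<^esub>" using c by (simp add: diff_def Q.D.r_right_minus_eq)
  qed
  have cQ: "red (a h) \<in> carrier Q.D" "red (ga h) \<in> carrier Q.D" "red (b h) \<in> carrier Q.D" "red (gb h) \<in> carrier Q.D"
    "diff h \<in> carrier Q.D" if "h \<in> ?H'" for h
    using fp.hom_closed ab(1,2)[OF that] g(1,2)[OF that] by (auto simp: diff_def)
  \<comment> \<open>The monomials that the collapse has to keep apart; \<open>N\<close> exceeds their sizes.\<close>
  define U where "U = (\<Union>h\<in>?H'. {m. red (b h) m \<noteq> \<zero>\<^bsub>k\<^esub>} \<union> {m. red (gb h) m \<noteq> \<zero>\<^bsub>k\<^esub>} \<union> {m. diff h m \<noteq> \<zero>\<^bsub>k\<^esub>})"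
  have finU: "finite U" using finH cQ unfolding U_def Q.D_carrier by (auto simp: supported_def)
  have supp: "set_mset m \<subseteq> carrier G" if "d \<in> carrier Q.D" "d m \<noteq> \<zero>\<^bsub>k\<^esub>" for d m
    using that by (simp add: Q.D_carrier supported_def)
  have UG: "set_mset m \<subseteq> carrier G" if mU: "m \<in> U" for m
  proof -
    obtain h where h: "h \<in> ?H'" "red (b h) m \<noteq> \<zero>\<^bsub>k\<^esub> \<or> red (gb h) m \<noteq> \<zero>\<^bsub>k\<^esub> \<or> diff h m \<noteq> \<zero>\<^bsub>k\<^esub>"
      using mU unfolding U_def by blast
    then show ?thesis using supp[OF cQ(3)[OF h(1)]] supp[OF cQ(4)[OF h(1)]] supp[OF cQ(5)[OF h(1)]] by blast
  qed
  define N where "N = Suc (\<Sum>m\<in>U. size m)"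
  have "size m < N" if "m \<in> U" for m
    unfolding N_def using that finU by (intro le_imp_less_Suc member_le_sum) auto
  then have injU: "inj_on (\<sigma> N) U" by (intro inj_onI \<sigma>_inj[OF UG UG]) auto
  let ?\<Phi> = "mpoly_map k k (\<lambda>a. a) (\<sigma> N)"
  interpret \<Phi>: subring_hom Q.D Y.D "carrier Q.D" ?\<Phi>
    unfolding Q.D_carrier
    by (rule subring_hom.mpoly_map_subring_hom[OF Q.F.id_subring_hom]) (use \<sigma> in auto)
  have \<Phi>_nz: "?\<Phi> d \<noteq> \<zero>\<^bsub>Y.D\<^esub>" if "d \<in> carrier Q.D" "d \<noteq> \<zero>\<^bsub>Q.D\<^esub>" "{m. d m \<noteq> \<zero>\<^bsub>k\<^esub>} \<subseteq> U" for d
    by (rule Q.F.mpoly_map_nonzero[OF that(1,2) inj_on_subset[OF injU that(3)]])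
  interpret v: valued_reduction F G k H A \<psi> "\<sigma> N" T
    by (intro valued_reduction.intro reduction.intro reduction_axioms.intro valued_reduction_axioms.intro
        P.regular_rep_axioms Y.regular_rep_axioms subring_hom_axioms T val \<sigma>)
  have vred: "v.red x = ?\<Phi> (red x)" if "x \<in> B" for x
    using mpoly_map_comp[OF subring_hom_axioms Q.F.id_subring_hom hom_closed, of "carrier G" x "\<sigma> N" "\<lambda>m. m"] that by simp
  let ?L = "v.res ` (L \<inter> v.V)"
  have eqv: "v.res (P.act (\<iota> h) x) = Y.act h (v.res x)" "P.act (\<iota> h) x \<in> v.V" if "h \<in> carrier H" "x \<in> v.V" for h x
    using v.residue_equivariant[OF \<iota>c[OF that(1)] that(1) \<sigma>(4)[OF that(1)] that(2)] by auto
  have "?L \<in> faithful_intermediate_fields k H"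
    unfolding faithful_intermediate_fields_def mem_Collect_eq
  proof (intro conjI)
    show subf: "subfield ?L Y.E" by (rule v.pl.residue_subfield[OF Lf(1)])
    show "regular_const k H \<subseteq> ?L"
    proof
      fix y assume "y \<in> regular_const k H"
      then obtain c where c: "c \<in> carrier k" "y = Y.const c" by (auto simp: Y.regular_const_eq)
      then obtain a where a: "a \<in> A" "c = \<psi> a" using surj by blast
      have "P.const a \<in> L" using Lf(2) A_closed(3)[OF a(1)] by (auto simp: P.regular_const_eq)
      then show "y \<in> ?L" using v.res_const[OF a(1)] c(2) a(2) by (metis IntI imageI)
    qed
    have sub: "?L \<subseteq> carrier Y.E" using subringE(1)[OF subfieldE(1)[OF subf]] .
    show "faithful_action H ?L (\<lambda>g. restrict (Y.act g) ?L)"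
      unfolding Y.faithful_action_iff[OF sub]
    proof (intro conjI ballI impI)
      fix h y assume h: "h \<in> carrier H" and "y \<in> ?L"
      then obtain x where x: "x \<in> L" "x \<in> v.V" "y = v.res x" by auto
      have "P.act (\<iota> h) x \<in> L \<inter> v.V" using inv[OF \<iota>c[OF h] x(1)] eqv(2)[OF h x(2)] by simp
      then show "Y.act h y \<in> ?L" using eqv(1)[OF h x(2)] x(3) by (metis imageI)
    next
      fix h assume h0: "h \<in> carrier H" "h \<noteq> \<one>\<^bsub>H\<^esub>"
      then have h: "h \<in> ?H'" by simp
      have b0: "v.red (b h) \<noteq> \<zero>\<^bsub>Y.D\<^esub>" and gb0: "v.red (gb h) \<noteq> \<zero>\<^bsub>Y.D\<^esub>" and d0: "?\<Phi> (diff h) \<noteq> \<zero>\<^bsub>Y.D\<^esub>"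
        unfolding vred[OF ab(2)[OF h]] vred[OF g(2)[OF h]]
        using \<Phi>_nz[OF cQ(3)[OF h] ab(3)[OF h]] \<Phi>_nz[OF cQ(4)[OF h] g(3)[OF h]] \<Phi>_nz[OF cQ(5)[OF h] g(4)[OF h]] h
        by (auto simp: U_def)
      let ?x = "fraction P.D (a h) (b h)"
      have xV: "?x \<in> L \<inter> v.V" using ab(4)[OF h] v.fp.localizationI[OF ab(1,2)[OF h] b0] by simp
      have c: "v.red (a h) \<in> carrier Y.D" "v.red (ga h) \<in> carrier Y.D" "v.red (b h) \<in> carrier Y.D" "v.red (gb h) \<in> carrier Y.D"
        using v.fp.hom_closed ab(1,2)[OF h] g(1,2)[OF h] by auto
      have "?\<Phi> (diff h) = v.red (ga h) \<otimes>\<^bsub>Y.D\<^esub> v.red (b h) \<ominus>\<^bsub>Y.D\<^esub> v.red (a h) \<otimes>\<^bsub>Y.D\<^esub> v.red (gb h)"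
        unfolding diff_def vred[OF ab(1)[OF h]] vred[OF ab(2)[OF h]] vred[OF g(1)[OF h]] vred[OF g(2)[OF h]]
          Q.D.minus_eq Y.D.minus_eq
        using cQ[OF h] by (simp add: \<Phi>.hom_add \<Phi>.hom_mult \<Phi>.hom_minus)
      then have ne: "v.red (ga h) \<otimes>\<^bsub>Y.D\<^esub> v.red (b h) \<noteq> v.red (a h) \<otimes>\<^bsub>Y.D\<^esub> v.red (gb h)"
        using d0 c by (auto simp: Y.D.r_right_minus_eq)
      have "v.res (P.act (\<iota> h) ?x) \<noteq> v.res ?x"
        unfolding g(5)[OF h] v.fp.residue_fraction[OF g(1,2)[OF h] gb0] v.fp.residue_fraction[OF ab(1,2)[OF h] b0]
        using ne c b0 gb0 by (subst Y.D.fraction_eq_iff) auto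
      then have "Y.act h (v.res ?x) \<noteq> v.res ?x" using eqv(1)[OF h0(1), of ?x] xV by auto
      then show "\<exists>y\<in>?L. Y.act h y \<noteq> y" using xV by blast
    qed
  qed
  then have "essential_dimension k H \<le> trdeg Y.E (regular_const k H) ?L"
    unfolding essential_dimension_def by (rule INF_lower)
  also have "\<dots> \<le> trdeg P.E (regular_const F G) L" by (rule v.trdeg_residue_field_le[OF Lf(1,2)])
  finally show ?thesis .
qed

section \<open>The lower bound in characteristic zero\<close>

theorem proposition4p3:
  fixes p n :: nat
    and G :: "('g, 'b) monoid_scheme"
    and K :: "('a, 'c) ring_scheme"
  assumes "Factorial_Ring.prime p"
    and "group G" and "finite (carrier G)"
    and "weakly_tame p G"
    and "\<exists>g \<in> carrier G. group.ord G g = p ^ n"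
    and "field K" and "ring_char K = 0"
    and "infinite (UNIV :: 'k set)"
    and ledet: "\<And>k :: 'k ring. field k \<Longrightarrow> ring_char k = p \<Longrightarrow>
      essential_dimension k (integer_mod_group (p ^ n)) = enat n"
  shows "essential_dimension K G \<ge> enat n"
  unfolding essential_dimension_def
proof (rule INF_greatest)
  fix L assume L: "L \<in> faithful_intermediate_fields K G"
  interpret K: field K by fact
  interpret G: group G by fact
  interpret P: regular_rep K G by (intro regular_rep.intro regular_rep_axioms.intro) fact+
  have Lf: "subfield L P.E" "regular_const K G \<subseteq> L" "faithful_action G L (\<lambda>g. restrict (P.act g) L)"
    using L by (auto simp: faithful_intermediate_fields_def)
  have Lc: "L \<subseteq> carrier P.E" using subringE(1)[OF subfieldE(1)[OF Lf(1)]] .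
  have inv: "P.act g x \<in> L" if "g \<in> carrier G" "x \<in> L" for g x
    using P.faithful_action_iff[OF Lc] Lf(3) that by blast
  let ?G' = "carrier G - {\<one>\<^bsub>G\<^esub>}"
  have "\<exists>a b. a \<in> carrier P.D \<and> b \<in> P.D.nonzero \<and> fraction P.D a b \<in> L \<and>
      P.act g (fraction P.D a b) \<noteq> fraction P.D a b" if g: "g \<in> ?G'" for g
  proof -
    obtain x where x: "x \<in> L" "P.act g x \<noteq> x" using P.faithful_action_iff[OF Lc] Lf(3) g by blast
    have "x \<in> carrier P.E" using Lc x(1) by (rule subsetD)
    then obtain a b where "a \<in> carrier P.D" "b \<in> P.D.nonzero" "x = fraction P.D a b" by (elim P.E_carrierE)
    then show ?thesis using x by blast
  qed
  then obtain a b where ab: "\<And>g. g \<in> ?G' \<Longrightarrow> a g \<in> carrier P.D" "\<And>g. g \<in> ?G' \<Longrightarrow> b g \<in> P.D.nonzero"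
    "\<And>g. g \<in> ?G' \<Longrightarrow> fraction P.D (a g) (b g) \<in> L"
    "\<And>g. g \<in> ?G' \<Longrightarrow> P.act g (fraction P.D (a g) (b g)) \<noteq> fraction P.D (a g) (b g)" by metis
  \<comment> \<open>The coefficients of one fraction in \<open>L\<close> moved by \<open>g\<close>, for each \<open>g \<noteq> 1\<close>.\<close>
  define C where "C = (\<Union>g\<in>?G'. range (a g) \<union> range (b g))"
  have poly: "finite {m. d m \<noteq> \<zero>\<^bsub>K\<^esub>}" "range d \<subseteq> carrier K" if "d \<in> carrier P.D" for d
    using that by (simp_all add: P.D_carrier supported_def)
  have supp_T: "supported K (carrier G) T d" if "d \<in> carrier P.D" "range d \<subseteq> T" for d T
    using that unfolding P.D_carrier supported_def by blast
  have fin_range: "finite (range d)" if "d \<in> carrier P.D" for d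
  proof (rule finite_subset)
    show "range d \<subseteq> insert \<zero>\<^bsub>K\<^esub> (d ` {m. d m \<noteq> \<zero>\<^bsub>K\<^esub>})" by auto
    show "finite (insert \<zero>\<^bsub>K\<^esub> (d ` {m. d m \<noteq> \<zero>\<^bsub>K\<^esub>}))" using poly(1)[OF that] by simp
  qed
  have bD: "b g \<in> carrier P.D" if "g \<in> ?G'" for g using ab(2)[OF that] by simp
  have "finite C"
    unfolding C_def using assms(3) fin_range[OF ab(1)] fin_range[OF bD] by (intro finite_UN_I finite_UnI) auto
  then have "countable C" by (rule countable_finite)
  have CK: "C \<subseteq> carrier K"
    unfolding C_def using poly(2)[OF ab(1)] poly(2)[OF bD] by (intro UN_least Un_least)
  define T where "T = generate_field K C"
  have T: "subfield T K" "countable T"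
    unfolding T_def using K.generate_field_is_subfield[OF CK] K.countable_generate_field[OF \<open>countable C\<close>] by auto
  have CT: "C \<subseteq> T" unfolding T_def by (rule subsetI, rule generate_field.incl)
  obtain k :: "'k ring" and A \<psi> where k: "field k" "ring_char k = p" and A: "A \<subseteq> T"
    and \<psi>: "subring_hom K k A \<psi>" "\<psi> ` A = carrier k"
    and val: "\<And>x. x \<in> T \<Longrightarrow> x \<noteq> \<zero>\<^bsub>K\<^esub> \<Longrightarrow> x \<in> A \<or> inv\<^bsub>K\<^esub> x \<in> A"
    using K.residue_field_exists[OF assms(7,1) T assms(8)] by blast
  interpret Q: regular_rep k G by (intro regular_rep.intro regular_rep_axioms.intro k(1)) fact+
  interpret v: gauss_valuation K G k A \<psi> T
    by (intro gauss_valuation.intro valued_reduction.intro reduction.intro reduction_axioms.intro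
        valued_reduction_axioms.intro P.regular_rep_axioms Q.regular_rep_axioms \<psi>(1) T(1) A val) auto
  have defined: "\<exists>f\<in>L \<inter> v.rT.V. P.act g f \<noteq> f" if "g \<in> carrier G" "g \<noteq> \<one>\<^bsub>G\<^esub>" for g
  proof -
    have g: "g \<in> ?G'" using that by simp
    have "range (a g) \<subseteq> C" "range (b g) \<subseteq> C" unfolding C_def using g by blast+
    note r = subset_trans[OF this(1) CT] subset_trans[OF this(2) CT]
    have "supported K (carrier G) T (a g)" "supported K (carrier G) T (b g)"
      using supp_T[OF ab(1)[OF g] r(1)] supp_T[OF bD[OF g] r(2)] .
    then have "fraction P.D (a g) (b g) \<in> v.rT.V" using v.rT_V_iff ab(2)[OF g] by blast
    then show ?thesis using ab(3,4)[OF g] by blast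
  qed
  have inertia: "v.inertia L = {\<one>\<^bsub>G\<^esub>}"
  proof (rule v.inertia_trivial[where p = p])
    show "P.act g x \<in> L" if "g \<in> carrier G" "x \<in> L" for g x using inv[OF that] .
    show "\<exists>f\<in>L \<inter> v.rT.V. P.act g f \<noteq> f" if "g \<in> carrier G" "g \<noteq> \<one>\<^bsub>G\<^esub>" for g using defined[OF that] .
  qed (fact Lf(1) Lf(2) assms(1) k(2) assms(4))+
  obtain g where g: "g \<in> carrier G" "group.ord G g = p ^ n" using assms(5) by blast
  have "p ^ n > 0" using prime_gt_0_nat[OF assms(1)] by simp
  note \<iota> = G.cyclic_embedding[OF g this]
  have "essential_dimension k (integer_mod_group (p ^ n)) \<le> trdeg P.E (regular_const K G) L"
    by (rule v.descent_to_subgroup[OF L inertia \<psi>(2) group_integer_mod_group \<iota>])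
  then show "enat n \<le> trdeg P.E (regular_const K G) L" using ledet[OF k] by simp
qed

end
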